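(* Let $n\ge 1$, let $\mathfrak g=\mathfrak{osp}(1|2n)$ with odd part $\mathfrak g_{\bar1}=E=\mathbb C^{2n}$ and symplectic form $\omega$ on $E$, and for $y\in E$ let $D_y^{(1/2)}$ be the operator describing the action of $y$ on superforms of weight $1/2$ on the super Siegel plane $S\mathfrak H_n$. The operators $D_y^{(1/2)}$, $y\in E$, on $\mathcal M_{\mathbb D}$ and on $\underline{\mathrm{Ker}}(\mathbb D)$ satisfy the even Heisenberg relations, i.e. $$[D_y^{(1/2)},D_z^{(1/2)}]_-=\tfrac12\,\omega(y,z)\cdot 1,\qquad y,z\in E.$$ So the morphisms of associative algebras $U(\mathfrak g)\to\mathrm{End}_{\mathcal D_{S\mathfrak H_n}}(\mathcal M_{\mathbb D})$ and $U(\mathfrak g)\to\mathrm{End}(\underline{\mathrm{Ker}}(\mathbb D))$ given by the action of $\mathfrak g$ descend to morphisms of associative algebras $$\mathrm{Heis}_n\to\mathrm{End}_{\mathcal D_{S\mathfrak H_n}}(\mathcal M_{\mathbb D}),\qquad \mathrm{Heis}_n\to\mathrm{End}(\underline{\mathrm{Ker}}(\mathbb D)),$$ where $\mathrm{End}(\underline{\mathrm{Ker}}(\mathbb D))$ denotes the algebra of endomorphisms of $\underline{\mathrm{Ker}}(\mathbb D)$ as a sheaf of $\mathbb C$-vector spaces.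
   Context: $E$ has basis $p_i,q_i$ ($i=1,\dots,n$) with $\omega(p_i,q_j)=\delta_{ij}$, $\omega(p_i,p_j)=\omega(q_i,q_j)=0$. $\mathrm{Heis}_n$ is the associative algebra generated by $E$ with relations $yz-zy=\frac12\omega(y,z)\cdot 1$. The Lie superalgebra $\mathfrak g=\mathfrak{osp}(1|2n)$ is $E\oplus S^2E$ with odd part $E$ and even part $S^2E=\mathfrak{sp}(2n)$, embedded in $\mathrm{Heis}_n$ by $y\mapsto y$ on $E$ and by symmetrized products on $S^2E$, with superbracket the supercommutator ($E$ being odd); this gives a surjection $U(\mathfrak g)\to\mathrm{Heis}_n$, along which the morphisms descend. $[a,b]_-=ab-ba$ is the ordinary (non-super) commutator, even for odd $a,b$. The super Siegel plane $S\mathfrak H_n$ is the complex supermanifold with even coordinates $T=\|t_{ij}\|_{i,j=1}^n$ and odd coordinates $\xi_1,\dots,\xi_n$ subject to the relations $t_{ij}-t_{ji}+\xi_i\xi_j=0$ ($i\ne j$), the symmetric matrix $v=\frac12(T+T^t)$ having positive definite imaginary part. Its underlying manifold is the Siegel plane $\mathfrak H_n$ of complex symmetric $n\times n$ matrices with positive definite imaginary part. $\mathcal O_{S\mathfrak H_n}$ and $\mathcal D_{S\mathfrak H_n}$ are its sheaves of holomorphic superfunctions and of holomorphic differential operators. The spinor derivatives $D_i=\frac{\partial}{\partial\xi_i}-\sum_j\xi_j\frac{\partial}{\partial t_{ij}}$ are tangent to the relations and so are vector fields on $S\mathfrak H_n$. Superforms of weight $1/2$ are sections of the (trivialized) equivariant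 line bundle on $S\mathfrak H_n$ that is the square root of the determinant of the tautological rank $n$ bundle; they are represented by superfunctions. The operator $D^{(1/2)}_y\in\mathcal D_{S\mathfrak H_n}$, the infinitesimal action of $y\in E$ on them, is linear in $y$ and is given by $D^{(1/2)}_{p_i}=D_i$, $D^{(1/2)}_{q_i}=\sum_jt_{ji}D_j-\frac12\xi_i$. Put $\mathbb D_{ij}=D_iD_j-D_jD_i$. These are the components of the super-Laplacian $\mathbb D$, which up to composition with the parity operator is an invariant differential operator on superforms of weight $1/2$. $\mathcal M_{\mathbb D}=\mathcal D_{S\mathfrak H_n}\big/\sum_{i<j}\mathcal D_{S\mathfrak H_n}\mathbb D_{ij}$ is the corresponding left $\mathcal D_{S\mathfrak H_n}$-module, and $\underline{\mathrm{Ker}}(\mathbb D)\subset\mathcal O_{S\mathfrak H_n}$ is the subsheaf of sections annihilated by all $\mathbb D_{ij}$. By invariance of the super-Laplacian, the operators of the $\mathfrak g$-action define endomorphisms of $\mathcal M_{\mathbb D}$ as a left $\mathcal D_{S\mathfrak H_n}$-module (induced by right multiplication) and of $\underline{\mathrm{Ker}}(\mathbb D)$ as a sheaf.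
   Formalization: On Ker(D) the stated relation has the wrong sign under composition (n=1: [D_p,D_q]_- 1 = -1/2, not +1/2). The Ker claims are instead proved with products in End(Ker) reversed, and also under composition for D_y composed with the parity operator; the M_D claims are as stated. *)

theory Defs
  imports "HOL-Analysis.Analysis" "HOL-Algebra.QuotRing" "HOL-Algebra.Module"
begin

section \<open>Associative algebras over the complex numbers\<close>

text \<open>An algebra is a ring record together with a scalar multiplication. All algebras are
  associative and unital, not necessarily commutative.\<close>

type_synonym 'a calg = "(complex, 'a) module"

definition alg_hom :: "'a calg \<Rightarrow> 'b calg \<Rightarrow> ('a \<Rightarrow> 'b) set" where
  "alg_hom A B = {h \<in> ring_hom A B. \<forall>c. \<forall>a\<in>carrier A. h (c \<odot>\<^bsub>A\<^esub> a) = c \<odot>\<^bsub>B\<^esub> h a}"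

definition opposite_alg :: "'a calg \<Rightarrow> 'a calg" where
  "opposite_alg A = A\<lparr>mult := \<lambda>a b. b \<otimes>\<^bsub>A\<^esub> a\<rparr>"

definition quot_alg :: "'a calg \<Rightarrow> 'a set \<Rightarrow> 'a set calg" where
  "quot_alg A I = ring.extend (A Quot I)
     (module.fields (\<lambda>c X. (I +>\<^bsub>A\<^esub> (c \<odot>\<^bsub>A\<^esub> \<one>\<^bsub>A\<^esub>)) \<otimes>\<^bsub>A Quot I\<^esub> X))"

text \<open>The free algebra on a set: finitely supported functions on words.\<close>

definition free_alg :: "'g set \<Rightarrow> ('g list \<Rightarrow> complex) calg" where
  "free_alg X =
     \<lparr>carrier = {f. finite {w. f w \<noteq> 0} \<and> (\<forall>w. f w \<noteq> 0 \<longrightarrow> set w \<subseteq> X)},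
      mult = \<lambda>f g w. \<Sum>k\<le>length w. f (take k w) * g (drop k w),
      one = \<lambda>w. if w = [] then 1 else 0,
      zero = \<lambda>w. 0,
      add = \<lambda>f g w. f w + g w,
      smult = \<lambda>c f w. c * f w\<rparr>"

definition gen :: "'g \<Rightarrow> 'g list \<Rightarrow> complex" where
  "gen x = (\<lambda>w. if w = [x] then 1 else 0)"

definition presented_alg :: "'g set \<Rightarrow> ('g list \<Rightarrow> complex) set \<Rightarrow> ('g list \<Rightarrow> complex) set calg" where
  "presented_alg X R = quot_alg (free_alg X) (Idl\<^bsub>free_alg X\<^esub> R)"

definition presented_gen ::
    "'g set \<Rightarrow> ('g list \<Rightarrow> complex) set \<Rightarrow> 'g \<Rightarrow> ('g list \<Rightarrow> complex) set" where
  "presented_gen X R x = Idl\<^bsub>free_alg X\<^esub> R +>\<^bsub>free_alg X\<^esub> gen x"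

text \<open>Extension of a map on generators to the free algebra, and the induced map on cosets.\<close>

definition free_eval :: "'b calg \<Rightarrow> ('g \<Rightarrow> 'b) \<Rightarrow> ('g list \<Rightarrow> complex) \<Rightarrow> 'b" where
  "free_eval B h f =
     (\<Oplus>\<^bsub>B\<^esub>w\<in>{w. f w \<noteq> 0}. f w \<odot>\<^bsub>B\<^esub> foldr (\<lambda>x b. h x \<otimes>\<^bsub>B\<^esub> b) w \<one>\<^bsub>B\<^esub>)"

definition presented_map :: "'b calg \<Rightarrow> ('g \<Rightarrow> 'b) \<Rightarrow> ('g list \<Rightarrow> complex) set \<Rightarrow> 'b" where
  "presented_map B h C = the_elem (free_eval B h ` C)"

inductive_set lin_span :: "'a calg \<Rightarrow> 'a set \<Rightarrow> 'a set" for A S where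
  zero: "\<zero>\<^bsub>A\<^esub> \<in> lin_span A S"
| add: "a \<in> lin_span A S \<Longrightarrow> s \<in> S \<Longrightarrow> a \<oplus>\<^bsub>A\<^esub> c \<odot>\<^bsub>A\<^esub> s \<in> lin_span A S"


section \<open>The algebra Heis and the Lie superalgebra osp(1|2n)\<close>

text \<open>The index type has n elements. The pair (a, b) stands for the vector
  \<open>\<Sum>i. a $ i p\<^sub>i + b $ i q\<^sub>i\<close>.\<close>

type_synonym 'n evec = "(complex^'n) \<times> (complex^'n)"

definition evec_scale :: "complex \<Rightarrow> 'n evec \<Rightarrow> 'n::finite evec" where
  "evec_scale c y = (c *s fst y, c *s snd y)"

definition symp :: "'n evec \<Rightarrow> 'n::finite evec \<Rightarrow> complex" where
  "symp y z = (\<Sum>i\<in>UNIV. fst y $ i * snd z $ i - snd y $ i * fst z $ i)"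

definition heis_rels :: "('n::finite evec list \<Rightarrow> complex) set" where
  "heis_rels = (let F = free_alg UNIV in
     {gen (evec_scale a y + evec_scale b z) \<ominus>\<^bsub>F\<^esub> (a \<odot>\<^bsub>F\<^esub> gen y \<oplus>\<^bsub>F\<^esub> b \<odot>\<^bsub>F\<^esub> gen z) | a b y z. True} \<union>
     {(gen y \<otimes>\<^bsub>F\<^esub> gen z \<ominus>\<^bsub>F\<^esub> gen z \<otimes>\<^bsub>F\<^esub> gen y) \<ominus>\<^bsub>F\<^esub> (symp y z / 2) \<odot>\<^bsub>F\<^esub> \<one>\<^bsub>F\<^esub> | y z. True})"

type_synonym 'n heis_elem = "('n evec list \<Rightarrow> complex) set"

definition heis :: "'n::finite heis_elem calg" where
  "heis = presented_alg UNIV heis_rels"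

definition heis_gen :: "'n::finite evec \<Rightarrow> 'n heis_elem" where
  "heis_gen = presented_gen UNIV heis_rels"

text \<open>The Lie superalgebra is realized inside Heis: the odd part is spanned by the generators,
  the even part by their symmetrized products, and the bracket is the supercommutator.
  The Boolean argument of \<open>osp_part\<close> is True for the odd part.\<close>

definition osp_part :: "bool \<Rightarrow> 'n::finite heis_elem set" where
  "osp_part p = (if p then range heis_gen
     else lin_span heis {heis_gen y \<otimes>\<^bsub>heis\<^esub> heis_gen z \<oplus>\<^bsub>heis\<^esub> heis_gen z \<otimes>\<^bsub>heis\<^esub> heis_gen y | y z. True})"

definition osp :: "'n::finite heis_elem set" where
  "osp = {a \<oplus>\<^bsub>heis\<^esub> b | a b. a \<in> osp_part False \<and> b \<in> osp_part True}"

definition supercomm :: "'a calg \<Rightarrow> bool \<Rightarrow> bool \<Rightarrow> 'a \<Rightarrow> 'a \<Rightarrow> 'a" where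
  "supercomm A p q a b =
     (if p \<and> q then a \<otimes>\<^bsub>A\<^esub> b \<oplus>\<^bsub>A\<^esub> b \<otimes>\<^bsub>A\<^esub> a else a \<otimes>\<^bsub>A\<^esub> b \<ominus>\<^bsub>A\<^esub> b \<otimes>\<^bsub>A\<^esub> a)"

definition uea_rels :: "('n::finite heis_elem list \<Rightarrow> complex) set" where
  "uea_rels = (let F = free_alg osp in
     {gen (a \<odot>\<^bsub>heis\<^esub> x \<oplus>\<^bsub>heis\<^esub> b \<odot>\<^bsub>heis\<^esub> x') \<ominus>\<^bsub>F\<^esub> (a \<odot>\<^bsub>F\<^esub> gen x \<oplus>\<^bsub>F\<^esub> b \<odot>\<^bsub>F\<^esub> gen x')
        | a b x x'. x \<in> osp \<and> x' \<in> osp} \<union>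
     {supercomm F p q (gen x) (gen x') \<ominus>\<^bsub>F\<^esub> gen (supercomm heis p q x x')
        | p q x x'. x \<in> osp_part p \<and> x' \<in> osp_part q})"

type_synonym 'n uea_elem = "('n heis_elem list \<Rightarrow> complex) set"

definition uea :: "'n::finite uea_elem calg" where
  "uea = presented_alg osp uea_rels"

definition uea_gen :: "'n::finite heis_elem \<Rightarrow> 'n uea_elem" where
  "uea_gen = presented_gen osp uea_rels"

definition uea_to_heis :: "'n::finite uea_elem \<Rightarrow> 'n heis_elem" where
  "uea_to_heis = presented_map heis (\<lambda>x. x)"


section \<open>The Siegel plane and its superfunctions\<close>

type_synonym 'n cmat = "complex^'n^'n"

definition siegel :: "'n::finite cmat set" where
  "siegel = {v. transpose v = v \<and>
     (\<forall>x::real^'n. x \<noteq> 0 \<longrightarrow> x \<bullet> ((\<chi> i j. Im (v $ i $ j)) *v x) > 0)}"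

abbreviation siegel_open :: "'n::finite cmat set \<Rightarrow> bool" where
  "siegel_open U \<equiv> openin (top_of_set siegel) U"

text \<open>Complex differentiability on a relatively open subset of the space of symmetric matrices.\<close>

definition holo_on :: "'n::finite cmat set \<Rightarrow> ('n cmat \<Rightarrow> complex) \<Rightarrow> bool" where
  "holo_on U f \<longleftrightarrow> (\<forall>v\<in>U. \<exists>L. (f has_derivative L) (at v within U) \<and>
     (\<forall>c x. L (\<chi> i j. c * x $ i $ j) = c * L x))"

text \<open>An element of the Grassmann algebra is the family of its coefficients at the monomials
  \<open>\<xi>\<^sub>A\<close>, the product of the \<open>\<xi>\<^sub>i\<close>, i in A, in increasing order.
  \<open>gsign A B\<close> is the sign with \<open>\<xi>\<^sub>A \<xi>\<^sub>B = gsign A B \<xi>\<^bsub>A \<union> B\<^esub>\<close> for disjoint A and B.\<close>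

type_synonym 'n grass = "'n set \<Rightarrow> complex"

definition gsign :: "'n::linorder set \<Rightarrow> 'n set \<Rightarrow> complex" where
  "gsign A B = (-1) ^ card {(a, b). a \<in> A \<and> b \<in> B \<and> b < a}"

definition gmul :: "'n::linorder grass \<Rightarrow> 'n grass \<Rightarrow> 'n grass" where
  "gmul a b = (\<lambda>C. \<Sum>A\<in>Pow C. gsign A (C - A) * a A * b (C - A))"

definition gxi :: "'n \<Rightarrow> 'n grass" where
  "gxi i = (\<lambda>A. if A = {i} then 1 else 0)"

text \<open>The functions \<open>v\<^sub>i\<^sub>j\<close> (i at most j) and \<open>\<xi>\<^sub>i\<close> are global coordinates of the super Siegel plane,
  since the relations express T through them: \<open>t\<^sub>i\<^sub>j = v\<^sub>i\<^sub>j - \<xi>\<^sub>i \<xi>\<^sub>j / 2\<close>.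
  A superfunction is written in these coordinates, so its value at v is an element of the
  Grassmann algebra.\<close>

type_synonym 'n sfun = "'n cmat \<Rightarrow> 'n grass"

definition xi_fun :: "'n \<Rightarrow> 'n::finite sfun" where
  "xi_fun i = (\<lambda>v. gxi i)"

definition t_fun :: "'n \<Rightarrow> 'n \<Rightarrow> 'n::{finite,linorder} sfun" where
  "t_fun i j = (\<lambda>v A. (if A = {} then v $ i $ j else 0) - gmul (gxi i) (gxi j) A / 2)"

text \<open>Presheaves of complex vector spaces on the Siegel plane. Sections are elements of one
  type, and \<open>rest W\<close> restricts a section to W from any larger open set. The laws are not part
  of the record.\<close>

record ('p, 's) vsheaf =
  sect :: "'p set \<Rightarrow> 's set"
  rest :: "'p set \<Rightarrow> 's \<Rightarrow> 's"
  vadd :: "'s \<Rightarrow> 's \<Rightarrow> 's"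
  vscl :: "complex \<Rightarrow> 's \<Rightarrow> 's"

text \<open>The structure sheaf. Superfunctions on U are extended by zero outside U.\<close>

definition sfun_sheaf :: "('n::{finite,linorder} cmat, 'n sfun) vsheaf" where
  "sfun_sheaf =
     \<lparr>sect = \<lambda>U. {f. (\<forall>A. holo_on U (\<lambda>v. f v A)) \<and> (\<forall>v A. v \<notin> U \<longrightarrow> f v A = 0)},
      rest = \<lambda>W f v A. if v \<in> W then f v A else 0,
      vadd = \<lambda>f g v A. f v A + g v A,
      vscl = \<lambda>c f v A. c * f v A\<rparr>"

text \<open>Endomorphisms of the restriction of a sheaf F of vector spaces to U: families of linear maps,
  one for each open subset of U, compatible with restrictions. As functions they are
  normalized by \<open>on_sect\<close> to be undefined on arguments that are not sections over open subsets of U;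
  \<open>on_sect F W\<close> also restricts an endomorphism from U to W.\<close>

definition on_sect ::
    "('n::finite cmat, 's) vsheaf \<Rightarrow> 'n cmat set \<Rightarrow> ('n cmat set \<Rightarrow> 's \<Rightarrow> 's) \<Rightarrow> 'n cmat set \<Rightarrow> 's \<Rightarrow> 's" where
  "on_sect F U \<phi> =
     (\<lambda>V s. if siegel_open V \<and> V \<subseteq> U \<and> s \<in> sect F V then \<phi> V s else undefined)"

definition sheaf_End ::
    "('n::finite cmat, 's) vsheaf \<Rightarrow> 'n cmat set \<Rightarrow> ('n cmat set \<Rightarrow> 's \<Rightarrow> 's) calg" where
  "sheaf_End F U =
     \<lparr>carrier = {\<phi>. on_sect F U \<phi> = \<phi> \<and>
        (\<forall>V. siegel_open V \<longrightarrow> V \<subseteq> U \<longrightarrow>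
          (\<forall>s\<in>sect F V. \<phi> V s \<in> sect F V) \<and>
          (\<forall>s\<in>sect F V. \<forall>t\<in>sect F V. \<phi> V (vadd F s t) = vadd F (\<phi> V s) (\<phi> V t)) \<and>
          (\<forall>c. \<forall>s\<in>sect F V. \<phi> V (vscl F c s) = vscl F c (\<phi> V s)) \<and>
          (\<forall>W. siegel_open W \<longrightarrow> W \<subseteq> V \<longrightarrow>
             (\<forall>s\<in>sect F V. rest F W (\<phi> V s) = \<phi> W (rest F W s))))},
      mult = \<lambda>\<phi> \<psi>. on_sect F U (\<lambda>V s. \<phi> V (\<psi> V s)),
      one = on_sect F U (\<lambda>V s. s),
      zero = on_sect F U (\<lambda>V s. vscl F 0 s),
      add = \<lambda>\<phi> \<psi>. on_sect F U (\<lambda>V s. vadd F (\<phi> V s) (\<psi> V s)),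
      smult = \<lambda>c \<phi>. on_sect F U (\<lambda>V s. vscl F c (\<phi> V s))\<rparr>"


section \<open>Differential operators\<close>

type_synonym 'n oper = "'n cmat set \<Rightarrow> 'n sfun \<Rightarrow> 'n sfun"

abbreviation oper_alg :: "'n::{finite,linorder} cmat set \<Rightarrow> 'n oper calg" where
  "oper_alg U \<equiv> sheaf_End sfun_sheaf U"

abbreviation oper_on :: "'n::{finite,linorder} cmat set \<Rightarrow> 'n oper \<Rightarrow> 'n oper" where
  "oper_on U \<equiv> on_sect sfun_sheaf U"

definition mult_op :: "'n::{finite,linorder} cmat set \<Rightarrow> 'n sfun \<Rightarrow> 'n oper" where
  "mult_op U g = oper_on U (\<lambda>V f v. gmul (g v) (f v))"

text \<open>Parity is True for odd.\<close>

definition has_parity :: "bool \<Rightarrow> 'n sfun \<Rightarrow> bool" where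
  "has_parity p f \<longleftrightarrow> (\<forall>v A. f v A \<noteq> 0 \<longrightarrow> odd (card A) = p)"

definition vector_fields :: "'n::{finite,linorder} cmat set \<Rightarrow> bool \<Rightarrow> 'n oper set" where
  "vector_fields U p = {X \<in> carrier (oper_alg U).
     \<forall>V. siegel_open V \<longrightarrow> V \<subseteq> U \<longrightarrow>
       (\<forall>q. \<forall>f\<in>sect sfun_sheaf V. has_parity q f \<longrightarrow> has_parity (p \<noteq> q) (X V f) \<and>
         (\<forall>g\<in>sect sfun_sheaf V. X V (\<lambda>v. gmul (f v) (g v)) =
            (\<lambda>v A. gmul (X V f v) (g v) A
               + (if p \<and> q then -1 else 1) * gmul (f v) (X V g v) A)))}"

text \<open>The sheaf of differential operators is the subsheaf of rings of the sheaf of endomorphisms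
  of the structure sheaf that is generated by superfunctions and vector fields.\<close>

inductive_set diff_gen :: "'n::{finite,linorder} cmat set \<Rightarrow> 'n oper set" for U where
  fn: "g \<in> sect sfun_sheaf U \<Longrightarrow> mult_op U g \<in> diff_gen U"
| vf: "X \<in> vector_fields U p \<Longrightarrow> X \<in> diff_gen U"
| add: "P \<in> diff_gen U \<Longrightarrow> Q \<in> diff_gen U \<Longrightarrow> P \<oplus>\<^bsub>oper_alg U\<^esub> Q \<in> diff_gen U"
| mult: "P \<in> diff_gen U \<Longrightarrow> Q \<in> diff_gen U \<Longrightarrow> P \<otimes>\<^bsub>oper_alg U\<^esub> Q \<in> diff_gen U"

definition diff_ops :: "'n::{finite,linorder} cmat set \<Rightarrow> 'n oper set" where
  "diff_ops U = {P \<in> carrier (oper_alg U).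
     \<forall>x\<in>U. \<exists>W. siegel_open W \<and> x \<in> W \<and> W \<subseteq> U \<and> oper_on W P \<in> diff_gen W}"


section \<open>Spinor derivatives, the action on superforms of weight 1/2, the super-Laplacian\<close>

text \<open>The left derivative with respect to \<open>\<xi>\<^sub>i\<close>, on coefficients.\<close>

definition d_xi :: "'n \<Rightarrow> 'n::linorder grass \<Rightarrow> 'n grass" where
  "d_xi i a = (\<lambda>A. if i \<in> A then 0 else gsign {i} A * a (insert i A))"

text \<open>The derivative with respect to \<open>t\<^sub>i\<^sub>j\<close> of the function \<open>f ((T + transpose T) / 2)\<close> of an
  arbitrary matrix T, at T = v.\<close>

definition d_t :: "'n \<Rightarrow> 'n \<Rightarrow> 'n::finite sfun \<Rightarrow> 'n sfun" where
  "d_t i j f v A = deriv (\<lambda>z.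
     let T = (\<chi> k l. v $ k $ l + (if k = i \<and> l = j then z else 0))
     in f (\<chi> k l. (T $ k $ l + T $ l $ k) / 2) A) 0"

definition spinor_fun :: "'n \<Rightarrow> 'n::{finite,linorder} sfun \<Rightarrow> 'n sfun" where
  "spinor_fun i f v A = d_xi i (f v) A - (\<Sum>j\<in>UNIV. gmul (gxi j) (d_t i j f v) A)"

definition spinor :: "'n::{finite,linorder} cmat set \<Rightarrow> 'n \<Rightarrow> 'n oper" where
  "spinor U i = oper_on U (\<lambda>V f. rest sfun_sheaf V (spinor_fun i f))"

text \<open>The relations between the \<open>t\<^sub>i\<^sub>j\<close> and the \<open>\<xi>\<^sub>i\<close>, and the values of the spinor derivatives on
  them; these values determine the vector fields.\<close>

lemma gmul_gxi:
  fixes i :: "'n::{finite,linorder}"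
  shows "gmul (gxi i) a C = (if i \<in> C then gsign {i} (C - {i}) * a (C - {i}) else 0)"
proof -
  have "gmul (gxi i) a C = (\<Sum>A\<in>Pow C. if A = {i} then gsign {i} (C - {i}) * a (C - {i}) else 0)"
    unfolding gmul_def gxi_def by (intro sum.cong) auto
  also have "\<dots> = (if i \<in> C then gsign {i} (C - {i}) * a (C - {i}) else 0)"
    by (subst sum.delta) auto
  finally show ?thesis .
qed

lemma gsign_sing: "gsign {i} {j} = (if j < i then -1 else 1)"
proof -
  have "{(a, b). a \<in> {i} \<and> b \<in> {j} \<and> b < a} = (if j < i then {(i, j)} else {})"
    by auto
  then show ?thesis by (auto simp: gsign_def)
qed

lemma gsign_empty: "gsign A {} = 1"
  by (simp add: gsign_def)

lemma gmul_gxi_gxi: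
  fixes i j :: "'n::{finite,linorder}"
  shows "gmul (gxi i) (gxi j) C = (if i \<noteq> j \<and> C = {i, j} then (if j < i then -1 else 1) else 0)"
proof -
  have eq: "C - {i} = {j} \<and> i \<in> C \<longleftrightarrow> i \<noteq> j \<and> C = {i, j}" by auto
  show ?thesis
  proof (cases "i \<noteq> j \<and> C = {i, j}")
    case True
    then have "C - {i} = {j}" "i \<in> C" using eq by blast+
    with True show ?thesis by (simp add: gmul_gxi gsign_sing) (simp add: gxi_def)
  next
    case False
    then have "i \<in> C \<Longrightarrow> C - {i} \<noteq> {j}" using eq by blast
    then have "gmul (gxi i) (gxi j) C = 0" by (simp add: gmul_gxi) (simp add: gxi_def)
    with False show ?thesis by simp
  qed
qed

lemma t_fun_relation:
  assumes "i \<noteq> j" and "transpose v = v"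
  shows "t_fun i j v A - t_fun j i v A + gmul (xi_fun i v) (xi_fun j v) A = 0"
proof -
  have "v $ i $ j = v $ j $ i"
    using assms(2) by (metis transpose_def vec_lambda_beta)
  with assms(1) show ?thesis
    by (auto simp: t_fun_def xi_fun_def gmul_gxi_gxi insert_commute[of j i])
qed

lemma spinor_fun_xi:
  "spinor_fun i (xi_fun k) v A = (if i = k \<and> A = {} then 1 else 0)"
proof -
  have "d_t i j (xi_fun k) v = (\<lambda>A. 0)" for j
    by (auto simp: d_t_def xi_fun_def fun_eq_iff)
  then have "(\<Sum>j\<in>UNIV. gmul (gxi j) (d_t i j (xi_fun k) v) A) = 0"
    by (simp add: gmul_gxi cong: if_cong)
  moreover have "d_xi i (xi_fun k v) A = (if i = k \<and> A = {} then 1 else 0)"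
  proof -
    have "i \<notin> A \<and> insert i A = {k} \<longleftrightarrow> i = k \<and> A = {}" by auto
    then show ?thesis by (auto simp: d_xi_def xi_fun_def gxi_def gsign_empty)
  qed
  ultimately show ?thesis by (simp add: spinor_fun_def)
qed

lemma spinor_fun_t:
  "spinor_fun i (t_fun k l) v A = (if i = k then - xi_fun l v A else 0)"
proof -
  have dt: "d_t i j (t_fun k l) v B =
      (if B = {} then ((if i = k \<and> j = l then 1 else 0) + (if i = l \<and> j = k then 1 else 0)) / 2 else 0)"
    for j B
  proof -
    let ?c = "((if i = k \<and> j = l then 1 else 0) + (if i = l \<and> j = k then 1 else 0)) / 2 :: complex"
    let ?F = "\<lambda>z. (if B = {} then (v $ k $ l + v $ l $ k) / 2 + ?c * z else 0)
        - gmul (gxi k) (gxi l) B / 2"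
    have "d_t i j (t_fun k l) v B = deriv ?F 0"
      unfolding d_t_def t_fun_def Let_def
      by (intro arg_cong2[where f = deriv] refl ext)
        (cases "B = {}"; cases "i = k"; cases "j = l"; cases "i = l"; cases "j = k"; simp add: add_divide_distrib)
    also have "\<dots> = (if B = {} then ?c else 0)"
    proof (rule DERIV_imp_deriv)
      have lin: "((\<lambda>z. a + c * z - d) has_field_derivative c) (at 0)" for a c d :: complex
        by (auto intro!: derivative_eq_intros)
      show "(?F has_field_derivative (if B = {} then ?c else 0)) (at 0)"
      proof (cases "B = {}")
        case True
        show ?thesis unfolding if_P[OF True] by (rule lin)
      next
        case False
        show ?thesis unfolding if_not_P[OF False] by (rule DERIV_const)
      qed
    qed
    finally show ?thesis .
  qed
  define c where
    "c j = ((if i = k \<and> j = l then 1 else 0) + (if i = l \<and> j = k then 1 else 0)) / (2::complex)" for j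
  have summand: "gmul (gxi j) (d_t i j (t_fun k l) v) A = c j * gxi j A" for j
  proof -
    have d: "d_t i j (t_fun k l) v (A - {j}) = (if A - {j} = {} then c j else 0)"
      unfolding dt c_def ..
    show ?thesis
    proof (cases "j \<in> A \<and> A - {j} = {}")
      case True
      then have A: "A = {j}" by blast
      show ?thesis unfolding gmul_gxi d unfolding gxi_def A by (simp add: gsign_empty)
    next
      case False
      then have "A \<noteq> {j}" by blast
      with False show ?thesis unfolding gmul_gxi d unfolding gxi_def by auto
    qed
  qed
  have "(\<Sum>j\<in>UNIV. c j * gxi j A) =
      (\<Sum>j\<in>UNIV. (if j = l then (if i = k then gxi l A / 2 else 0) else 0)
        + (if j = k then (if i = l then gxi k A / 2 else 0) else 0))"
    unfolding c_def
    by (intro sum.cong refl)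
      (simp only: add_divide_distrib distrib_right if_distrib[of "\<lambda>x. x / 2"] if_distrib[of "\<lambda>x. x * _"], auto)
  also have "\<dots> = (if i = k then gxi l A / 2 else 0) + (if i = l then gxi k A / 2 else 0)"
    by (simp only: sum.distrib sum.delta' sum.delta finite UNIV_I if_True)
  finally have sum_eq: "(\<Sum>j\<in>UNIV. gmul (gxi j) (d_t i j (t_fun k l) v) A) =
      (if i = k then gxi l A / 2 else 0) + (if i = l then gxi k A / 2 else 0)"
    unfolding summand .
  have dxi: "d_xi i (t_fun k l v) A =
      (if i = l then gxi k A / 2 else 0) - (if i = k then gxi l A / 2 else 0)"
  proof (cases "i \<in> A")
    case True
    have "gxi m A = 0" if "m \<noteq> i" for m
      using True that by (auto simp: gxi_def)
    then have "(if i = l then gxi k A / 2 else 0) - (if i = k then gxi l A / 2 else 0) = 0"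
      by (cases "i = k"; cases "i = l") auto
    with True show ?thesis by (simp add: d_xi_def)
  next
    case False
    have d: "d_xi i (t_fun k l v) A = - (gsign {i} A * gmul (gxi k) (gxi l) (insert i A) / 2)"
      using False by (simp add: d_xi_def t_fun_def)
    have A0: "gxi i A = 0"
      using False by (auto simp: gxi_def)
    have eq: "insert i A = {i, m} \<longleftrightarrow> A = {m}" if "m \<noteq> i" for m
      using False that by auto
    consider "i = k" "i = l" | "i = k" "i \<noteq> l" | "i \<noteq> k" "i = l" | "i \<noteq> k" "i \<noteq> l"
      by blast
    then show ?thesis
    proof cases
      case 1
      have "gmul (gxi i) (gxi i) (insert i A) = 0"
        unfolding gmul_gxi_gxi by simp
      with 1 d show ?thesis by simp
    next
      case 2
      have "gmul (gxi i) (gxi l) (insert i A) = (if A = {l} then (if l < i then -1 else 1) else 0)"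
        unfolding gmul_gxi_gxi using 2 eq[of l] by simp
      with 2 show ?thesis
        unfolding d by (cases "A = {l}") (simp_all add: gsign_sing, simp_all add: gxi_def)
    next
      case 3
      have "gmul (gxi k) (gxi i) (insert i A) = (if A = {k} then (if i < k then -1 else 1) else 0)"
        unfolding gmul_gxi_gxi using 3 eq[of k] insert_commute[of k i "{}"] by simp
      moreover have "\<not> i < k \<longleftrightarrow> k < i" using 3 by auto
      ultimately show ?thesis
        using 3 unfolding d by (cases "A = {k}"; cases "i < k") (simp_all add: gsign_sing, simp_all add: gxi_def)
    next
      case 4
      then have "insert i A \<noteq> {k, l}" by blast
      then have "gmul (gxi k) (gxi l) (insert i A) = 0"
        unfolding gmul_gxi_gxi by simp
      with 4 d show ?thesis by simp
    qed
  qed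
  show ?thesis
    by (simp add: spinor_fun_def sum_eq dxi xi_fun_def)
qed

definition D_q :: "'n::{finite,linorder} cmat set \<Rightarrow> 'n \<Rightarrow> 'n oper" where
  "D_q U i = (\<Oplus>\<^bsub>oper_alg U\<^esub>j\<in>UNIV. mult_op U (t_fun j i) \<otimes>\<^bsub>oper_alg U\<^esub> spinor U j)
     \<ominus>\<^bsub>oper_alg U\<^esub> (1/2) \<odot>\<^bsub>oper_alg U\<^esub> mult_op U (xi_fun i)"

text \<open>The restriction to U of the operator by which y acts.\<close>

definition D_half :: "'n::{finite,linorder} cmat set \<Rightarrow> 'n evec \<Rightarrow> 'n oper" where
  "D_half U y = (\<Oplus>\<^bsub>oper_alg U\<^esub>i\<in>UNIV.
     (fst y $ i) \<odot>\<^bsub>oper_alg U\<^esub> spinor U i \<oplus>\<^bsub>oper_alg U\<^esub> (snd y $ i) \<odot>\<^bsub>oper_alg U\<^esub> D_q U i)"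

definition super_lap :: "'n::{finite,linorder} cmat set \<Rightarrow> 'n \<Rightarrow> 'n \<Rightarrow> 'n oper" where
  "super_lap U i j = spinor U i \<otimes>\<^bsub>oper_alg U\<^esub> spinor U j
     \<ominus>\<^bsub>oper_alg U\<^esub> spinor U j \<otimes>\<^bsub>oper_alg U\<^esub> spinor U i"


section \<open>The sheaf of solutions\<close>

definition ker_sheaf :: "('n::{finite,linorder} cmat, 'n sfun) vsheaf" where
  "ker_sheaf = sfun_sheaf\<lparr>sect := \<lambda>U. {f \<in> sect sfun_sheaf U.
     \<forall>i j. i < j \<longrightarrow> super_lap U i j U f = (\<lambda>v A. 0)}\<rparr>"

abbreviation End_Ker :: "'n::{finite,linorder} oper calg" where
  "End_Ker \<equiv> sheaf_End ker_sheaf siegel"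

definition ker_act :: "'n::{finite,linorder} evec \<Rightarrow> 'n oper" where
  "ker_act y = on_sect ker_sheaf siegel (D_half siegel y)"

text \<open>As differential operators, \<open>D\<^sub>p\<^sub>i D\<^sub>q\<^sub>i - D\<^sub>q\<^sub>i D\<^sub>p\<^sub>i\<close> is -1/2 modulo the super-Laplacian, whereas
  \<open>\<omega>(p\<^sub>i, q\<^sub>i) = 1\<close>. Right multiplication reverses products, which gives the
  sign +1/2 on the D-module. On solutions the same sign arises when products are read in the reversed
  order, because taking solutions is a contravariant functor of the D-module, or, with composition as
  the product, when the operators are preceded by the parity operator.\<close>

definition parity_fun :: "'n sfun \<Rightarrow> 'n sfun" where
  "parity_fun f = (\<lambda>v A. (-1) ^ card A * f v A)"

definition ker_act_parity :: "'n::{finite,linorder} evec \<Rightarrow> 'n oper" where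
  "ker_act_parity y = on_sect ker_sheaf siegel (\<lambda>V f. D_half siegel y V (parity_fun f))"


section \<open>The D-module\<close>

definition lap_ideal :: "'n::{finite,linorder} cmat set \<Rightarrow> 'n oper set" where
  "lap_ideal U = {finsum (oper_alg U) (\<lambda>(i, j). Q i j \<otimes>\<^bsub>oper_alg U\<^esub> super_lap U i j) {(i, j). i < j} | Q.
     \<forall>i j. Q i j \<in> diff_ops U}"

text \<open>The quotient sheaf is built from its stalks. An element of the stalk at x is the set of all
  pairs (W, Q) of an open neighbourhood W of x and an operator Q over W representing it, and a
  section over U is a function on U (extended by the empty set) with values in the stalks that is
  locally given by operators.\<close>

type_synonym 'n germ = "('n cmat set \<times> 'n oper) set"
type_synonym 'n msect = "'n cmat \<Rightarrow> 'n germ"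

definition germ_class :: "'n cmat \<Rightarrow> 'n cmat set \<Rightarrow> 'n::{finite,linorder} oper \<Rightarrow> 'n germ" where
  "germ_class x W P = {(W', Q). siegel_open W' \<and> x \<in> W' \<and> Q \<in> diff_ops W' \<and>
     (\<exists>N. siegel_open N \<and> x \<in> N \<and> N \<subseteq> W \<inter> W' \<and>
        oper_on N P \<ominus>\<^bsub>oper_alg N\<^esub> oper_on N Q \<in> lap_ideal N)}"

definition M_sheaf :: "('n::{finite,linorder} cmat, 'n msect) vsheaf" where
  "M_sheaf =
     \<lparr>sect = \<lambda>U. {s. (\<forall>x. x \<notin> U \<longrightarrow> s x = {}) \<and>
        (\<forall>x\<in>U. \<exists>W P. siegel_open W \<and> x \<in> W \<and> W \<subseteq> U \<and> P \<in> diff_ops W \<and>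
           (\<forall>y\<in>W. s y = germ_class y W P))},
      rest = \<lambda>W s x. if x \<in> W then s x else {},
      vadd = \<lambda>s t x. \<Union>(W, P)\<in>s x. \<Union>(W', Q)\<in>t x. germ_class x (W \<inter> W')
        (oper_on (W \<inter> W') P \<oplus>\<^bsub>oper_alg (W \<inter> W')\<^esub> oper_on (W \<inter> W') Q),
      vscl = \<lambda>c s x. \<Union>(W, P)\<in>s x. germ_class x W (c \<odot>\<^bsub>oper_alg W\<^esub> P)\<rparr>"

text \<open>Left multiplication of a section of the module by an operator over U.\<close>

definition M_lmult :: "'n cmat set \<Rightarrow> 'n::{finite,linorder} oper \<Rightarrow> 'n msect \<Rightarrow> 'n msect" where
  "M_lmult U P s = (\<lambda>x. \<Union>(W, Q)\<in>s x. germ_class x (U \<inter> W)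
     (oper_on (U \<inter> W) P \<otimes>\<^bsub>oper_alg (U \<inter> W)\<^esub> oper_on (U \<inter> W) Q))"

text \<open>Endomorphisms of the sheaf of left modules; the multiplication is composition of maps.\<close>

definition End_M :: "('n cmat set \<Rightarrow> 'n msect \<Rightarrow> 'n::{finite,linorder} msect) calg" where
  "End_M = (sheaf_End M_sheaf siegel)\<lparr>carrier := {\<phi> \<in> carrier (sheaf_End M_sheaf siegel).
     \<forall>U. siegel_open U \<longrightarrow> (\<forall>P\<in>diff_ops U. \<forall>s\<in>sect M_sheaf U.
        \<phi> U (M_lmult U P s) = M_lmult U P (\<phi> U s))}\<rparr>"

text \<open>Right multiplication by the operator of y.\<close>

definition M_act :: "'n::{finite,linorder} evec \<Rightarrow> 'n cmat set \<Rightarrow> 'n msect \<Rightarrow> 'n msect" where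
  "M_act y = on_sect M_sheaf siegel (\<lambda>U s x. \<Union>(W, Q)\<in>s x.
     germ_class x W (Q \<otimes>\<^bsub>oper_alg W\<^esub> D_half W y))"


section \<open>Descending to Heis\<close>

text \<open>Operators \<open>d y\<close> in an algebra B give an action of osp(1|2n) if y maps to \<open>d y\<close> under an
  algebra morphism from the enveloping algebra; it is unique, as the odd part generates.\<close>

definition osp_actions :: "'b calg \<Rightarrow> ('n::finite evec \<Rightarrow> 'b) \<Rightarrow> ('n uea_elem \<Rightarrow> 'b) set" where
  "osp_actions B d = {\<rho> \<in> alg_hom uea B. \<forall>y. \<rho> (uea_gen (heis_gen y)) = d y}"

definition descends :: "'b calg \<Rightarrow> ('n::finite uea_elem \<Rightarrow> 'b) \<Rightarrow> bool" where
  "descends B \<rho> \<longleftrightarrow> (\<exists>h\<in>alg_hom heis B. \<forall>u\<in>carrier uea. \<rho> u = h (uea_to_heis u))"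

end

theory Submission
  imports Defs "HOL-Complex_Analysis.Cauchy_Integral_Formula" "HOL-Library.Function_Algebras"
begin

text \<open>
  The spinor derivatives satisfy \<open>D\<^sub>i D\<^sub>j + D\<^sub>j D\<^sub>i = - 2 \<partial>/\<partial>t\<^sub>i\<^sub>j\<close>, which commutes with all \<open>D\<^sub>k\<close>. Writing L for the
  super-Laplacian and \<open>Q\<^sub>i\<close> for \<open>D\<^sub>q\<^sub>i\<close>, this and the relations between \<open>t\<^sub>i\<^sub>j\<close>, \<open>\<xi>\<^sub>i\<close> and \<open>D\<^sub>k\<close> give
  \<open>3 L\<^sub>i\<^sub>j D\<^sub>k = 2 D\<^sub>i L\<^sub>j\<^sub>k - 2 D\<^sub>j L\<^sub>i\<^sub>k - D\<^sub>k L\<^sub>i\<^sub>j\<close>,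
  \<open>L\<^sub>i\<^sub>j Q\<^sub>k = (3/2) \<xi>\<^sub>k L\<^sub>i\<^sub>j + \<Sum>\<^sub>a t\<^sub>a\<^sub>k L\<^sub>i\<^sub>j D\<^sub>a\<close>,
  \<open>[D\<^sub>k, Q\<^sub>i] = \<Sum>\<^sub>j t\<^sub>j\<^sub>i L\<^sub>k\<^sub>j - \<delta>\<^sub>k\<^sub>i / 2\<close> and \<open>[Q\<^sub>i, Q\<^sub>k] = \<Sum>\<^sub>a\<^sub>b t\<^sub>a\<^sub>i t\<^sub>b\<^sub>k L\<^sub>a\<^sub>b\<close>.
  By the first two identities the left ideal generated by L is stable under right multiplication by the
  operators of E, and by the last two these satisfy the Heisenberg relations modulo the ideal, up to the sign
  that is absorbed by reversing products or by the parity operator, which anticommutes with them.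
  The operators of E thus define a morphism from Heis, and its composite with \<open>U(\<gg>) \<rightarrow> Heis\<close> is the only
  action of \<open>\<gg>\<close> with the given odd operators, since the odd part generates \<open>U(\<gg>)\<close>.
\<close>

section \<open>Algebras over the complex numbers and presentations\<close>

text \<open>\<open>holo_on\<close> asks for a single complex-linear differential on a relatively
  open set, whereas the identities of the overview differentiate superfunctions repeatedly and
  interchange derivatives. Both properties come from Cauchy's formula on complex lines, applied
  after functions have been pulled back along symmetrization to open sets of all matrices. The
  identities themselves are formal: they are proved for abstract operators on a vector space and
  then read twice, as relations in the operator algebra and as relations on solutions. The shift by
  -1/2 times xi in the operator of q makes them close up. Differentiating the coefficients t
  produces a term -xi D; the shift gives half of it back, and the remaining half is the one that
  occurs in the product in the other order. The quotient sheaf consists of germs, so each operation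
  is also checked to be independent of the representing operator and of its domain.\<close>

locale calgebra = ring A for A :: "'a calg" (structure) +
  assumes smult_closed [simp, intro]: "a \<in> carrier A \<Longrightarrow> c \<odot> a \<in> carrier A"
    and smult_add_left: "a \<in> carrier A \<Longrightarrow> (c + d) \<odot> a = c \<odot> a \<oplus> d \<odot> a"
    and smult_add_right: "a \<in> carrier A \<Longrightarrow> b \<in> carrier A \<Longrightarrow> c \<odot> (a \<oplus> b) = c \<odot> a \<oplus> c \<odot> b"
    and smult_smult: "a \<in> carrier A \<Longrightarrow> c \<odot> (d \<odot> a) = (c * d) \<odot> a"
    and smult_one [simp]: "a \<in> carrier A \<Longrightarrow> 1 \<odot> a = a"
    and smult_mult_left: "a \<in> carrier A \<Longrightarrow> b \<in> carrier A \<Longrightarrow> (c \<odot> a) \<otimes> b = c \<odot> (a \<otimes> b)"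
    and smult_mult_right: "a \<in> carrier A \<Longrightarrow> b \<in> carrier A \<Longrightarrow> a \<otimes> (c \<odot> b) = c \<odot> (a \<otimes> b)"
begin

lemma smult_zero_left [simp]: assumes "a \<in> carrier A" shows "0 \<odot> a = \<zero>"
proof -
  have "0 \<odot> a \<oplus> 0 \<odot> a = 0 \<odot> a"
    using smult_add_left[OF assms, of 0 0] by simp
  then show ?thesis using assms by (metis add.l_cancel_one' smult_closed)
qed

lemma smult_zero_right [simp]: "c \<odot> \<zero> = \<zero>"
  using smult_smult[of \<zero> c 0] by simp

lemma smult_minus_one: assumes "a \<in> carrier A" shows "(-1) \<odot> a = \<ominus> a"
proof -
  have "(-1) \<odot> a \<oplus> a = \<zero>"
    using smult_add_left[OF assms, of "-1" 1] assms by simp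
  then show ?thesis using assms by (simp add: minus_equality)
qed

lemma minus_eq_smult:
  assumes "a \<in> carrier A" "b \<in> carrier A" shows "a \<ominus> b = a \<oplus> (-1) \<odot> b"
  using assms by (simp add: smult_minus_one a_minus_def)

lemma smult_finsum:
  "f \<in> I \<rightarrow> carrier A \<Longrightarrow> c \<odot> (\<Oplus>i\<in>I. f i) = (\<Oplus>i\<in>I. c \<odot> f i)"
proof (induction I rule: infinite_finite_induct)
  case (insert x F)
  then have "f \<in> F \<rightarrow> carrier A" "f x \<in> carrier A" by auto
  with insert show ?case by (simp add: smult_add_right Pi_def)
qed simp_all

lemma minus_eq_zero_iff:
  assumes a: "a \<in> carrier A" and b: "b \<in> carrier A" shows "a \<ominus> b = \<zero> \<longleftrightarrow> a = b"
proof
  assume "a \<ominus> b = \<zero>"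
  then have "a \<ominus> b \<oplus> b = \<zero> \<oplus> b" by simp
  then show "a = b" using a b by (simp add: a_minus_def a_assoc l_neg)
qed (use a b in \<open>simp add: a_minus_def r_neg\<close>)

lemma calgebra_opposite: "calgebra (opposite_alg A)"
proof -
  have "ring (opposite_alg A)"
  proof (rule ringI)
    show "abelian_group (opposite_alg A)"
      by (rule abelian_groupI)
        (use add.r_inv_ex in \<open>auto simp: opposite_alg_def a_ac\<close>)
    show "Group.monoid (opposite_alg A)"
      by (rule monoidI) (auto simp: opposite_alg_def m_assoc)
  qed (auto simp: opposite_alg_def l_distr r_distr)
  then show ?thesis
    by (auto intro!: calgebra.intro calgebra_axioms.intro
        simp: opposite_alg_def smult_add_left smult_add_right smult_smult smult_mult_left smult_mult_right)
qed

text \<open>Negatives and zero are the multiples by -1 and 0, so closure under scalars already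
  supplies them.\<close>

lemma calgebra_subalgebra:
  assumes S: "S \<subseteq> carrier A" and one: "\<one> \<in> S"
    and add: "\<And>a b. a \<in> S \<Longrightarrow> b \<in> S \<Longrightarrow> a \<oplus> b \<in> S"
    and mult: "\<And>a b. a \<in> S \<Longrightarrow> b \<in> S \<Longrightarrow> a \<otimes> b \<in> S"
    and smult: "\<And>c a. a \<in> S \<Longrightarrow> c \<odot> a \<in> S"
  shows "calgebra (A\<lparr>carrier := S\<rparr>)"
proof -
  have S': "a \<in> carrier A" if "a \<in> S" for a using that S by blast
  have zero: "\<zero> \<in> S" using smult[OF one, of 0] by simp
  have inv: "\<exists>y\<in>S. x \<oplus> y = \<zero>" if "x \<in> S" for x
    using S'[OF that] smult[OF that, of "-1"]
    by (intro bexI[of _ "(-1) \<odot> x"]) (simp_all add: smult_minus_one r_neg)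
  have "ring (A\<lparr>carrier := S\<rparr>)"
  proof (rule ringI)
    show "abelian_group (A\<lparr>carrier := S\<rparr>)"
      by (rule abelian_groupI) (auto simp: a_assoc a_comm[OF S' S'] a_lcomm S' zero add intro: inv)
    show "Group.monoid (A\<lparr>carrier := S\<rparr>)"
      by (rule monoidI) (auto simp: m_assoc S' one mult)
  qed (auto simp: l_distr r_distr S')
  then show ?thesis
    by (auto intro!: calgebra.intro calgebra_axioms.intro
        simp: smult_add_left smult_add_right smult_smult smult_mult_left smult_mult_right S' smult)
qed

lemma quot_alg_simps:
  "carrier (quot_alg A I) = carrier (A Quot I)" "mult (quot_alg A I) = mult (A Quot I)"
  "one (quot_alg A I) = one (A Quot I)" "zero (quot_alg A I) = zero (A Quot I)"
  "add (quot_alg A I) = add (A Quot I)"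
  "smult (quot_alg A I) = (\<lambda>c X. (I +> (c \<odot> \<one>)) \<otimes>\<^bsub>A Quot I\<^esub> X)"
  by (simp_all add: quot_alg_def ring.extend_def module.fields_def)

lemma coset_alg_hom: assumes "ideal I A" shows "(+>) I \<in> alg_hom A (quot_alg A I)"
proof -
  interpret I: ideal I A by fact
  show ?thesis
    using I.rcos_ring_hom
    by (auto simp: alg_hom_def ring_hom_def quot_alg_simps smult_mult_left simp flip: ring_hom_mult[OF I.rcos_ring_hom])
qed

text \<open>The scalar c acts on the quotient as multiplication by the coset of
  \<open>c \<odot> \<one>\<close>. Its laws are therefore images of the laws in \<open>A\<close>
  under the projection, which is a surjective ring homomorphism; \<open>car\<close> records the
  surjectivity.\<close>

lemma calgebra_quot_alg: assumes "ideal I A" shows "calgebra (quot_alg A I)"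
proof -
  interpret I: ideal I A by fact
  interpret Q: ring "A Quot I" by (rule I.quotient_is_ring)
  let ?Q = "quot_alg A I"
  have "ring ?Q"
  proof (rule ringI)
    show "abelian_group ?Q"
      by (rule abelian_groupI)
        (use Q.add.r_inv_ex in \<open>auto simp: quot_alg_simps Q.a_ac\<close>)
    show "Group.monoid ?Q"
      by (rule monoidI) (auto simp: quot_alg_simps Q.m_assoc)
  qed (auto simp: quot_alg_simps Q.l_distr Q.r_distr)
  moreover have h: "(+>) I \<in> ring_hom A (A Quot I)" by (rule I.rcos_ring_hom)
  have car: "\<exists>a\<in>carrier A. X = I +> a" if "X \<in> carrier (A Quot I)" for X
    using that by (auto simp: FactRing_def A_RCOSETS_def')
  note * = ring_hom_mult[OF h, symmetric] ring_hom_add[OF h, symmetric] ring_hom_closed[OF h]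
    ring_hom_one[OF h, symmetric]
  ultimately show ?thesis
    by (intro calgebra.intro calgebra_axioms.intro)
      (auto simp: quot_alg_simps * dest!: car simp: smult_mult_left smult_mult_right smult_add_left smult_add_right smult_smult l_distr r_distr mult.commute)
qed

end

lemma alg_homD:
  assumes "h \<in> alg_hom A B"
  shows "a \<in> carrier A \<Longrightarrow> h a \<in> carrier B"
    and "a \<in> carrier A \<Longrightarrow> b \<in> carrier A \<Longrightarrow> h (a \<otimes>\<^bsub>A\<^esub> b) = h a \<otimes>\<^bsub>B\<^esub> h b"
    and "a \<in> carrier A \<Longrightarrow> b \<in> carrier A \<Longrightarrow> h (a \<oplus>\<^bsub>A\<^esub> b) = h a \<oplus>\<^bsub>B\<^esub> h b"
    and "h \<one>\<^bsub>A\<^esub> = \<one>\<^bsub>B\<^esub>"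
    and "a \<in> carrier A \<Longrightarrow> h (c \<odot>\<^bsub>A\<^esub> a) = c \<odot>\<^bsub>B\<^esub> h a"
  using assms by (auto simp: alg_hom_def ring_hom_def)

lemma alg_hom_minus:
  assumes "h \<in> alg_hom A B" "calgebra A" "calgebra B" "a \<in> carrier A" "b \<in> carrier A"
  shows "h (a \<ominus>\<^bsub>A\<^esub> b) = h a \<ominus>\<^bsub>B\<^esub> h b"
proof -
  interpret A: calgebra A by fact
  interpret B: calgebra B by fact
  show ?thesis using assms by (simp add: A.minus_eq_smult B.minus_eq_smult alg_homD[OF assms(1)])
qed

lemma alg_hom_compose:
  "f \<in> alg_hom A B \<Longrightarrow> g \<in> alg_hom B C \<Longrightarrow> g \<circ> f \<in> alg_hom A C"
  by (auto simp: alg_hom_def ring_hom_def Pi_iff)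

lemma ideal_kernel:
  assumes "h \<in> alg_hom A B" "calgebra A" "calgebra B"
  shows "ideal {a \<in> carrier A. h a = \<zero>\<^bsub>B\<^esub>} A"
proof -
  interpret A: calgebra A by fact
  interpret B: calgebra B by fact
  have "ring_hom_ring A B h"
    by (rule ring_hom_ringI2) (use assms in \<open>auto simp: alg_hom_def A.ring_axioms B.ring_axioms\<close>)
  from ring_hom_ring.kernel_is_ideal[OF this] show ?thesis by (simp add: a_kernel_def')
qed

section \<open>The free algebra as a convolution algebra of functions on words\<close>

lemma free_alg_simps:
  "f \<in> carrier (free_alg X) \<longleftrightarrow> finite {w. f w \<noteq> 0} \<and> (\<forall>w. f w \<noteq> 0 \<longrightarrow> set w \<subseteq> X)"
  "mult (free_alg X) f g = (\<lambda>w. \<Sum>k\<le>length w. f (take k w) * g (drop k w))"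
  "one (free_alg X) = (\<lambda>w. if w = [] then 1 else 0)"
  "zero (free_alg X) = (\<lambda>w. 0)"
  "add (free_alg X) f g = (\<lambda>w. f w + g w)"
  "smult (free_alg X) c f = (\<lambda>w. c * f w)"
  by (simp_all add: free_alg_def)

text \<open>A nonzero coefficient of a product has a nonzero summand, so its word is a concatenation
  of a word from each support.\<close>

lemma free_alg_mult_closed:
  assumes f: "f \<in> carrier (free_alg X)" and g: "g \<in> carrier (free_alg X)"
  shows "f \<otimes>\<^bsub>free_alg X\<^esub> g \<in> carrier (free_alg X)"
proof -
  have nz: "\<exists>k. f (take k w) \<noteq> 0 \<and> g (drop k w) \<noteq> 0" if "(f \<otimes>\<^bsub>free_alg X\<^esub> g) w \<noteq> 0" for w
  proof (rule ccontr)
    assume "\<not> ?thesis"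
    then have "f (take k w) * g (drop k w) = 0" for k by auto
    with that show False by (simp add: free_alg_simps)
  qed
  have "{w. (f \<otimes>\<^bsub>free_alg X\<^esub> g) w \<noteq> 0} \<subseteq> (\<lambda>(u, v). u @ v) ` ({w. f w \<noteq> 0} \<times> {w. g w \<noteq> 0})"
    (is "?L \<subseteq> ?R")
  proof
    fix w assume "w \<in> ?L"
    then obtain k where "f (take k w) \<noteq> 0" "g (drop k w) \<noteq> 0" using nz by blast
    then show "w \<in> ?R" by (intro image_eqI[of _ _ "(take k w, drop k w)"]) auto
  qed
  moreover have "finite ?R" using f g by (simp add: free_alg_simps)
  ultimately have "finite ?L" by (rule finite_subset)
  moreover have "set w \<subseteq> X" if w: "(f \<otimes>\<^bsub>free_alg X\<^esub> g) w \<noteq> 0" for w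
  proof -
    from nz[OF w] obtain k where "f (take k w) \<noteq> 0" "g (drop k w) \<noteq> 0" by blast
    then have "set (take k w) \<subseteq> X" "set (drop k w) \<subseteq> X" using f g by (auto simp: free_alg_simps)
    then show ?thesis by (metis append_take_drop_id set_append Un_subset_iff)
  qed
  ultimately show ?thesis unfolding free_alg_simps(1) by blast
qed

text \<open>Both sides sum over the ways to cut a word into three pieces. The left side records the
  ends k and m of the first two pieces, the right side the end k of the first and the length j = m -
  k of the second.\<close>

lemma free_alg_mult_assoc:
  "(f \<otimes>\<^bsub>free_alg X\<^esub> g) \<otimes>\<^bsub>free_alg X\<^esub> h = f \<otimes>\<^bsub>free_alg X\<^esub> (g \<otimes>\<^bsub>free_alg X\<^esub> h)"
proof
  fix w :: "'a list"
  let ?F = "\<lambda>k m. f (take k w) * g (drop k (take m w)) * h (drop m w)"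
  have "((f \<otimes>\<^bsub>free_alg X\<^esub> g) \<otimes>\<^bsub>free_alg X\<^esub> h) w = (\<Sum>m\<le>length w. \<Sum>k\<le>m. ?F k m)"
    unfolding free_alg_simps sum_distrib_right
    by (intro sum.cong refl) (simp_all add: min_def)
  also have "\<dots> = (\<Sum>(m, k)\<in>(SIGMA m:{..length w}. {..m}). ?F k m)"
    by (simp add: sum.Sigma)
  also have "\<dots> = (\<Sum>(k, j)\<in>(SIGMA k:{..length w}. {..length w - k}). ?F k (k + j))"
    by (rule sum.reindex_bij_witness[of _ "\<lambda>(k, j). (k + j, k)" "\<lambda>(m, k). (k, m - k)"]) auto
  also have "\<dots> = (\<Sum>k\<le>length w. \<Sum>j\<le>length w - k. ?F k (k + j))"
    by (simp add: sum.Sigma)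
  also have "\<dots> = (f \<otimes>\<^bsub>free_alg X\<^esub> (g \<otimes>\<^bsub>free_alg X\<^esub> h)) w"
    by (simp add: free_alg_simps sum_distrib_left mult.assoc take_drop add.commute)
  finally show "((f \<otimes>\<^bsub>free_alg X\<^esub> g) \<otimes>\<^bsub>free_alg X\<^esub> h) w = (f \<otimes>\<^bsub>free_alg X\<^esub> (g \<otimes>\<^bsub>free_alg X\<^esub> h)) w" .
qed

lemma calgebra_free_alg: "calgebra (free_alg X)"
proof -
  have add_closed: "finite {w. f w + g w \<noteq> 0}" if "finite {w. f w \<noteq> 0}" "finite {w. g w \<noteq> 0}"
    for f g :: "'a list \<Rightarrow> complex"
    by (rule finite_subset[of _ "{w. f w \<noteq> 0} \<union> {w. g w \<noteq> 0}"]) (use that in auto)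
  have smult_closed: "finite {w. c \<noteq> 0 \<and> f w \<noteq> 0}" if "finite {w. f w \<noteq> 0}" for c and f :: "'a list \<Rightarrow> complex"
    by (rule finite_subset[of _ "{w. f w \<noteq> 0}"]) (use that in auto)
  have unit: "(\<Sum>k\<le>length w. (if take k w = [] then 1 else 0) * f (drop k w)) = f w"
    "(\<Sum>k\<le>length w. f (take k w) * (if drop k w = [] then 1 else 0)) = f w" for f :: "'a list \<Rightarrow> complex" and w
  proof -
    have "(\<Sum>k\<le>length w. (if take k w = [] then 1 else 0) * f (drop k w)) = (\<Sum>k\<le>length w. if k = 0 then f w else 0)"
      by (intro sum.cong) auto
    then show "(\<Sum>k\<le>length w. (if take k w = [] then 1 else 0) * f (drop k w)) = f w" by simp
    have "(\<Sum>k\<le>length w. f (take k w) * (if drop k w = [] then 1 else 0)) = (\<Sum>k\<le>length w. if k = length w then f w else 0)"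
      by (intro sum.cong) auto
    then show "(\<Sum>k\<le>length w. f (take k w) * (if drop k w = [] then 1 else 0)) = f w" by simp
  qed
  have neg: "\<exists>y\<in>carrier (free_alg X). y \<oplus>\<^bsub>free_alg X\<^esub> x = \<zero>\<^bsub>free_alg X\<^esub>" if "x \<in> carrier (free_alg X)" for x
    using that by (intro bexI[of _ "\<lambda>w. - x w"]) (auto simp: free_alg_simps)
  have "ring (free_alg X)"
  proof (rule ringI)
    show "abelian_group (free_alg X)"
    proof (rule abelian_groupI)
      fix x y assume "x \<in> carrier (free_alg X)" "y \<in> carrier (free_alg X)"
      then show "x \<oplus>\<^bsub>free_alg X\<^esub> y \<in> carrier (free_alg X)"
        by (auto simp: add_closed free_alg_simps) (metis add.right_neutral subsetD)
    qed (use neg in \<open>auto simp: free_alg_simps algebra_simps\<close>)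
    show "Group.monoid (free_alg X)"
    proof (rule monoidI)
      show "\<one>\<^bsub>free_alg X\<^esub> \<in> carrier (free_alg X)" by (simp add: free_alg_simps)
    next
      fix x y assume "x \<in> carrier (free_alg X)" "y \<in> carrier (free_alg X)"
      then show "x \<otimes>\<^bsub>free_alg X\<^esub> y \<in> carrier (free_alg X)" by (rule free_alg_mult_closed)
    next
      fix x show "\<one>\<^bsub>free_alg X\<^esub> \<otimes>\<^bsub>free_alg X\<^esub> x = x" "x \<otimes>\<^bsub>free_alg X\<^esub> \<one>\<^bsub>free_alg X\<^esub> = x"
        by (simp_all only: free_alg_simps unit)
    qed (rule free_alg_mult_assoc)
  qed (auto simp: free_alg_simps fun_eq_iff algebra_simps sum.distrib)
  then show ?thesis
    by (auto intro!: calgebra.intro calgebra_axioms.intro simp: free_alg_simps fun_eq_iff algebra_simps sum_distrib_left smult_closed)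
qed

lemma gen_closed [simp]: "gen x \<in> carrier (free_alg X) \<longleftrightarrow> x \<in> X"
  by (auto simp: gen_def free_alg_simps)

lemma gen_mult:
  "gen x \<otimes>\<^bsub>free_alg X\<^esub> f = (\<lambda>w. case w of [] \<Rightarrow> 0 | y # v \<Rightarrow> if x = y then f v else 0)"
proof
  fix w
  show "(gen x \<otimes>\<^bsub>free_alg X\<^esub> f) w = (case w of [] \<Rightarrow> 0 | y # v \<Rightarrow> if x = y then f v else 0)"
  proof (cases w)
    case (Cons y v)
    have "(\<Sum>k\<le>length w. gen x (take k w) * f (drop k w)) =
        (\<Sum>k\<in>{1}. gen x (take k w) * f (drop k w))"
    proof (rule sum.mono_neutral_right)
      show "\<forall>k\<in>{..length w} - {1}. gen x (take k w) * f (drop k w) = 0"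
      proof
        fix k assume "k \<in> {..length w} - {1}"
        then have "length (take k w) \<noteq> length [x]" by auto
        then have "take k w \<noteq> [x]" by metis
        then show "gen x (take k w) * f (drop k w) = 0" by (simp add: gen_def)
      qed
    qed (auto simp: Cons)
    then show ?thesis by (simp add: Cons gen_def free_alg_simps)
  qed (simp add: gen_def free_alg_simps)
qed

text \<open>A monomial arises from a scalar by multiplying with generators on the left, and every
  element is a finite sum of monomials.\<close>

lemma free_alg_induct [consumes 1, case_names smult_one add gen_mult]:
  assumes f: "f \<in> carrier (free_alg X)"
    and one: "\<And>c. P (c \<odot>\<^bsub>free_alg X\<^esub> \<one>\<^bsub>free_alg X\<^esub>)"
    and add: "\<And>f g. f \<in> carrier (free_alg X) \<Longrightarrow> g \<in> carrier (free_alg X) \<Longrightarrow> P f \<Longrightarrow> P g \<Longrightarrow> P (f \<oplus>\<^bsub>free_alg X\<^esub> g)"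
    and gen: "\<And>x f. x \<in> X \<Longrightarrow> f \<in> carrier (free_alg X) \<Longrightarrow> P f \<Longrightarrow> P (gen x \<otimes>\<^bsub>free_alg X\<^esub> f)"
  shows "P f"
proof -
  interpret F: calgebra "free_alg X" by (rule calgebra_free_alg)
  have mono: "(\<lambda>v. if v = w then c else 0) \<in> carrier (free_alg X) \<and> P (\<lambda>v. if v = w then c else 0)"
    if "set w \<subseteq> X" for w c
    using that
  proof (induction w)
    case Nil
    have "c \<odot>\<^bsub>free_alg X\<^esub> \<one>\<^bsub>free_alg X\<^esub> = (\<lambda>v. if v = [] then c else 0)" by (auto simp: free_alg_simps)
    then show ?case using one[of c] F.smult_closed[OF F.one_closed, of c] by simp
  next
    case (Cons x w)
    have "gen x \<otimes>\<^bsub>free_alg X\<^esub> (\<lambda>v. if v = w then c else 0) = (\<lambda>v. if v = x # w then c else 0)"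
      unfolding gen_mult by (auto simp: fun_eq_iff split: list.split)
    moreover have "gen x \<in> carrier (free_alg X)" using Cons.prems by simp
    ultimately show ?case using Cons gen[of x "\<lambda>v. if v = w then c else 0"]
      free_alg_mult_closed[of "gen x" X "\<lambda>v. if v = w then c else 0"] by auto
  qed
  \<comment> \<open>The induction runs over a finite set that contains the support, so that a word
    can be removed whether or not its coefficient vanishes.\<close>
  have "finite S \<Longrightarrow> S \<subseteq> lists X \<Longrightarrow> {w. f w \<noteq> 0} \<subseteq> S \<Longrightarrow> f \<in> carrier (free_alg X) \<and> P f" for S f
  proof (induction S arbitrary: f rule: finite_induct)
    case empty
    then have "f = 0 \<odot>\<^bsub>free_alg X\<^esub> \<one>\<^bsub>free_alg X\<^esub>" by (auto simp: fun_eq_iff free_alg_simps)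
    moreover have "f \<in> carrier (free_alg X)" using empty by (auto simp: free_alg_simps)
    ultimately show ?case using one[of 0] by simp
  next
    case (insert w S)
    let ?g = "\<lambda>v. if v = w then 0 else f v" and ?m = "\<lambda>v. if v = w then f w else 0"
    have g: "?g \<in> carrier (free_alg X) \<and> P ?g" using insert by (intro insert.IH) auto
    have m: "?m \<in> carrier (free_alg X) \<and> P ?m" using insert.prems by (intro mono) auto
    have eq: "f = ?g \<oplus>\<^bsub>free_alg X\<^esub> ?m" by (auto simp: free_alg_simps)
    have "?g \<oplus>\<^bsub>free_alg X\<^esub> ?m \<in> carrier (free_alg X)"
      using g m by (intro F.add.m_closed) auto
    moreover have "P (?g \<oplus>\<^bsub>free_alg X\<^esub> ?m)" using add[of ?g ?m] g m by blast
    ultimately show ?case unfolding eq[symmetric] ..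
  qed
  from this[of "{w. f w \<noteq> 0}" f] show ?thesis using f by (auto simp: free_alg_simps)
qed

section \<open>Evaluation of noncommutative polynomials in an algebra\<close>

context calgebra begin

definition word_eval :: "('g \<Rightarrow> 'a) \<Rightarrow> 'g list \<Rightarrow> 'a" where
  "word_eval h w = foldr (\<lambda>x b. h x \<otimes> b) w \<one>"

lemma word_eval_Cons: "word_eval h (x # w) = h x \<otimes> word_eval h w"
  by (simp add: word_eval_def)

lemma word_eval_closed: "h \<in> X \<rightarrow> carrier A \<Longrightarrow> set w \<subseteq> X \<Longrightarrow> word_eval h w \<in> carrier A"
  by (induction w) (auto simp: word_eval_Cons, simp add: word_eval_def)

text \<open>The supports of f, g and f + g differ. Summing over a common finite superset makes
  additivity a statement about each word.\<close>

lemma free_eval_superset: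
  assumes h: "h \<in> X \<rightarrow> carrier A" and S: "finite S" "S \<subseteq> lists X" "{w. f w \<noteq> 0} \<subseteq> S"
  shows "free_eval A h f = (\<Oplus>w\<in>S. f w \<odot> word_eval h w)"
  unfolding free_eval_def word_eval_def[symmetric]
proof (rule add.finprod_mono_neutral_cong_left)
  show "(\<lambda>w. f w \<odot> word_eval h w) \<in> S \<rightarrow> carrier A"
    using S word_eval_closed[OF h] by (auto simp: subset_iff in_lists_conv_set)
qed (use S word_eval_closed[OF h] in \<open>auto simp: subset_iff in_lists_conv_set\<close>)

text \<open>Multiplicativity is checked first for a generator x on the left, where the support
  consists of the words \<open>x # w\<close>. Induction over the left factor by
  \<open>free_alg_induct\<close> gives the general case.\<close>

lemma free_eval_alg_hom:
  assumes h: "h \<in> X \<rightarrow> carrier A"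
  shows "free_eval A h \<in> alg_hom (free_alg X) A"
    and "x \<in> X \<Longrightarrow> free_eval A h (gen x) = h x"
proof -
  let ?F = "free_alg X" and ?e = "free_eval A h"
  interpret F: calgebra ?F by (rule calgebra_free_alg)
  note ev = free_eval_superset[OF h]
  have car: "finite {w. f w \<noteq> 0} \<and> {w. f w \<noteq> 0} \<subseteq> lists X" if "f \<in> carrier ?F" for f
    using that by (auto simp: free_alg_simps)
  have w: "w \<in> lists X \<Longrightarrow> word_eval h w \<in> carrier A" for w
    by (rule word_eval_closed[OF h]) auto
  have closed: "?e f \<in> carrier A" if "f \<in> carrier ?F" for f
    using car[OF that] w by (subst ev[of "{w. f w \<noteq> 0}"]) (auto intro!: add.finprod_closed)
  have e_add: "?e (f \<oplus>\<^bsub>?F\<^esub> g) = ?e f \<oplus> ?e g" if "f \<in> carrier ?F" "g \<in> carrier ?F" for f g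
  proof -
    let ?S = "{w. f w \<noteq> 0} \<union> {w. g w \<noteq> 0}"
    have S: "finite ?S" "?S \<subseteq> lists X" using car that by auto
    have wS: "word_eval h u \<in> carrier A" if "u \<in> ?S" for u using w S(2) that by blast
    have "?e (f \<oplus>\<^bsub>?F\<^esub> g) = (\<Oplus>u\<in>?S. (f u + g u) \<odot> word_eval h u)"
      by (subst ev[OF S]) (auto simp: free_alg_simps)
    also have "\<dots> = (\<Oplus>u\<in>?S. f u \<odot> word_eval h u \<oplus> g u \<odot> word_eval h u)"
      using wS by (intro add.finprod_cong') (simp_all add: smult_add_left Pi_iff)
    also have "\<dots> = (\<Oplus>u\<in>?S. f u \<odot> word_eval h u) \<oplus> (\<Oplus>u\<in>?S. g u \<odot> word_eval h u)"
      using wS by (intro add.finprod_multf) (simp_all add: Pi_iff)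
    also have "\<dots> = ?e f \<oplus> ?e g"
      using S by (simp add: ev[of ?S])
    finally show ?thesis .
  qed
  have smult: "?e (c \<odot>\<^bsub>?F\<^esub> f) = c \<odot> ?e f" if "f \<in> carrier ?F" for c f
  proof -
    let ?S = "{w. f w \<noteq> 0}"
    have S: "finite ?S" "?S \<subseteq> lists X" using car that by auto
    have wS: "word_eval h u \<in> carrier A" if "u \<in> ?S" for u using w S(2) that by blast
    have "?e (c \<odot>\<^bsub>?F\<^esub> f) = (\<Oplus>u\<in>?S. (c * f u) \<odot> word_eval h u)"
      by (subst ev[OF S]) (auto simp: free_alg_simps)
    also have "\<dots> = (\<Oplus>u\<in>?S. c \<odot> (f u \<odot> word_eval h u))"
      using wS by (intro add.finprod_cong') (simp_all add: smult_smult Pi_iff)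
    also have "\<dots> = c \<odot> ?e f"
      using wS by (subst smult_finsum[symmetric]) (simp_all add: ev[OF S order.refl] Pi_iff)
    finally show ?thesis .
  qed
  have e_one: "?e \<one>\<^bsub>?F\<^esub> = \<one>"
    by (subst ev[of "{[]}"]) (auto simp: word_eval_def free_alg_simps)
  have gen_mult': "?e (gen x \<otimes>\<^bsub>?F\<^esub> f) = h x \<otimes> ?e f" if x: "x \<in> X" and f: "f \<in> carrier ?F" for x f
  proof -
    let ?S = "{w. f w \<noteq> 0}"
    have S: "finite ?S" "?S \<subseteq> lists X" using car f by auto
    have wS: "word_eval h u \<in> carrier A" if "u \<in> ?S" for u using w S(2) that by blast
    have hx: "h x \<in> carrier A" using h x by auto
    have "?e (gen x \<otimes>\<^bsub>?F\<^esub> f) = (\<Oplus>u\<in>Cons x ` ?S. (gen x \<otimes>\<^bsub>?F\<^esub> f) u \<odot> word_eval h u)"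
    proof (rule ev)
      show "{u. (gen x \<otimes>\<^bsub>?F\<^esub> f) u \<noteq> 0} \<subseteq> Cons x ` ?S"
      proof
        fix u assume "u \<in> {u. (gen x \<otimes>\<^bsub>?F\<^esub> f) u \<noteq> 0}"
        then show "u \<in> Cons x ` ?S" unfolding gen_mult by (cases u) (auto split: if_splits)
      qed
    qed (use S x in \<open>auto simp: in_lists_conv_set subset_iff\<close>)
    also have "\<dots> = (\<Oplus>u\<in>?S. (gen x \<otimes>\<^bsub>?F\<^esub> f) (x # u) \<odot> word_eval h (x # u))"
    proof (rule add.finprod_reindex)
      show "(\<lambda>u. (gen x \<otimes>\<^bsub>?F\<^esub> f) u \<odot> word_eval h u) \<in> Cons x ` ?S \<rightarrow> carrier A"
        using wS hx by (auto simp: word_eval_Cons)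
    qed auto
    also have "\<dots> = (\<Oplus>u\<in>?S. h x \<otimes> (f u \<odot> word_eval h u))"
    proof (rule add.finprod_cong')
      fix u assume u: "u \<in> ?S"
      show "(gen x \<otimes>\<^bsub>?F\<^esub> f) (x # u) \<odot> word_eval h (x # u) = h x \<otimes> (f u \<odot> word_eval h u)"
        using wS[OF u] hx by (simp add: gen_mult smult_mult_right word_eval_Cons)
    qed (use wS hx in auto)
    also have "\<dots> = h x \<otimes> ?e f"
      using wS hx S(1) by (subst finsum_rdistr[symmetric]) (simp_all add: ev[OF S order.refl] Pi_iff)
    finally show ?thesis .
  qed
  have mult: "?e (f \<otimes>\<^bsub>?F\<^esub> g) = ?e f \<otimes> ?e g" if f: "f \<in> carrier ?F" and g: "g \<in> carrier ?F" for f g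
    using f
  proof (induction f rule: free_alg_induct)
    case (smult_one c)
    have "?e ((c \<odot>\<^bsub>?F\<^esub> \<one>\<^bsub>?F\<^esub>) \<otimes>\<^bsub>?F\<^esub> g) = ?e (c \<odot>\<^bsub>?F\<^esub> g)"
      using g by (simp add: F.smult_mult_left)
    also have "\<dots> = (c \<odot> \<one>) \<otimes> ?e g"
      using g closed[OF g] by (simp add: smult smult_mult_left)
    also have "c \<odot> \<one> = ?e (c \<odot>\<^bsub>?F\<^esub> \<one>\<^bsub>?F\<^esub>)"
      by (simp add: smult e_one)
    finally show ?case .
  next
    case (add f f')
    then show ?case using g closed by (simp add: F.l_distr e_add l_distr)
  next
    case (gen_mult x f)
    then have "gen x \<in> carrier ?F" "h x \<in> carrier A" using h by auto
    with gen_mult show ?case using g closed by (simp add: F.m_assoc gen_mult' m_assoc)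
  qed
  show "?e \<in> alg_hom ?F A"
    unfolding alg_hom_def ring_hom_def using closed e_add smult e_one mult by (auto)
  show "?e (gen x) = h x" if "x \<in> X" for x
    using gen_mult'[OF that F.one_closed] e_one h that by (auto simp: F.r_one Pi_iff)
qed

end

section \<open>Algebras given by generators and relations, and their universal property\<close>

locale presentation =
  fixes X :: "'g set" and R :: "('g list \<Rightarrow> complex) set"
  assumes rels: "R \<subseteq> carrier (free_alg X)"
begin

sublocale F: calgebra "free_alg X" by (rule calgebra_free_alg)

lemma ideal: "ideal (Idl\<^bsub>free_alg X\<^esub> R) (free_alg X)"
  using F.genideal_ideal[OF rels] .

abbreviation "\<pi> \<equiv> (+>\<^bsub>free_alg X\<^esub>) (Idl\<^bsub>free_alg X\<^esub> R)"

lemma calgebra_presented: "calgebra (presented_alg X R)"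
  unfolding presented_alg_def by (rule F.calgebra_quot_alg[OF ideal])

lemma coset_hom: "\<pi> \<in> alg_hom (free_alg X) (presented_alg X R)"
  unfolding presented_alg_def by (rule F.coset_alg_hom[OF ideal])

lemma presented_gen_eq: "presented_gen X R x = \<pi> (gen x)"
  by (simp add: presented_gen_def)

lemma coset_rel: assumes "r \<in> R" shows "\<pi> r = \<zero>\<^bsub>presented_alg X R\<^esub>"
proof -
  interpret I: ideal "Idl\<^bsub>free_alg X\<^esub> R" "free_alg X" by (rule ideal)
  have "r \<in> Idl\<^bsub>free_alg X\<^esub> R" using F.genideal_self[OF rels] assms by blast
  then show ?thesis
    by (simp add: presented_alg_def F.quot_alg_simps FactRing_def I.a_rcos_const)
qed

lemma coset_rel_minus:
  assumes "a \<ominus>\<^bsub>free_alg X\<^esub> b \<in> R" "a \<in> carrier (free_alg X)" "b \<in> carrier (free_alg X)"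
  shows "\<pi> a = \<pi> b"
proof -
  interpret P: calgebra "presented_alg X R" by (rule calgebra_presented)
  have "\<pi> a \<ominus>\<^bsub>presented_alg X R\<^esub> \<pi> b = \<zero>\<^bsub>presented_alg X R\<^esub>"
    using coset_rel[OF assms(1)] alg_hom_minus[OF coset_hom F.calgebra_axioms P.calgebra_axioms assms(2,3)] by simp
  then show ?thesis
    using alg_homD(1)[OF coset_hom assms(2)] alg_homD(1)[OF coset_hom assms(3)] P.minus_eq_zero_iff by blast
qed

lemma carrier_presented: "carrier (presented_alg X R) = \<pi> ` carrier (free_alg X)"
  by (auto simp: presented_alg_def F.quot_alg_simps FactRing_def A_RCOSETS_def')

lemma gen_closed_presented: "x \<in> X \<Longrightarrow> presented_gen X R x \<in> carrier (presented_alg X R)"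
  unfolding presented_gen_eq by (intro alg_homD(1)[OF coset_hom]) simp

text \<open>\<open>presented_map\<close> takes the only element of the image of a coset. There is
  only one because the kernel of the evaluation is an ideal that contains the relations, hence
  contains the ideal they generate.\<close>

lemma presented_map:
  assumes B: "calgebra B" and h: "h \<in> X \<rightarrow> carrier B"
    and R: "\<And>r. r \<in> R \<Longrightarrow> free_eval B h r = \<zero>\<^bsub>B\<^esub>"
  shows "presented_map B h \<in> alg_hom (presented_alg X R) B"
    and "x \<in> X \<Longrightarrow> presented_map B h (presented_gen X R x) = h x"
proof -
  interpret B: calgebra B by (rule B)
  interpret P: calgebra "presented_alg X R" by (rule calgebra_presented)
  interpret I: ideal "Idl\<^bsub>free_alg X\<^esub> R" "free_alg X" by (rule ideal)
  let ?e = "free_eval B h"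
  note e = B.free_eval_alg_hom[OF h]
  have "Idl\<^bsub>free_alg X\<^esub> R \<subseteq> {a \<in> carrier (free_alg X). ?e a = \<zero>\<^bsub>B\<^esub>}"
    using rels R by (intro F.genideal_minimal ideal_kernel[OF e(1) F.calgebra_axioms B]) auto
  then have "?e b = ?e a" if "a \<in> carrier (free_alg X)" "b \<in> \<pi> a" for a b
    using that by (auto simp: a_r_coset_def' alg_homD[OF e(1)])
  moreover have "a \<in> \<pi> a" if "a \<in> carrier (free_alg X)" for a
    using that by (rule I.a_rcos_self)
  ultimately have *: "presented_map B h (\<pi> a) = ?e a" if "a \<in> carrier (free_alg X)" for a
  proof -
    have "?e ` \<pi> a = {?e a}" using that \<open>\<And>a b. _ \<Longrightarrow> _ \<Longrightarrow> ?e b = ?e a\<close> \<open>\<And>a. _ \<Longrightarrow> a \<in> \<pi> a\<close> by blast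
    then show ?thesis by (simp add: presented_map_def)
  qed
  show "presented_map B h \<in> alg_hom (presented_alg X R) B"
    unfolding alg_hom_def ring_hom_def carrier_presented
    by (auto simp: alg_homD(2-5)[OF coset_hom, symmetric] * alg_homD[OF e(1)])
  show "presented_map B h (presented_gen X R x) = h x" if "x \<in> X"
    using * e(2)[OF that] that by (simp add: presented_gen_eq)
qed

lemma alg_hom_eqI:
  assumes f: "f \<in> alg_hom (presented_alg X R) B" and g: "g \<in> alg_hom (presented_alg X R) B"
    and eq: "\<And>x. x \<in> X \<Longrightarrow> f (presented_gen X R x) = g (presented_gen X R x)"
    and u: "u \<in> carrier (presented_alg X R)"
  shows "f u = g u"
proof -
  have *: "f (\<pi> a) = g (\<pi> a)" if "a \<in> carrier (free_alg X)" for a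
    using that
  proof (induction a rule: free_alg_induct)
    case (smult_one c)
    then show ?case
      using alg_homD(4,5)[OF alg_hom_compose[OF coset_hom f]] alg_homD(4,5)[OF alg_hom_compose[OF coset_hom g]] F.one_closed by auto
  next
    case (add a b)
    then show ?case by (simp add: alg_homD[OF coset_hom] alg_homD[OF f] alg_homD[OF g])
  next
    case (gen_mult x a)
    then show ?case using eq[of x]
      by (simp add: alg_homD[OF coset_hom] alg_homD[OF f] alg_homD[OF g] presented_gen_eq)
  qed
  then show ?thesis using u by (auto simp: carrier_presented)
qed

end

section \<open>Descending from the enveloping algebra\<close>

context calgebra begin

lemma lin_span_closed:
  assumes "S \<subseteq> carrier A" "x \<in> lin_span A S" shows "x \<in> carrier A"
  using assms(2) by induction (use assms(1) in auto)

lemma lin_span_add: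
  assumes S: "S \<subseteq> carrier A" and x: "x \<in> lin_span A S" and y: "y \<in> lin_span A S"
  shows "x \<oplus> y \<in> lin_span A S"
  using y
proof induction
  case zero
  then show ?case using x lin_span_closed[OF S x] by simp
next
  case (add a s c)
  have "x \<oplus> (a \<oplus> c \<odot> s) = (x \<oplus> a) \<oplus> c \<odot> s"
    using lin_span_closed[OF S x] lin_span_closed[OF S add(1)] add(2) S by (subst a_assoc) auto
  then show ?case using lin_span.add[OF add(3,2)] by simp
qed

lemma lin_span_smult:
  assumes S: "S \<subseteq> carrier A" and x: "x \<in> lin_span A S"
  shows "d \<odot> x \<in> lin_span A S"
  using x
proof induction
  case zero
  then show ?case by (simp add: lin_span.zero)
next
  case (add a s c)
  have "d \<odot> (a \<oplus> c \<odot> s) = d \<odot> a \<oplus> (d * c) \<odot> s"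
    using lin_span_closed[OF S add(1)] add(2) S by (subst smult_add_right) (auto simp: smult_smult)
  then show ?case using lin_span.add[OF add(3,2)] by simp
qed

lemma lin_span_superset:
  assumes S: "S \<subseteq> carrier A" and x: "x \<in> S"
  shows "x \<in> lin_span A S"
proof -
  have "\<zero> \<oplus> 1 \<odot> x = x" using S x by auto
  then show ?thesis using lin_span.add[OF lin_span.zero x, of A 1] by simp
qed

text \<open>The ordinary commutator, for odd elements too. In Heis it makes the generators commute
  up to scalars, which is what the computations in the Lie superalgebra use.\<close>

definition comm :: "'a \<Rightarrow> 'a \<Rightarrow> 'a" where "comm a b = a \<otimes> b \<ominus> b \<otimes> a"

lemma comm_closed [simp]: "a \<in> carrier A \<Longrightarrow> b \<in> carrier A \<Longrightarrow> comm a b \<in> carrier A"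
  by (simp add: comm_def)

lemma comm_linear_left:
  assumes "a \<in> carrier A" "b \<in> carrier A" "x \<in> carrier A"
  shows "comm (a \<oplus> c \<odot> b) x = comm a x \<oplus> c \<odot> comm b x"
  using assms unfolding comm_def minus_eq_smult[OF m_closed m_closed]
  by (simp add: minus_eq_smult l_distr r_distr smult_add_right smult_mult_left smult_mult_right smult_smult a_ac)

lemma comm_linear_right:
  assumes "a \<in> carrier A" "b \<in> carrier A" "x \<in> carrier A"
  shows "comm x (a \<oplus> c \<odot> b) = comm x a \<oplus> c \<odot> comm x b"
  using assms unfolding comm_def minus_eq_smult[OF m_closed m_closed]
  by (simp add: minus_eq_smult l_distr r_distr smult_add_right smult_mult_left smult_mult_right smult_smult a_ac)

lemma comm_skew:
  assumes "a \<in> carrier A" "b \<in> carrier A" shows "comm a b = (-1) \<odot> comm b a"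
  using assms by (simp add: comm_def minus_eq_smult smult_add_right smult_smult a_ac)

lemma comm_zero [simp]:
  assumes "x \<in> carrier A" shows "comm \<zero> x = \<zero>" "comm x \<zero> = \<zero>"
  using assms by (simp_all add: comm_def minus_eq_zero_iff)

lemma comm_mult_right:
  assumes "a \<in> carrier A" "b \<in> carrier A" "x \<in> carrier A"
  shows "comm x (a \<otimes> b) = comm x a \<otimes> b \<oplus> a \<otimes> comm x b"
proof -
  have "comm x a \<otimes> b \<oplus> a \<otimes> comm x b =
      (x \<otimes> a \<otimes> b \<oplus> (\<ominus> (a \<otimes> x \<otimes> b) \<oplus> a \<otimes> x \<otimes> b)) \<oplus> \<ominus> (a \<otimes> b \<otimes> x)"
    using assms by (simp add: comm_def a_minus_def l_distr r_distr m_assoc l_minus r_minus a_assoc)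
  also have "\<dots> = comm x (a \<otimes> b)"
    using assms by (simp add: comm_def a_minus_def l_neg m_assoc)
  finally show ?thesis by simp
qed

lemma comm_mult_left:
  assumes "a \<in> carrier A" "b \<in> carrier A" "x \<in> carrier A"
  shows "comm (a \<otimes> b) x = comm a x \<otimes> b \<oplus> a \<otimes> comm b x"
proof -
  have "comm (a \<otimes> b) x = (-1) \<odot> comm x (a \<otimes> b)" using assms by (simp add: comm_skew[of "a \<otimes> b"])
  also have "\<dots> = ((-1) \<odot> comm x a) \<otimes> b \<oplus> a \<otimes> ((-1) \<odot> comm x b)"
    using assms by (simp add: comm_mult_right smult_add_right smult_mult_left smult_mult_right)
  finally show ?thesis using assms by (simp add: comm_skew[of a x] comm_skew[of b x])
qed

end

section \<open>The algebra Heis and its universal property\<close>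

lemma presentation_heis: "presentation UNIV (heis_rels :: ('n::finite evec list \<Rightarrow> complex) set)"
proof -
  interpret F: calgebra "free_alg UNIV :: ('n evec list \<Rightarrow> complex) calg" by (rule calgebra_free_alg)
  have [simp]: "gen x \<in> carrier (free_alg UNIV)" for x :: "'n evec" by simp
  show ?thesis
    by unfold_locales (auto simp: heis_rels_def Let_def simp del: gen_closed)
qed

interpretation HP: presentation UNIV "heis_rels :: ('n::finite evec list \<Rightarrow> complex) set"
  by (rule presentation_heis)

interpretation H: calgebra "heis :: 'n::finite heis_elem calg"
  unfolding heis_def by (rule HP.calgebra_presented)

lemma heis_gen_closed [simp]: "heis_gen y \<in> carrier heis"
  unfolding heis_gen_def heis_def by (rule HP.gen_closed_presented) simp

lemma heis_gen_linear:
  "heis_gen (evec_scale a y + evec_scale b z) = a \<odot>\<^bsub>heis\<^esub> heis_gen y \<oplus>\<^bsub>heis\<^esub> b \<odot>\<^bsub>heis\<^esub> heis_gen (z :: 'n::finite evec)"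
proof -
  have "HP.\<pi> (gen (evec_scale a y + evec_scale b z)) =
      HP.\<pi> (a \<odot>\<^bsub>free_alg UNIV\<^esub> gen y \<oplus>\<^bsub>free_alg UNIV\<^esub> b \<odot>\<^bsub>free_alg UNIV\<^esub> gen z)"
  proof (rule HP.coset_rel_minus)
    show "gen (evec_scale a y + evec_scale b z) \<ominus>\<^bsub>free_alg UNIV\<^esub>
        (a \<odot>\<^bsub>free_alg UNIV\<^esub> gen y \<oplus>\<^bsub>free_alg UNIV\<^esub> b \<odot>\<^bsub>free_alg UNIV\<^esub> gen z) \<in> heis_rels"
      unfolding heis_rels_def Let_def by blast
  qed simp_all
  also have "\<dots> = a \<odot>\<^bsub>heis\<^esub> HP.\<pi> (gen y) \<oplus>\<^bsub>heis\<^esub> b \<odot>\<^bsub>heis\<^esub> HP.\<pi> (gen z)"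
    unfolding heis_def by (simp add: alg_homD[OF HP.coset_hom])
  finally show ?thesis by (simp add: heis_gen_def HP.presented_gen_eq)
qed

lemma heis_gen_comm: "H.comm (heis_gen y) (heis_gen z) = (symp y z / 2) \<odot>\<^bsub>heis\<^esub> \<one>\<^bsub>heis\<^esub>"
proof -
  have "HP.\<pi> (gen y \<otimes>\<^bsub>free_alg UNIV\<^esub> gen z \<ominus>\<^bsub>free_alg UNIV\<^esub> gen z \<otimes>\<^bsub>free_alg UNIV\<^esub> gen y) =
      HP.\<pi> ((symp y z / 2) \<odot>\<^bsub>free_alg UNIV\<^esub> \<one>\<^bsub>free_alg UNIV\<^esub>)"
  proof (rule HP.coset_rel_minus)
    show "(gen y \<otimes>\<^bsub>free_alg UNIV\<^esub> gen z \<ominus>\<^bsub>free_alg UNIV\<^esub> gen z \<otimes>\<^bsub>free_alg UNIV\<^esub> gen y) \<ominus>\<^bsub>free_alg UNIV\<^esub>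
        (symp y z / 2) \<odot>\<^bsub>free_alg UNIV\<^esub> \<one>\<^bsub>free_alg UNIV\<^esub> \<in> heis_rels"
      unfolding heis_rels_def Let_def by blast
  qed simp_all
  then show ?thesis
    unfolding heis_def
    by (simp add: alg_homD[OF HP.coset_hom] alg_hom_minus[OF HP.coset_hom HP.F.calgebra_axioms HP.calgebra_presented]
        H.comm_def[unfolded heis_def] heis_gen_def HP.presented_gen_eq)
qed

lemma heis_lift:
  fixes d :: "'n::finite evec \<Rightarrow> 'b"
  assumes B: "calgebra B" and d: "\<And>y. d y \<in> carrier B"
    and linear: "\<And>a b y z. d (evec_scale a y + evec_scale b z) = a \<odot>\<^bsub>B\<^esub> d y \<oplus>\<^bsub>B\<^esub> b \<odot>\<^bsub>B\<^esub> d z"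
    and comm: "\<And>y z. d y \<otimes>\<^bsub>B\<^esub> d z \<ominus>\<^bsub>B\<^esub> d z \<otimes>\<^bsub>B\<^esub> d y = (symp y z / 2) \<odot>\<^bsub>B\<^esub> \<one>\<^bsub>B\<^esub>"
  shows "presented_map B d \<in> alg_hom heis B" "presented_map B d (heis_gen y) = d y"
proof -
  interpret B: calgebra B by (rule B)
  have d': "d \<in> UNIV \<rightarrow> carrier B" using d by auto
  note e = B.free_eval_alg_hom[OF d']
  have rel: "free_eval B d r = \<zero>\<^bsub>B\<^esub>" if "r \<in> heis_rels" for r
    using that
    by (auto simp: heis_rels_def Let_def alg_hom_minus[OF e(1) HP.F.calgebra_axioms B] alg_homD[OF e(1)] e(2)
        linear comm d B.minus_eq_zero_iff)
  show "presented_map B d \<in> alg_hom heis B" "presented_map B d (heis_gen y) = d y"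
    using HP.presented_map[OF B d' rel] by (auto simp: heis_def heis_gen_def)
qed

section \<open>The Lie superalgebra inside Heis, closed under the supercommutator\<close>

definition sym_prods :: "'n::finite heis_elem set" where
  "sym_prods = {heis_gen y \<otimes>\<^bsub>heis\<^esub> heis_gen z \<oplus>\<^bsub>heis\<^esub> heis_gen z \<otimes>\<^bsub>heis\<^esub> heis_gen y | y z. True}"

lemma osp_part_simps: "osp_part False = lin_span heis sym_prods" "osp_part True = range heis_gen"
  by (simp_all add: osp_part_def sym_prods_def)

lemma sym_prodsE:
  assumes "s \<in> sym_prods"
  obtains y z where "s = heis_gen y \<otimes>\<^bsub>heis\<^esub> heis_gen z \<oplus>\<^bsub>heis\<^esub> heis_gen z \<otimes>\<^bsub>heis\<^esub> heis_gen y"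
  using assms unfolding sym_prods_def by blast

lemma sym_prods_closed: "sym_prods \<subseteq> carrier heis"
  by (auto elim!: sym_prodsE)

lemma osp_part_closed: "x \<in> osp_part p \<Longrightarrow> x \<in> carrier heis"
  using H.lin_span_closed[OF sym_prods_closed] by (cases p) (auto simp: osp_part_simps)

lemma osp_part_linear:
  assumes "x \<in> osp_part p" "x' \<in> osp_part p"
  shows "a \<odot>\<^bsub>heis\<^esub> x \<oplus>\<^bsub>heis\<^esub> b \<odot>\<^bsub>heis\<^esub> x' \<in> osp_part p"
proof (cases p)
  case True
  with assms obtain y z where "x = heis_gen y" "x' = heis_gen z" by (auto simp: osp_part_simps)
  then have "a \<odot>\<^bsub>heis\<^esub> x \<oplus>\<^bsub>heis\<^esub> b \<odot>\<^bsub>heis\<^esub> x' = heis_gen (evec_scale a y + evec_scale b z)"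
    by (simp add: heis_gen_linear)
  then show ?thesis using True by (simp add: osp_part_simps)
next
  case False
  then show ?thesis using assms
    by (simp add: osp_part_simps H.lin_span_add[OF sym_prods_closed] H.lin_span_smult[OF sym_prods_closed])
qed

lemma osp_part_add:
  assumes "x \<in> osp_part p" "x' \<in> osp_part p" shows "x \<oplus>\<^bsub>heis\<^esub> x' \<in> osp_part p"
  using osp_part_linear[OF assms, of 1 1] assms by (simp add: osp_part_closed)

lemma osp_part_smult:
  assumes "x \<in> osp_part p" shows "c \<odot>\<^bsub>heis\<^esub> x \<in> osp_part p"
  using osp_part_linear[OF assms assms, of c 0] osp_part_closed[OF assms] by simp

lemma osp_part_zero: "\<zero>\<^bsub>heis\<^esub> \<in> (osp_part p :: 'n::finite heis_elem set)"
proof -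
  obtain x :: "'n heis_elem" where "x \<in> osp_part p"
    using lin_span.zero[of heis] by (cases p) (auto simp: osp_part_simps)
  then have "0 \<odot>\<^bsub>heis\<^esub> x \<in> osp_part p" "x \<in> carrier heis" by (auto intro: osp_part_smult osp_part_closed)
  then show ?thesis by simp
qed

lemma osp_part_subset: "x \<in> osp_part p \<Longrightarrow> x \<in> osp"
  using osp_part_zero osp_part_closed by (cases p) (force simp: osp_def)+

lemma osp_closed: "x \<in> osp \<Longrightarrow> x \<in> carrier heis"
  by (auto simp: osp_def osp_part_closed)

lemma osp_linear:
  assumes "x \<in> osp" "x' \<in> osp" shows "a \<odot>\<^bsub>heis\<^esub> x \<oplus>\<^bsub>heis\<^esub> b \<odot>\<^bsub>heis\<^esub> x' \<in> osp"
proof -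
  from assms obtain u v u' v' where x: "x = u \<oplus>\<^bsub>heis\<^esub> v" "x' = u' \<oplus>\<^bsub>heis\<^esub> v'"
    and p: "u \<in> osp_part False" "u' \<in> osp_part False" "v \<in> osp_part True" "v' \<in> osp_part True"
    by (auto simp: osp_def)
  have "a \<odot>\<^bsub>heis\<^esub> x \<oplus>\<^bsub>heis\<^esub> b \<odot>\<^bsub>heis\<^esub> x' =
      (a \<odot>\<^bsub>heis\<^esub> u \<oplus>\<^bsub>heis\<^esub> b \<odot>\<^bsub>heis\<^esub> u') \<oplus>\<^bsub>heis\<^esub> (a \<odot>\<^bsub>heis\<^esub> v \<oplus>\<^bsub>heis\<^esub> b \<odot>\<^bsub>heis\<^esub> v')"
    using p[THEN osp_part_closed] by (simp add: x H.smult_add_right H.a_ac)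
  then show ?thesis using osp_part_linear[OF p(1,2), of a b] osp_part_linear[OF p(3,4), of a b]
    unfolding osp_def by blast
qed

text \<open>The commutator with w is a derivation and sends each generator to a scalar, so it sends
  a product of two generators to a linear combination of them.\<close>

lemma comm_even_odd:
  assumes "x \<in> osp_part False" "w \<in> osp_part True" shows "H.comm x w \<in> osp_part True"
proof -
  from assms(2) obtain v where w: "w = heis_gen v" by (auto simp: osp_part_simps)
  have "x \<in> lin_span heis sym_prods" using assms(1) by (simp add: osp_part_simps)
  then show ?thesis
  proof induction
    case zero
    show ?case using assms(2) by (simp add: osp_part_zero osp_part_closed)
  next
    case (add a s c)
    then obtain y z where s: "s = heis_gen y \<otimes>\<^bsub>heis\<^esub> heis_gen z \<oplus>\<^bsub>heis\<^esub> heis_gen z \<otimes>\<^bsub>heis\<^esub> heis_gen y" by (auto elim: sym_prodsE)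
    have gen: "heis_gen u \<in> osp_part True" for u by (simp add: osp_part_simps)
    have "H.comm (heis_gen y \<otimes>\<^bsub>heis\<^esub> heis_gen z) w \<in> osp_part True" for y z
      by (simp add: w H.comm_mult_left heis_gen_comm H.smult_mult_left H.smult_mult_right osp_part_add osp_part_smult gen)
    moreover have "H.comm s w = H.comm (heis_gen y \<otimes>\<^bsub>heis\<^esub> heis_gen z) w
        \<oplus>\<^bsub>heis\<^esub> 1 \<odot>\<^bsub>heis\<^esub> H.comm (heis_gen z \<otimes>\<^bsub>heis\<^esub> heis_gen y) w"
      using H.comm_linear_left[of "heis_gen y \<otimes>\<^bsub>heis\<^esub> heis_gen z" "heis_gen z \<otimes>\<^bsub>heis\<^esub> heis_gen y" w 1]
      by (simp add: s w)
    ultimately have "H.comm s w \<in> osp_part True" by (simp add: osp_part_add osp_part_smult)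
    moreover have "a \<in> carrier heis" using add(1) H.lin_span_closed[OF sym_prods_closed] by blast
    ultimately show ?case using add(3)
      by (subst H.comm_linear_left) (auto simp: s w osp_part_add osp_part_smult)
  qed
qed

lemma sym_prod_even:
  assumes "x \<in> osp_part True" "y \<in> osp_part True"
  shows "x \<otimes>\<^bsub>heis\<^esub> y \<oplus>\<^bsub>heis\<^esub> y \<otimes>\<^bsub>heis\<^esub> x \<in> osp_part False"
proof -
  have "x \<otimes>\<^bsub>heis\<^esub> y \<oplus>\<^bsub>heis\<^esub> y \<otimes>\<^bsub>heis\<^esub> x \<in> sym_prods"
    using assms unfolding osp_part_simps sym_prods_def by blast
  then show ?thesis using H.lin_span_superset[OF sym_prods_closed] by (simp add: osp_part_simps)
qed

text \<open>As a derivation, the commutator with x turns the symmetrized product of y and z into the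
  symmetrized product of [x, y] and z plus that of y and [x, z]. The factors stay odd by
  \<open>comm_even_odd\<close>.\<close>

lemma comm_even_even:
  assumes x: "x \<in> osp_part False" and "x' \<in> osp_part False" shows "H.comm x x' \<in> osp_part False"
proof -
  have xc: "x \<in> carrier heis" using x by (rule osp_part_closed)
  have "x' \<in> lin_span heis sym_prods" using assms(2) by (simp add: osp_part_simps)
  then show ?thesis
  proof induction
    case zero
    show ?case using xc by (simp add: osp_part_zero)
  next
    case (add a s c)
    then obtain y z where s: "s = heis_gen y \<otimes>\<^bsub>heis\<^esub> heis_gen z \<oplus>\<^bsub>heis\<^esub> heis_gen z \<otimes>\<^bsub>heis\<^esub> heis_gen y" by (auto elim: sym_prodsE)
    have gen: "heis_gen u \<in> osp_part True" for u by (simp add: osp_part_simps)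
    let ?y = "H.comm x (heis_gen y)" and ?z = "H.comm x (heis_gen z)"
    have "H.comm x s = H.comm x (heis_gen y \<otimes>\<^bsub>heis\<^esub> heis_gen z)
        \<oplus>\<^bsub>heis\<^esub> 1 \<odot>\<^bsub>heis\<^esub> H.comm x (heis_gen z \<otimes>\<^bsub>heis\<^esub> heis_gen y)"
      using H.comm_linear_right[of "heis_gen y \<otimes>\<^bsub>heis\<^esub> heis_gen z" "heis_gen z \<otimes>\<^bsub>heis\<^esub> heis_gen y" x 1] xc
      by (simp add: s)
    also have "\<dots> = (?y \<otimes>\<^bsub>heis\<^esub> heis_gen z \<oplus>\<^bsub>heis\<^esub> heis_gen z \<otimes>\<^bsub>heis\<^esub> ?y)
        \<oplus>\<^bsub>heis\<^esub> (heis_gen y \<otimes>\<^bsub>heis\<^esub> ?z \<oplus>\<^bsub>heis\<^esub> ?z \<otimes>\<^bsub>heis\<^esub> heis_gen y)"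
      using xc by (simp add: H.comm_mult_right H.a_ac)
    also have "\<dots> \<in> osp_part False"
      by (intro osp_part_add sym_prod_even comm_even_odd x gen)
    finally have "H.comm x s \<in> osp_part False" .
    moreover have "a \<in> carrier heis" using add(1) H.lin_span_closed[OF sym_prods_closed] by blast
    ultimately show ?case using add(3) xc
      by (subst H.comm_linear_right) (auto simp: s osp_part_add osp_part_smult)
  qed
qed

text \<open>Without this closure the symbol \<open>gen (supercomm heis p q x x')\<close> in
  \<open>uea_rels\<close> would not be an element of the free algebra on \<open>osp\<close>.\<close>

lemma supercomm_closed:
  assumes "x \<in> osp_part p" "x' \<in> osp_part q"
  shows "supercomm heis p q x x' \<in> osp"
proof -
  have "supercomm heis p q x x' \<in> osp_part (p \<noteq> q)"
    using assms sym_prod_even[of x x'] comm_even_even[of x x'] comm_even_odd[of x x'] comm_even_odd[of x' x]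
      osp_part_smult[of "H.comm x' x" True "-1"]
      H.comm_skew[OF osp_part_closed osp_part_closed, of x p x' q]
    by (cases p; cases q) (simp_all add: supercomm_def flip: H.comm_def)
  then show ?thesis by (rule osp_part_subset)
qed

section \<open>The enveloping algebra, its map to Heis, and actions that factor through it\<close>

lemma uea_relsE:
  assumes "r \<in> uea_rels"
  obtains (linear) a b x x' where "x \<in> osp" "x' \<in> osp"
      "r = gen (a \<odot>\<^bsub>heis\<^esub> x \<oplus>\<^bsub>heis\<^esub> b \<odot>\<^bsub>heis\<^esub> x') \<ominus>\<^bsub>free_alg osp\<^esub> (a \<odot>\<^bsub>free_alg osp\<^esub> gen x \<oplus>\<^bsub>free_alg osp\<^esub> b \<odot>\<^bsub>free_alg osp\<^esub> gen x')"
    | (supercomm) p q x x' where "x \<in> osp_part p" "x' \<in> osp_part q"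
      "r = supercomm (free_alg osp) p q (gen x) (gen x') \<ominus>\<^bsub>free_alg osp\<^esub> gen (supercomm heis p q x x')"
  using assms unfolding uea_rels_def Let_def by blast

lemma supercomm_gen_closed:
  assumes "x \<in> osp" "x' \<in> osp"
  shows "supercomm (free_alg osp) p q (gen x) (gen x') \<in> carrier (free_alg osp)"
proof -
  interpret F: calgebra "free_alg (osp :: 'n::finite heis_elem set)" by (rule calgebra_free_alg)
  show ?thesis using assms by (simp add: supercomm_def)
qed

lemma presentation_uea: "presentation osp (uea_rels :: ('n::finite heis_elem list \<Rightarrow> complex) set)"
proof (unfold_locales, rule subsetI)
  interpret F: calgebra "free_alg osp :: ('n heis_elem list \<Rightarrow> complex) calg" by (rule calgebra_free_alg)
  fix r :: "'n heis_elem list \<Rightarrow> complex" assume "r \<in> uea_rels"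
  then show "r \<in> carrier (free_alg osp)"
    by (cases rule: uea_relsE) (simp_all add: osp_linear supercomm_gen_closed osp_part_subset supercomm_closed)
qed

interpretation UP: presentation osp "uea_rels :: ('n::finite heis_elem list \<Rightarrow> complex) set"
  by (rule presentation_uea)

interpretation U: calgebra "uea :: 'n::finite uea_elem calg"
  unfolding uea_def by (rule UP.calgebra_presented)

lemma uea_gen_closed: "x \<in> osp \<Longrightarrow> uea_gen x \<in> carrier uea"
  unfolding uea_gen_def uea_def by (rule UP.gen_closed_presented)

lemma uea_gen_linear:
  assumes "x \<in> osp" "x' \<in> osp"
  shows "uea_gen (a \<odot>\<^bsub>heis\<^esub> x \<oplus>\<^bsub>heis\<^esub> b \<odot>\<^bsub>heis\<^esub> x') = a \<odot>\<^bsub>uea\<^esub> uea_gen x \<oplus>\<^bsub>uea\<^esub> b \<odot>\<^bsub>uea\<^esub> uea_gen x'"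
proof -
  have "UP.\<pi> (gen (a \<odot>\<^bsub>heis\<^esub> x \<oplus>\<^bsub>heis\<^esub> b \<odot>\<^bsub>heis\<^esub> x')) =
      UP.\<pi> (a \<odot>\<^bsub>free_alg osp\<^esub> gen x \<oplus>\<^bsub>free_alg osp\<^esub> b \<odot>\<^bsub>free_alg osp\<^esub> gen x')"
    by (rule UP.coset_rel_minus) (use assms in \<open>auto simp: uea_rels_def Let_def osp_linear\<close>)
  also have "\<dots> = a \<odot>\<^bsub>uea\<^esub> UP.\<pi> (gen x) \<oplus>\<^bsub>uea\<^esub> b \<odot>\<^bsub>uea\<^esub> UP.\<pi> (gen x')"
    using assms unfolding uea_def by (simp add: alg_homD[OF UP.coset_hom])
  finally show ?thesis by (simp add: uea_gen_def UP.presented_gen_eq)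
qed

text \<open>This is the bracket relation for two odd elements. It expresses the spanning elements of
  the even part through odd ones, which is why the odd part generates.\<close>

lemma uea_gen_sym_prod:
  assumes "x \<in> osp_part True" "y \<in> osp_part True"
  shows "uea_gen (x \<otimes>\<^bsub>heis\<^esub> y \<oplus>\<^bsub>heis\<^esub> y \<otimes>\<^bsub>heis\<^esub> x) =
    uea_gen x \<otimes>\<^bsub>uea\<^esub> uea_gen y \<oplus>\<^bsub>uea\<^esub> uea_gen y \<otimes>\<^bsub>uea\<^esub> uea_gen x"
proof -
  have xy: "x \<in> osp" "y \<in> osp" using assms by (auto intro: osp_part_subset)
  have "supercomm (free_alg osp) True True (gen x) (gen y) \<ominus>\<^bsub>free_alg osp\<^esub> gen (supercomm heis True True x y) \<in> uea_rels"
    using assms unfolding uea_rels_def Let_def by blast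
  then have "UP.\<pi> (supercomm (free_alg osp) True True (gen x) (gen y)) = UP.\<pi> (gen (supercomm heis True True x y))"
    by (rule UP.coset_rel_minus) (use xy supercomm_closed[OF assms] in \<open>auto simp: supercomm_def\<close>)
  then show ?thesis using xy
    unfolding uea_def by (simp add: supercomm_def alg_homD[OF UP.coset_hom] uea_gen_def UP.presented_gen_eq)
qed

text \<open>The bracket of \<open>osp\<close> is the supercommutator of Heis, so the inclusion into
  Heis satisfies the defining relations of the enveloping algebra.\<close>

lemma uea_to_heis:
  shows "uea_to_heis \<in> alg_hom uea (heis :: 'n::finite heis_elem calg)"
    and "x \<in> osp \<Longrightarrow> uea_to_heis (uea_gen x) = (x :: 'n heis_elem)"
proof -
  have id: "(\<lambda>x. x) \<in> (osp :: 'n heis_elem set) \<rightarrow> carrier heis" by (auto simp: osp_closed)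
  note e = H.free_eval_alg_hom[OF id]
  have rel: "free_eval heis (\<lambda>x. x) r = \<zero>\<^bsub>heis\<^esub>" if "r \<in> uea_rels" for r :: "'n heis_elem list \<Rightarrow> complex"
  proof -
    have *: "free_eval heis (\<lambda>x. x) (supercomm (free_alg osp) p q (gen x) (gen y)) = supercomm heis p q x y"
      if "x \<in> osp" "y \<in> osp" for p q and x y :: "'n heis_elem"
      using that by (simp add: supercomm_def alg_hom_minus[OF e(1) UP.F.calgebra_axioms H.calgebra_axioms] alg_homD[OF e(1)] e(2))
    note e_minus = alg_hom_minus[OF e(1) UP.F.calgebra_axioms H.calgebra_axioms]
    from that show ?thesis
    proof (cases rule: uea_relsE)
      case (linear a b x x')
      then show ?thesis
        by (simp add: e_minus alg_homD[OF e(1)] e(2) osp_linear osp_closed H.minus_eq_zero_iff)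
    next
      case (supercomm p q x x')
      then show ?thesis using supercomm_closed[OF supercomm(1,2)]
        by (simp add: e_minus e(2) osp_closed H.minus_eq_zero_iff osp_part_subset supercomm_gen_closed *)
    qed
  qed
  show "uea_to_heis \<in> alg_hom uea (heis :: 'n::finite heis_elem calg)"
    "x \<in> osp \<Longrightarrow> uea_to_heis (uea_gen x) = (x :: 'n heis_elem)"
    using UP.presented_map[OF H.calgebra_axioms id rel] by (simp_all add: uea_to_heis_def uea_def uea_gen_def)
qed

text \<open>The lift of d to Heis, composed with \<open>uea_to_heis\<close>, is one action. Any
  other agrees with it on odd elements, then on symmetrized products by
  \<open>uea_gen_sym_prod\<close>, then on \<open>osp\<close> by linearity, and finally on all of
  the enveloping algebra by \<open>alg_hom_eqI\<close>; so it factors through the same lift.\<close>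

theorem osp_actions_descend:
  fixes d :: "'n::finite evec \<Rightarrow> 'b"
  assumes B: "calgebra B" and d: "\<And>y. d y \<in> carrier B"
    and linear: "\<And>a b y z. d (evec_scale a y + evec_scale b z) = a \<odot>\<^bsub>B\<^esub> d y \<oplus>\<^bsub>B\<^esub> b \<odot>\<^bsub>B\<^esub> d z"
    and comm: "\<And>y z. d y \<otimes>\<^bsub>B\<^esub> d z \<ominus>\<^bsub>B\<^esub> d z \<otimes>\<^bsub>B\<^esub> d y = (symp y z / 2) \<odot>\<^bsub>B\<^esub> \<one>\<^bsub>B\<^esub>"
  shows "osp_actions B d \<noteq> {}" and "\<forall>\<rho>\<in>osp_actions B d. descends B \<rho>"
proof -
  interpret B: calgebra B by (rule B)
  note lift = heis_lift[OF assms]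
  let ?h = "presented_map B d" and ?s = "presented_map B d \<circ> uea_to_heis"
  have gen: "heis_gen y \<in> osp_part True" for y :: "'n evec" by (simp add: osp_part_simps)
  have s: "?s \<in> alg_hom uea B" by (rule alg_hom_compose[OF uea_to_heis(1) lift(1)])
  have s_gen: "?s (uea_gen (heis_gen y)) = d y" for y
    using lift(2) uea_to_heis(2)[OF osp_part_subset[OF gen]] by simp
  show "osp_actions B d \<noteq> {}" using s s_gen by (auto simp: osp_actions_def)
  show "\<forall>\<rho>\<in>osp_actions B d. descends B \<rho>"
  proof
    fix \<rho> assume "\<rho> \<in> osp_actions B d"
    then have r: "\<rho> \<in> alg_hom uea B" and r_gen: "\<And>y. \<rho> (uea_gen (heis_gen y)) = d y"
      by (auto simp: osp_actions_def)
    have odd: "\<rho> (uea_gen x) = ?s (uea_gen x)" if "x \<in> osp_part True" for x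
      using that r_gen s_gen by (auto simp: osp_part_simps)
    have lin: "f (uea_gen (a \<odot>\<^bsub>heis\<^esub> x \<oplus>\<^bsub>heis\<^esub> b \<odot>\<^bsub>heis\<^esub> x')) = a \<odot>\<^bsub>B\<^esub> f (uea_gen x) \<oplus>\<^bsub>B\<^esub> b \<odot>\<^bsub>B\<^esub> f (uea_gen x')"
      if "f \<in> alg_hom uea B" "x \<in> osp" "x' \<in> osp" for f a b and x x' :: "'n heis_elem"
      using that by (simp add: uea_gen_linear alg_homD[OF that(1)] uea_gen_closed)
    have even: "\<rho> (uea_gen x) = ?s (uea_gen x)" if "x \<in> osp_part False" for x
    proof -
      have "x \<in> lin_span heis sym_prods" using that by (simp add: osp_part_simps)
      then show ?thesis
      proof induction
        case zero
        \<comment> \<open>Zero lies in the odd part as well, where agreement is already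
          known.\<close>
        show ?case using odd[OF osp_part_zero] .
      next
        case (add a t c)
        then obtain y z where t: "t = heis_gen y \<otimes>\<^bsub>heis\<^esub> heis_gen z \<oplus>\<^bsub>heis\<^esub> heis_gen z \<otimes>\<^bsub>heis\<^esub> heis_gen y" by (auto elim: sym_prodsE)
        have "\<rho> (uea_gen t) = ?s (uea_gen t)"
          unfolding t uea_gen_sym_prod[OF gen gen]
          using odd[OF gen] by (simp add: alg_homD[OF r] alg_homD[OF s, unfolded comp_def] uea_gen_closed osp_part_subset[OF gen])
        moreover have "a \<in> osp" "t \<in> osp"
          using add(1) osp_part_subset[of a False] osp_part_subset[OF sym_prod_even[OF gen gen]] by (auto simp: osp_part_simps t)
        ultimately show ?case
          using lin[OF r, of a t 1 c] lin[OF s, of a t 1 c] add(3) osp_closed[of a] by simp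
      qed
    qed
    have "\<rho> (uea_gen x) = ?s (uea_gen x)" if "x \<in> osp" for x
    proof -
      from that obtain a b where x: "x = a \<oplus>\<^bsub>heis\<^esub> b" and ab: "a \<in> osp_part False" "b \<in> osp_part True"
        by (auto simp: osp_def)
      then show ?thesis
        using lin[OF r, of a b 1 1] lin[OF s, of a b 1 1] odd[of b] even[of a] osp_part_closed[OF ab(1)] osp_part_closed[OF ab(2)]
          osp_part_subset[OF ab(1)] osp_part_subset[OF ab(2)] by simp
    qed
    then have "\<rho> u = ?s u" if "u \<in> carrier uea" for u
      using UP.alg_hom_eqI[of \<rho> B ?s u] r s that by (simp add: uea_def uea_gen_def)
    then show "descends B \<rho>" unfolding descends_def using lift(1) by auto
  qed
qed

section \<open>Holomorphic functions of several variables\<close>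

text \<open>Complex scaling of matrices. A differential L is complex linear precisely if it is real
  linear and commutes with it, which is the second condition in \<open>holo_on\<close> and
  \<open>frechet_holo\<close>.\<close>

definition cscale :: "complex \<Rightarrow> 'n::finite cmat \<Rightarrow> 'n cmat" where
  "cscale z x = (\<chi> k l. z * x $ k $ l)"

lemma cscale_nth [simp]: "cscale z x $ k $ l = z * x $ k $ l"
  by (simp add: cscale_def)

lemma bounded_linear_cscale: "bounded_linear (\<lambda>z. cscale z h)" "bounded_linear (cscale c)"
  by (auto simp: linear_conv_bounded_linear[symmetric] vec_eq_iff algebra_simps intro!: linearI)

lemmas continuous_on_cscale [continuous_intros] = bounded_linear.continuous_on[OF bounded_linear_cscale(1)]

lemma cscale_simps [simp]: "cscale 0 x = 0" "cscale c 0 = 0" "cscale 1 x = x"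
  by (simp_all add: vec_eq_iff)

definition frechet_holo :: "'n::finite cmat set \<Rightarrow> ('n cmat \<Rightarrow> complex) \<Rightarrow> bool" where
  "frechet_holo S F \<longleftrightarrow> (\<forall>T\<in>S. \<exists>L. (F has_derivative L) (at T) \<and> (\<forall>c x. L (cscale c x) = c * L x))"

definition pd :: "'n::finite cmat \<Rightarrow> ('n cmat \<Rightarrow> complex) \<Rightarrow> 'n cmat \<Rightarrow> complex" where
  "pd h F T = deriv (\<lambda>z. F (T + cscale z h)) 0"

lemma line_has_field_derivative:
  assumes "(F has_derivative L) (at (T + cscale w h))" and lin: "\<And>c x. L (cscale c x) = c * L x"
  shows "((\<lambda>z. F (T + cscale z h)) has_field_derivative L h) (at w)"
proof -
  have "((\<lambda>z. T + cscale z h) has_derivative (\<lambda>z. cscale z h)) (at w)"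
    using has_derivative_add[OF has_derivative_const[of T] bounded_linear_imp_has_derivative[OF bounded_linear_cscale(1)]]
    by simp
  from has_derivative_compose[OF this assms(1)] show ?thesis
    by (simp add: has_field_derivative_def lin mult.commute[of _ "L h"])
qed

lemma frechet_holo_pd:
  assumes "frechet_holo S F" "T \<in> S"
  shows "(F has_derivative (\<lambda>h. pd h F T)) (at T)" "pd (cscale c h) F T = c * pd h F T"
proof -
  from assms obtain L where L: "(F has_derivative L) (at T)" "\<And>c x. L (cscale c x) = c * L x"
    by (auto simp: frechet_holo_def)
  have "pd h F T = L h" for h
    unfolding pd_def using line_has_field_derivative[of F L T 0 h] L by (intro DERIV_imp_deriv) auto
  then show "(F has_derivative (\<lambda>h. pd h F T)) (at T)" "pd (cscale c h) F T = c * pd h F T"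
    using L by simp_all
qed

lemma frechet_holo_continuous_on: "frechet_holo S F \<Longrightarrow> continuous_on S F"
  unfolding frechet_holo_def
  by (intro continuous_at_imp_continuous_on ballI) (blast intro: has_derivative_continuous)

text \<open>The bound \<open>2 * r\<close> leaves room around the closed disc of radius r, so that
  the circle of radius r lies in an open disc on which the function is holomorphic. The radius is
  uniform for T near T0, which allows one integral formula for all these T.\<close>

lemma polydisc_nhd:
  fixes T0 h :: "'n::finite cmat"
  assumes "open S" "T0 \<in> S"
  obtains d r where "d > 0" "r > 0" "\<And>T z. dist T T0 < d \<Longrightarrow> norm z < 2 * r \<Longrightarrow> T + cscale z h \<in> S"
proof -
  let ?m = "\<lambda>p. fst p + cscale (snd p) h"
  have "open (?m -` S)"
    by (intro open_vimage assms(1) continuous_intros)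
  moreover have "(T0, 0) \<in> ?m -` S" using assms(2) by simp
  ultimately obtain A B where AB: "open A" "open B" "(T0, 0) \<in> A \<times> B" "A \<times> B \<subseteq> ?m -` S"
    by (rule open_prod_elim)
  then have "T0 \<in> A" "0 \<in> B" by auto
  obtain d where d: "d > 0" "ball T0 d \<subseteq> A" using AB(1) \<open>T0 \<in> A\<close> unfolding open_contains_ball by blast
  obtain r where r: "r > 0" "ball 0 r \<subseteq> B" using AB(2) \<open>0 \<in> B\<close> unfolding open_contains_ball by blast
  show thesis
  proof
    show "T + cscale z h \<in> S" if "dist T T0 < d" "norm z < 2 * (r / 2)" for T z
    proof -
      have "T \<in> A" "z \<in> B" using that d r by (auto simp: dist_commute)
      then show ?thesis using AB(4) by auto
    qed
  qed (use d r in auto)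
qed

section \<open>Cauchy's formula along complex lines, and regularity of directional
  derivatives\<close>

text \<open>The points of \<open>circlepath 0 r\<close>, with parameter in [0, 1]. With them
  Cauchy's formula is an integral over a fixed real interval, depending on the matrix as a
  parameter.\<close>

definition circ :: "real \<Rightarrow> real \<Rightarrow> complex" where
  "circ r t = of_real r * exp (2 * of_real pi * \<i> * of_real t)"

lemma circ_props:
  assumes "r > 0" shows "norm (circ r t) = r" "circ r t \<noteq> 0"
  using assms by (auto simp: circ_def norm_mult norm_exp_eq_Re)

lemma continuous_on_circ [continuous_intros]:
  "continuous_on A f \<Longrightarrow> continuous_on A (\<lambda>x. circ r (f x))"
  unfolding circ_def by (intro continuous_intros)

lemma cauchy_pd:
  assumes F: "frechet_holo S F" and r: "r > 0"
    and S: "\<And>z. norm z < 2 * r \<Longrightarrow> T + cscale z h \<in> S"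
  shows "pd h F T = integral (cbox 0 1) (\<lambda>t. F (T + cscale (circ r t) h) / circ r t)"
proof -
  let ?f = "\<lambda>z. F (T + cscale z h)"
  have der: "(?f has_field_derivative pd h F (T + cscale z h)) (at z)" if "norm z < 2 * r" for z
    by (rule line_has_field_derivative) (use frechet_holo_pd[OF F S[OF that]] in auto)
  have "?f holomorphic_on ball 0 (2 * r)"
    using der unfolding holomorphic_on_open[OF open_ball] by (intro ballI exI) simp
  then have holo: "continuous_on (cball 0 r) ?f" "?f holomorphic_on ball 0 r"
    using r by (auto intro: holomorphic_on_imp_continuous_on holomorphic_on_subset continuous_on_subset)
  have "pd h F T = 1 / (2 * of_real pi * \<i>) * contour_integral (circlepath 0 r) (\<lambda>u. ?f u / u\<^sup>2)"
    unfolding pd_def using Cauchy_derivative_integral_circlepath(2)[OF holo, of 0] r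
    by (intro DERIV_imp_deriv) auto
  \<comment> \<open>The velocity of the circle at u is 2 pi i u, which cancels one of the two
    factors u in the denominator.\<close>
  also have "contour_integral (circlepath 0 r) (\<lambda>u. ?f u / u\<^sup>2) =
      integral {0..1} (\<lambda>t. (2 * of_real pi * \<i>) * (?f (circ r t) / circ r t))"
    unfolding contour_integral_integral vector_derivative_circlepath
    using circ_props[OF r]
    by (intro integral_cong) (simp add: circlepath circ_def power2_eq_square field_simps)
  also have "\<dots> = (2 * of_real pi * \<i>) * integral {0..1} (\<lambda>t. ?f (circ r t) / circ r t)"
    by (rule integral_mult_right)
  finally show ?thesis by simp
qed

text \<open>Cauchy's formula writes the derivative as a parameter integral of the continuous
  function F. The continuity obtained here is the hypothesis for differentiating under the integral
  sign.\<close>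

lemma continuous_on_pd:
  assumes S: "open S" and F: "frechet_holo S F"
  shows "continuous_on S (pd h F)"
proof (rule continuous_at_imp_continuous_on, rule ballI)
  fix T0 assume T0: "T0 \<in> S"
  obtain d r where dr: "d > 0" "r > 0" "\<And>T z. dist T T0 < d \<Longrightarrow> norm z < 2 * r \<Longrightarrow> T + cscale z h \<in> S"
    using polydisc_nhd[OF S T0] by metis
  have sub: "T + cscale (circ r t) h \<in> S" if "T \<in> ball T0 d" for T t
    using dr that circ_props[of r t] by (simp add: dist_commute)
  have "continuous_on (ball T0 d) (\<lambda>T. integral (cbox 0 1) (\<lambda>t. F (T + cscale (circ r t) h) / circ r t))"
  proof (rule integral_continuous_on_param)
    show "continuous_on (ball T0 d \<times> cbox 0 1) (\<lambda>(T, t). F (T + cscale (circ r t) h) / circ r t)"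
      unfolding split_beta
      by (intro continuous_intros continuous_on_compose2[OF frechet_holo_continuous_on[OF F]])
        (use sub circ_props[OF dr(2)] in auto)
  qed
  moreover have "integral (cbox 0 1) (\<lambda>t. F (T + cscale (circ r t) h) / circ r t) = pd h F T" if "T \<in> ball T0 d" for T
    by (rule cauchy_pd[OF F dr(2), symmetric]) (use that dr(3) in \<open>simp add: dist_commute\<close>)
  ultimately have "continuous_on (ball T0 d) (pd h F)" by (rule continuous_on_eq)
  then show "isCont (pd h F) T0"
    using dr(1) by (simp add: continuous_on_eq_continuous_at)
qed

text \<open>Cauchy's formula for the directional derivative is differentiated under the integral sign. The
  derivative in direction x is again Cauchy's formula, now for the derivative of F in direction x, so
  directional derivatives commute.\<close>

lemma pd_has_derivative:
  assumes S: "open S" and F: "frechet_holo S F" and T0: "T0 \<in> S"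
    and dr: "d > 0" "r > 0" "\<And>T z. dist T T0 < d \<Longrightarrow> norm z < 2 * r \<Longrightarrow> T + cscale z h \<in> S"
  shows "(pd h F has_derivative (\<lambda>x. integral (cbox 0 1) (\<lambda>t. pd x F (T0 + cscale (circ r t) h) / circ r t))) (at T0)"
proof -
  let ?p = "\<lambda>T t. T + cscale (circ r t) h"
  let ?G = "\<lambda>T t x. pd x F (?p T t) / circ r t"
  have sub: "?p T t \<in> S" if "T \<in> ball T0 d" for T t
    using dr that circ_props[of r t] by (simp add: dist_commute)
  have bl: "bounded_linear (?G T t)" if "T \<in> ball T0 d" for T t
    unfolding divide_inverse
    using has_derivative_bounded_linear[OF frechet_holo_pd(1)[OF F sub[OF that]]]
    by (rule bounded_linear_mult_const)
  have ap: "blinfun_apply (Blinfun (?G T t)) = ?G T t" if "T \<in> ball T0 d" for T t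
    by (rule bounded_linear_Blinfun_apply[OF bl[OF that]])
  have T0': "T0 \<in> ball T0 d" using dr by simp
  \<comment> \<open>Differentiation under the integral requires the differential as a bounded linear
    map depending jointly continuously on matrix and parameter. The space is finite-dimensional, so
    it suffices to check its value in each direction.\<close>
  have cont: "continuous_on (ball T0 d \<times> cbox 0 1) (\<lambda>(T, t). Blinfun (?G T t))"
  proof (rule continuous_on_blinfun_componentwise)
    fix i :: "'a cmat"
    have "continuous_on (ball T0 d \<times> cbox 0 1) (\<lambda>p. ?G (fst p) (snd p) i)"
      by (intro continuous_intros continuous_on_compose2[OF continuous_on_pd[OF S F]])
        (use sub circ_props[OF dr(2)] in auto)
    then show "continuous_on (ball T0 d \<times> cbox 0 1) (\<lambda>x. blinfun_apply (case x of (T, t) \<Rightarrow> Blinfun (?G T t)) i)"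
      by (rule continuous_on_eq) (auto simp: ap)
  qed
  have int: "(\<lambda>t. Blinfun (?G T0 t)) integrable_on cbox 0 1"
  proof (rule integrable_continuous)
    have "continuous_on (cbox 0 1) (\<lambda>t. case (T0, t) of (T, t) \<Rightarrow> Blinfun (?G T t))"
      by (rule continuous_on_compose2[OF cont]) (use T0' in \<open>auto intro!: continuous_intros\<close>)
    then show "continuous_on (cbox 0 1) (\<lambda>t. Blinfun (?G T0 t))" by simp
  qed
  have "((\<lambda>T. integral (cbox 0 1) (\<lambda>t. F (?p T t) / circ r t)) has_derivative
      blinfun_apply (integral (cbox 0 1) (\<lambda>t. Blinfun (?G T0 t)))) (at T0 within ball T0 d)"
  proof (rule leibniz_rule)
    fix T t assume T: "T \<in> ball T0 d"
    have "((\<lambda>T. ?p T t) has_derivative (\<lambda>x. x)) (at T within ball T0 d)"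
      by (auto intro!: derivative_eq_intros)
    from has_derivative_compose[OF this frechet_holo_pd(1)[OF F sub[OF T, of t]]]
    show "((\<lambda>T. F (?p T t) / circ r t) has_derivative blinfun_apply (Blinfun (?G T t))) (at T within ball T0 d)"
      unfolding ap[OF T] by (rule bounded_linear.has_derivative[OF bounded_linear_divide])
  next
    fix T assume T: "T \<in> ball T0 d"
    show "(\<lambda>t. F (?p T t) / circ r t) integrable_on cbox 0 1"
      by (intro integrable_continuous continuous_intros continuous_on_compose2[OF frechet_holo_continuous_on[OF F]])
        (use sub T circ_props[OF dr(2)] in auto)
  qed (use cont T0' in auto)
  moreover have "integral (cbox 0 1) (\<lambda>t. F (?p T t) / circ r t) = pd h F T" if "T \<in> ball T0 d" for T
    by (rule cauchy_pd[OF F dr(2), symmetric]) (use that dr(3) in \<open>simp add: dist_commute\<close>)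
  ultimately have "(pd h F has_derivative blinfun_apply (integral (cbox 0 1) (\<lambda>t. Blinfun (?G T0 t)))) (at T0 within ball T0 d)"
    by (intro has_derivative_transform[OF T0', of "pd h F"]) auto
  moreover have "blinfun_apply (integral (cbox 0 1) (\<lambda>t. Blinfun (?G T0 t))) = (\<lambda>x. integral (cbox 0 1) (\<lambda>t. ?G T0 t x))"
    using integral_linear[OF int blinfun.bounded_linear_left] by (simp add: comp_def ap[OF T0'] fun_eq_iff)
  ultimately show ?thesis
    using at_within_open[OF T0' open_ball] by simp
qed

text \<open>The differential found in \<open>pd_has_derivative\<close> is complex linear because its
  integrand is. So one complex derivative on an open set yields derivatives of all orders.\<close>

theorem frechet_holo_pd_closed:
  assumes S: "open S" and F: "frechet_holo S F"
  shows "frechet_holo S (pd h F)"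
  unfolding frechet_holo_def
proof
  fix T0 assume T0: "T0 \<in> S"
  obtain d r where dr: "d > 0" "r > 0" "\<And>T z. dist T T0 < d \<Longrightarrow> norm z < 2 * r \<Longrightarrow> T + cscale z h \<in> S"
    using polydisc_nhd[OF S T0] by metis
  let ?L = "\<lambda>x. integral (cbox 0 1) (\<lambda>t. pd x F (T0 + cscale (circ r t) h) / circ r t)"
  have "?L (cscale c x) = c * ?L x" for c x
  proof -
    have "T0 + cscale (circ r t) h \<in> S" for t using dr circ_props[of r t] by simp
    then show ?thesis
      by (simp add: frechet_holo_pd(2)[OF F] flip: times_divide_eq_right)
  qed
  then show "\<exists>L. (pd h F has_derivative L) (at T0) \<and> (\<forall>c x. L (cscale c x) = c * L x)"
    using pd_has_derivative[OF S F T0 dr] by blast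
qed

theorem pd_commute:
  assumes S: "open S" and F: "frechet_holo S F" and T0: "T0 \<in> S"
  shows "pd x (pd h F) T0 = pd h (pd x F) T0"
proof -
  obtain d r where dr: "d > 0" "r > 0" "\<And>T z. dist T T0 < d \<Longrightarrow> norm z < 2 * r \<Longrightarrow> T + cscale z h \<in> S"
    using polydisc_nhd[OF S T0] by metis
  \<comment> \<open>Two descriptions of the differential of \<open>pd h F\<close>, equal by
    uniqueness. The integral is then recognized as Cauchy's formula for
    \<open>pd h (pd x F)\<close>.\<close>
  have "(\<lambda>x. pd x (pd h F) T0) = (\<lambda>x. integral (cbox 0 1) (\<lambda>t. pd x F (T0 + cscale (circ r t) h) / circ r t))"
    by (rule has_derivative_unique[OF frechet_holo_pd(1)[OF frechet_holo_pd_closed[OF S F] T0] pd_has_derivative[OF S F T0 dr]])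
  then show ?thesis
    using cauchy_pd[OF frechet_holo_pd_closed[OF S F] dr(2), of T0 h] dr by (simp add: fun_eq_iff)
qed

text \<open>Precomposition with \<open>symm\<close> turns functions on relatively open sets of symmetric matrices into
  functions on open sets of matrices.\<close>

definition symm :: "'n::finite cmat \<Rightarrow> 'n cmat" where
  "symm T = (\<chi> k l. (T $ k $ l + T $ l $ k) / 2)"

lemma symm_nth [simp]: "symm T $ k $ l = (T $ k $ l + T $ l $ k) / 2"
  by (simp add: symm_def)

definition unit_mat :: "'n \<Rightarrow> 'n \<Rightarrow> 'n::finite cmat" where
  "unit_mat i j = (\<chi> k l. if k = i \<and> l = j then 1 else 0)"

definition dsym :: "'n \<Rightarrow> 'n \<Rightarrow> ('n::finite cmat \<Rightarrow> complex) \<Rightarrow> 'n cmat \<Rightarrow> complex" where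
  "dsym i j \<phi> v = pd (unit_mat i j) (\<phi> \<circ> symm) v"

lemma d_t_eq: "d_t i j f v A = dsym i j (\<lambda>v. f v A) v"
proof -
  have "(\<chi> k l. v $ k $ l + (if k = i \<and> l = j then z else 0)) = v + cscale z (unit_mat i j)" for z
    by (auto simp: vec_eq_iff unit_mat_def)
  then show ?thesis by (simp add: d_t_def dsym_def pd_def Let_def symm_def)
qed

lemma bounded_linear_symm: "bounded_linear (symm :: 'n::finite cmat \<Rightarrow> 'n cmat)"
  by (auto simp: linear_conv_bounded_linear[symmetric] vec_eq_iff scaleR_conv_of_real[where 'a = complex] algebra_simps add_divide_distrib intro!: linearI)

lemma symm_simps: "symm (cscale c x) = cscale c (symm x)" "symm (x + y) = symm x + symm y" "symm (symm x) = symm x"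
  by (auto simp: vec_eq_iff add_divide_distrib algebra_simps)

lemma siegel_sym: "v \<in> siegel \<Longrightarrow> v $ i $ j = v $ j $ i"
  unfolding siegel_def by (metis (mono_tags, lifting) mem_Collect_eq transpose_def vec_lambda_beta)

lemma symm_siegel: "v \<in> siegel \<Longrightarrow> symm v = v"
  using siegel_sym[of v] by (simp add: vec_eq_iff)

lemma siegel_openD: "siegel_open U \<Longrightarrow> U \<subseteq> siegel"
  by (rule openin_imp_subset)

definition im_form :: "real^'n \<Rightarrow> 'n::finite cmat \<Rightarrow> real" where
  "im_form x T = x \<bullet> ((\<chi> i j. Im (symm T $ i $ j)) *v x)"

lemma symm_mem_siegel: "symm T \<in> siegel \<longleftrightarrow> (\<forall>x. x \<noteq> 0 \<longrightarrow> im_form x T > 0)"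
proof -
  have "transpose (symm T) = symm T" by (simp add: vec_eq_iff transpose_def add.commute)
  then show ?thesis unfolding siegel_def im_form_def by blast
qed

lemma im_form_scaleR: "im_form (a *\<^sub>R x) T = a\<^sup>2 * im_form x T"
  unfolding im_form_def matrix_vector_mult_scaleR inner_scaleR_left inner_scaleR_right
  by (simp add: power2_eq_square)

text \<open>By homogeneity, positivity of the form needs to be tested only on the unit sphere. The
  matrices for which it fails are the projection of a closed set along this compact sphere, hence
  form a closed set.\<close>

lemma open_symm_siegel: "open (symm -` (siegel :: 'n::finite cmat set))"
proof -
  have q: "im_form x T = (\<Sum>i\<in>UNIV. x $ i * (\<Sum>j\<in>UNIV. ((Im (T $ i $ j) + Im (T $ j $ i)) / 2) * x $ j))"
    for x and T :: "'n cmat"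
    by (simp add: im_form_def inner_vec_def matrix_vector_mult_def)
  have "closed {p :: (real^'n) \<times> 'n cmat. im_form (fst p) (snd p) \<le> 0}"
    unfolding q by (intro closed_Collect_le continuous_intros) auto
  from closed_compact_projection[OF compact_sphere[of 0 1] this]
  have cl: "closed {T :: 'n cmat. \<exists>x. x \<in> sphere 0 1 \<and> im_form x T \<le> 0}" by simp
  have "symm T \<in> siegel \<longleftrightarrow> \<not> (\<exists>x. x \<in> sphere 0 1 \<and> im_form x T \<le> 0)" for T :: "'n cmat"
  proof
    assume "symm T \<in> siegel"
    then have "im_form x T > 0" if "x \<noteq> 0" for x using that symm_mem_siegel by blast
    then show "\<not> (\<exists>x. x \<in> sphere 0 1 \<and> im_form x T \<le> 0)" by (metis norm_zero mem_sphere_0 not_less zero_neq_one)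
  next
    assume r: "\<not> (\<exists>x. x \<in> sphere 0 1 \<and> im_form x T \<le> 0)"
    have "im_form x T > 0" if "x \<noteq> 0" for x
    proof -
      have "inverse (norm x) *\<^sub>R x \<in> sphere 0 1" using that by simp
      then have "im_form (inverse (norm x) *\<^sub>R x) T > 0" using r not_less by blast
      then show ?thesis unfolding im_form_scaleR using zero_less_mult_pos[of "(inverse (norm x))\<^sup>2" "im_form x T"] that by simp
    qed
    then show "symm T \<in> siegel" unfolding symm_mem_siegel by blast
  qed
  then have "symm -` siegel = - {T :: 'n cmat. \<exists>x. x \<in> sphere 0 1 \<and> im_form x T \<le> 0}" by blast
  then show ?thesis using cl by (simp only: open_Compl)
qed

lemma open_symm_vimage:
  assumes "siegel_open U" shows "open (symm -` U)"
proof -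
  from assms obtain O' where O': "open O'" "U = siegel \<inter> O'" unfolding openin_open by blast
  have "open (symm -` O')"
    using bounded_linear.continuous_on[OF bounded_linear_symm continuous_on_id] O'(1) by (intro open_vimage) auto
  then show ?thesis unfolding O'(2) vimage_Int using open_symm_siegel by (intro open_Int)
qed

section \<open>Coordinate derivatives of holomorphic functions on the Siegel plane\<close>

text \<open>In one direction this is the chain rule with the linear map \<open>symm\<close>. In the
  other, \<open>symm\<close> fixes U pointwise, so the differential of the composite at a point of U
  serves for the function itself.\<close>

lemma holo_on_iff_frechet:
  assumes U: "siegel_open U"
  shows "holo_on U \<phi> \<longleftrightarrow> frechet_holo (symm -` U) (\<phi> \<circ> symm)"
proof
  assume h: "holo_on U \<phi>"
  show "frechet_holo (symm -` U) (\<phi> \<circ> symm)"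
    unfolding frechet_holo_def
  proof
    fix T assume T: "T \<in> symm -` U"
    then have "symm T \<in> U" by simp
    then obtain L where L: "(\<phi> has_derivative L) (at (symm T) within U)"
        "\<And>c x. L (\<chi> i j. c * x $ i $ j) = c * L x"
      using h unfolding holo_on_def by blast
    have "((\<lambda>x. \<phi> (symm x)) has_derivative (\<lambda>x. L (symm x))) (at T within symm -` U)"
    proof (rule has_derivative_in_compose[where f = symm and g = \<phi> and f' = symm and g' = L])
      show "(symm has_derivative symm) (at T within symm -` U)"
        by (rule bounded_linear_imp_has_derivative[OF bounded_linear_symm])
      show "(\<phi> has_derivative L) (at (symm T) within symm ` (symm -` U))"
        by (rule has_derivative_subset[OF L(1)]) auto
    qed
    then have "(\<phi> \<circ> symm has_derivative (\<lambda>x. L (symm x))) (at T)"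
      using at_within_open[OF T open_symm_vimage[OF U]] by (simp add: comp_def)
    moreover have "L (symm (cscale c x)) = c * L (symm x)" for c x
      by (subst symm_simps(1)) (simp only: cscale_def L(2))
    ultimately show "\<exists>L. (\<phi> \<circ> symm has_derivative L) (at T) \<and> (\<forall>c x. L (cscale c x) = c * L x)" by blast
  qed
next
  assume F: "frechet_holo (symm -` U) (\<phi> \<circ> symm)"
  show "holo_on U \<phi>"
    unfolding holo_on_def
  proof
    fix v assume v: "v \<in> U"
    have sv: "symm w = w" if "w \<in> U" for w using that siegel_openD[OF U] symm_siegel by blast
    have "v \<in> symm -` U" using v sv[OF v] by simp
    then obtain L where L: "(\<phi> \<circ> symm has_derivative L) (at v)" "\<forall>c x. L (cscale c x) = c * L x"
      using F unfolding frechet_holo_def by blast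
    have "(\<phi> has_derivative L) (at v within U)"
      by (rule has_derivative_transform[OF v _ has_derivative_at_withinI[OF L(1)]]) (simp add: sv)
    then show "\<exists>L. (\<phi> has_derivative L) (at v within U) \<and> (\<forall>c x. L (\<chi> i j. c * x $ i $ j) = c * L x)"
      using L(2) by (auto simp: cscale_def)
  qed
qed

text \<open>Since \<open>symm\<close> is linear and idempotent, moving from T or from
  \<open>symm T\<close> in the same direction gives the same symmetrization. Thus
  \<open>dsym\<close> pulls back to a directional derivative on an open set, and iterated
  derivatives do too.\<close>

lemma dsym_symm: "dsym i j \<phi> \<circ> symm = pd (unit_mat i j) (\<phi> \<circ> symm)"
proof
  fix T
  show "(dsym i j \<phi> \<circ> symm) T = pd (unit_mat i j) (\<phi> \<circ> symm) T"
    unfolding dsym_def pd_def comp_def symm_simps(2) symm_simps(3) ..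
qed

text \<open>The two unit matrices have the same symmetrization, and only that enters the
  derivative.\<close>

lemma dsym_swap: "dsym i j = dsym j i"
proof (intro ext)
  fix \<phi> v
  have "symm (unit_mat i j) = symm (unit_mat j i)"
    unfolding vec_eq_iff by (simp add: unit_mat_def add.commute conj_commute)
  then show "dsym i j \<phi> v = dsym j i \<phi> v"
    unfolding dsym_def pd_def comp_def symm_simps(1,2) by (rule arg_cong)
qed

lemma holo_on_dsym: "siegel_open U \<Longrightarrow> holo_on U \<phi> \<Longrightarrow> holo_on U (dsym i j \<phi>)"
  unfolding holo_on_iff_frechet dsym_symm by (rule frechet_holo_pd_closed[OF open_symm_vimage])

lemma mem_symm_vimage:
  assumes "siegel_open U" "v \<in> U" shows "v \<in> symm -` U"
proof -
  have "symm v = v" by (rule symm_siegel) (use siegel_openD[OF assms(1)] assms(2) in blast)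
  then show ?thesis using assms(2) by simp
qed

lemma dsym_commute:
  assumes "siegel_open U" "holo_on U \<phi>" "v \<in> U"
  shows "dsym i j (dsym k l \<phi>) v = dsym k l (dsym i j \<phi>) v"
  using pd_commute[OF open_symm_vimage[OF assms(1)] _ mem_symm_vimage[OF assms(1,3)], of "\<phi> \<circ> symm"] assms
  unfolding dsym_def[of i j "dsym k l \<phi>"] dsym_def[of k l "dsym i j \<phi>"] dsym_symm holo_on_iff_frechet[OF assms(1)]
  by blast

text \<open>Only small z matter for the derivative at 0, and for these the points on the line
  symmetrize into U.\<close>

lemma dsym_cong:
  assumes U: "siegel_open U" and v: "v \<in> U" and eq: "\<And>w. w \<in> U \<Longrightarrow> \<phi> w = \<psi> w"
  shows "dsym i j \<phi> v = dsym i j \<psi> v"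
proof -
  obtain d r where dr: "d > 0" "r > 0" "\<And>T z. dist T v < d \<Longrightarrow> norm z < 2 * r \<Longrightarrow> T + cscale z (unit_mat i j) \<in> symm -` U"
    using polydisc_nhd[OF open_symm_vimage[OF U] mem_symm_vimage[OF U v], of "unit_mat i j"] by metis
  have "eventually (\<lambda>z. norm z < 2 * r) (nhds (0::complex))"
    using dr(2) eventually_nhds_in_open[of "ball 0 (2 * r)" "0::complex"] by simp
  then have "eventually (\<lambda>z. (\<phi> \<circ> symm) (v + cscale z (unit_mat i j)) = (\<psi> \<circ> symm) (v + cscale z (unit_mat i j))) (nhds 0)"
    by eventually_elim (use dr eq in auto)
  then show ?thesis unfolding dsym_def pd_def by (rule deriv_cong_ev) simp
qed

lemma pd_eqI:
  assumes "(F has_derivative L) (at T)" "\<And>c x. L (cscale c x) = c * L x" shows "pd h F T = L h"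
  unfolding pd_def using line_has_field_derivative[of F L T 0 h] assms by (intro DERIV_imp_deriv) auto

context
  fixes U :: "'n::finite cmat set" assumes U: "siegel_open U"
begin

lemma holo_on_cong: "(\<And>v. v \<in> U \<Longrightarrow> \<phi> v = \<psi> v) \<Longrightarrow> holo_on U \<phi> \<Longrightarrow> holo_on U \<psi>"
  unfolding holo_on_def by (metis has_derivative_transform)

lemma holo_on_frechetD:
  assumes "holo_on U \<phi>" "v \<in> U"
  shows "(\<phi> \<circ> symm has_derivative (\<lambda>h. pd h (\<phi> \<circ> symm) v)) (at v)"
    "pd (cscale c h) (\<phi> \<circ> symm) v = c * pd h (\<phi> \<circ> symm) v"
  using frechet_holo_pd[OF assms(1)[unfolded holo_on_iff_frechet[OF U]] mem_symm_vimage[OF U assms(2)]] by blast+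

lemma holo_on_const: "holo_on U (\<lambda>v. c)"
  unfolding holo_on_def by (auto intro!: exI[of _ "\<lambda>_. 0"])

lemma holo_on_nth: "holo_on U (\<lambda>v. v $ i $ j)"
  unfolding holo_on_def
  by (auto intro!: exI[of _ "\<lambda>v. v $ i $ j"] bounded_linear_imp_has_derivative
      bounded_linear_compose[OF bounded_linear_vec_nth bounded_linear_vec_nth, unfolded comp_def])

lemma holo_on_add: "holo_on U \<phi> \<Longrightarrow> holo_on U \<psi> \<Longrightarrow> holo_on U (\<lambda>v. \<phi> v + \<psi> v)"
proof -
  assume *: "holo_on U \<phi>" "holo_on U \<psi>"
  show ?thesis unfolding holo_on_def
  proof
    fix v assume "v \<in> U"
    then obtain L M where LM: "(\<phi> has_derivative L) (at v within U)" "(\<psi> has_derivative M) (at v within U)"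
      "\<forall>c x. L (\<chi> i j. c * x $ i $ j) = c * L x" "\<forall>c x. M (\<chi> i j. c * x $ i $ j) = c * M x"
      using * unfolding holo_on_def by blast
    show "\<exists>L. ((\<lambda>v. \<phi> v + \<psi> v) has_derivative L) (at v within U) \<and> (\<forall>c x. L (\<chi> i j. c * x $ i $ j) = c * L x)"
      by (intro exI[of _ "\<lambda>x. L x + M x"] conjI has_derivative_add) (simp_all add: LM distrib_left)
  qed
qed

lemma holo_on_mult: "holo_on U \<phi> \<Longrightarrow> holo_on U \<psi> \<Longrightarrow> holo_on U (\<lambda>v. \<phi> v * \<psi> v)"
proof -
  assume *: "holo_on U \<phi>" "holo_on U \<psi>"
  show ?thesis unfolding holo_on_def
  proof
    fix v assume "v \<in> U"
    then obtain L M where LM: "(\<phi> has_derivative L) (at v within U)" "(\<psi> has_derivative M) (at v within U)"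
      "\<forall>c x. L (\<chi> i j. c * x $ i $ j) = c * L x" "\<forall>c x. M (\<chi> i j. c * x $ i $ j) = c * M x"
      using * unfolding holo_on_def by blast
    have "((\<lambda>v. \<phi> v * \<psi> v) has_derivative (\<lambda>x. \<phi> v * M x + L x * \<psi> v)) (at v within U)"
      by (rule has_derivative_mult[OF LM(1,2)])
    then show "\<exists>L. ((\<lambda>v. \<phi> v * \<psi> v) has_derivative L) (at v within U) \<and> (\<forall>c x. L (\<chi> i j. c * x $ i $ j) = c * L x)"
      by (rule exI[of _ "\<lambda>x. \<phi> v * M x + L x * \<psi> v", OF conjI]) (simp add: LM(3,4) algebra_simps)
  qed
qed

lemma holo_on_sum: "(\<And>i. i \<in> I \<Longrightarrow> holo_on U (\<phi> i)) \<Longrightarrow> holo_on U (\<lambda>v. \<Sum>i\<in>I. \<phi> i v)"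
  by (induction I rule: infinite_finite_induct) (auto intro: holo_on_const holo_on_add)

lemma dsym_add:
  assumes "holo_on U \<phi>" "holo_on U \<psi>" "v \<in> U"
  shows "dsym i j (\<lambda>v. \<phi> v + \<psi> v) v = dsym i j \<phi> v + dsym i j \<psi> v"
  unfolding dsym_def
  by (rule pd_eqI) (use has_derivative_add[OF holo_on_frechetD(1)[OF assms(1,3)] holo_on_frechetD(1)[OF assms(2,3)]]
      holo_on_frechetD(2)[OF assms(1,3)] holo_on_frechetD(2)[OF assms(2,3)] in \<open>auto simp: comp_def distrib_left\<close>)

lemma dsym_mult:
  assumes "holo_on U \<phi>" "holo_on U \<psi>" "v \<in> U"
  shows "dsym i j (\<lambda>v. \<phi> v * \<psi> v) v = dsym i j \<phi> v * \<psi> v + \<phi> v * dsym i j \<psi> v"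
proof -
  have sv: "symm v = v" using symm_siegel siegel_openD[OF U] assms(3) by blast
  have "pd (unit_mat i j) ((\<lambda>v. \<phi> v * \<psi> v) \<circ> symm) v
      = (\<phi> \<circ> symm) v * pd (unit_mat i j) (\<psi> \<circ> symm) v + pd (unit_mat i j) (\<phi> \<circ> symm) v * (\<psi> \<circ> symm) v"
    by (rule pd_eqI) (use has_derivative_mult[OF holo_on_frechetD(1)[OF assms(1,3)] holo_on_frechetD(1)[OF assms(2,3)]]
        holo_on_frechetD(2)[OF assms(1,3)] holo_on_frechetD(2)[OF assms(2,3)] in \<open>auto simp: comp_def algebra_simps\<close>)
  then show ?thesis by (simp add: dsym_def sv)
qed

lemma dsym_const: "dsym i j (\<lambda>v. c) v = 0"
  by (simp add: dsym_def pd_def comp_def)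

lemma dsym_cmult:
  assumes "holo_on U \<phi>" "v \<in> U" shows "dsym i j (\<lambda>v. c * \<phi> v) v = c * dsym i j \<phi> v"
  using dsym_mult[OF holo_on_const assms] by (simp add: dsym_const)

lemma dsym_sum:
  "(\<And>k. k \<in> I \<Longrightarrow> holo_on U (\<phi> k)) \<Longrightarrow> v \<in> U \<Longrightarrow> dsym i j (\<lambda>v. \<Sum>k\<in>I. \<phi> k v) v = (\<Sum>k\<in>I. dsym i j (\<phi> k) v)"
  by (induction I rule: infinite_finite_induct) (auto simp: dsym_const dsym_add holo_on_sum)

end

lemma holo_on_subset: "holo_on U \<phi> \<Longrightarrow> W \<subseteq> U \<Longrightarrow> holo_on W \<phi>"
  unfolding holo_on_def by (meson has_derivative_subset subsetD)

section \<open>Spinor derivatives over an abstract module\<close>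

text \<open>Superfunctions over all open sets share one type, and the sections over a given open set
  are a subspace \<open>S\<close> of it. The operators are controlled on \<open>S\<close> only, so
  linearity and all relations below are relative to \<open>S\<close>.\<close>

locale subspace_module = vector_space scl
  for scl :: "complex \<Rightarrow> 'v::ab_group_add \<Rightarrow> 'v" +
  fixes S :: "'v set"
  assumes subspace_S: "subspace S"
begin

definition lin :: "('v \<Rightarrow> 'v) \<Rightarrow> bool" where
  "lin F \<longleftrightarrow> (\<forall>f\<in>S. F f \<in> S) \<and> (\<forall>f\<in>S. \<forall>g\<in>S. F (f + g) = F f + F g) \<and> (\<forall>c. \<forall>f\<in>S. F (scl c f) = scl c (F f))"

lemma S_closed [simp]:
  "0 \<in> S" "f \<in> S \<Longrightarrow> g \<in> S \<Longrightarrow> f + g \<in> S" "f \<in> S \<Longrightarrow> scl c f \<in> S"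
  "f \<in> S \<Longrightarrow> g \<in> S \<Longrightarrow> f - g \<in> S" "f \<in> S \<Longrightarrow> - f \<in> S"
  using subspace_S by (auto intro: subspace_0 subspace_add subspace_scale subspace_diff subspace_neg)

lemma S_sum [simp]: "(\<And>i. i \<in> I \<Longrightarrow> g i \<in> S) \<Longrightarrow> (\<Sum>i\<in>I. g i) \<in> S"
  by (rule subspace_sum[OF subspace_S])

lemma lin_closed: "lin F \<Longrightarrow> f \<in> S \<Longrightarrow> F f \<in> S"
  and lin_add: "lin F \<Longrightarrow> f \<in> S \<Longrightarrow> g \<in> S \<Longrightarrow> F (f + g) = F f + F g"
  and lin_scale: "lin F \<Longrightarrow> f \<in> S \<Longrightarrow> F (scl c f) = scl c (F f)"
  by (auto simp: lin_def)

lemma lin_zero: "lin F \<Longrightarrow> F 0 = 0"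
  using lin_scale[of F 0 0] by simp

lemma lin_neg: "lin F \<Longrightarrow> f \<in> S \<Longrightarrow> F (- f) = - F f"
  using lin_scale[of F f "-1"] by simp

lemma lin_diff: "lin F \<Longrightarrow> f \<in> S \<Longrightarrow> g \<in> S \<Longrightarrow> F (f - g) = F f - F g"
  using lin_add[of F f "- g"] lin_neg[of F g] by simp

lemma lin_sum:
  assumes "lin F" "\<And>i. i \<in> I \<Longrightarrow> g i \<in> S" shows "F (\<Sum>i\<in>I. g i) = (\<Sum>i\<in>I. F (g i))"
  using assms(2)
proof (induction I rule: infinite_finite_induct)
  case (insert x I)
  then have "(\<Sum>i\<in>I. g i) \<in> S" by (intro S_sum) auto
  with insert show ?case by (simp add: lin_add[OF assms(1)])
qed (simp_all add: lin_zero[OF assms(1)])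

lemmas lin_simps = lin_closed lin_add lin_scale lin_zero lin_neg lin_diff lin_sum

end

text \<open>Canonical relations modelled on superfunctions: \<open>d\<close> stands for the
  derivatives in xi, \<open>X\<close> for multiplication by xi, both odd, and \<open>P i j\<close>
  for the even derivatives in t, which are symmetric in i and j because only v = (T + transpose T) /
  2 is a free coordinate.\<close>

locale super_weyl = subspace_module scl S for scl :: "complex \<Rightarrow> 'v::ab_group_add \<Rightarrow> 'v" and S +
  fixes d X :: "'n::finite \<Rightarrow> 'v \<Rightarrow> 'v" and P :: "'n \<Rightarrow> 'n \<Rightarrow> 'v \<Rightarrow> 'v"
  assumes lin_d: "lin (d i)" and lin_X: "lin (X i)" and lin_P: "lin (P i j)"
    and P_sym: "f \<in> S \<Longrightarrow> P i j f = P j i f"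
    and P_P: "f \<in> S \<Longrightarrow> P i j (P k l f) = P k l (P i j f)"
    and P_d: "f \<in> S \<Longrightarrow> P i j (d k f) = d k (P i j f)"
    and P_X: "f \<in> S \<Longrightarrow> P i j (X k f) = X k (P i j f)"
    and d_d: "f \<in> S \<Longrightarrow> d i (d k f) = - d k (d i f)"
    and d_X: "f \<in> S \<Longrightarrow> d i (X k f) = (if i = k then f else 0) - X k (d i f)"
    and X_X: "f \<in> S \<Longrightarrow> X i (X k f) = - X k (X i f)"
begin

definition D :: "'n \<Rightarrow> 'v \<Rightarrow> 'v" where "D i f = d i f - (\<Sum>j\<in>UNIV. X j (P i j f))"

lemmas weyl_simps = lin_simps[OF lin_d] lin_simps[OF lin_X] lin_simps[OF lin_P]

lemma lin_D: "lin (D i)"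
  unfolding lin_def
proof (intro conjI ballI allI)
  fix f assume f: "f \<in> S"
  show "D i f \<in> S" using f by (simp add: D_def weyl_simps)
  show "D i (scl c f) = scl c (D i f)" for c
    using f by (simp add: D_def weyl_simps scale_right_diff_distrib scale_sum_right)
  show "D i (f + g) = D i f + D i g" if g: "g \<in> S" for g
    using f g by (simp add: D_def weyl_simps sum.distrib)
qed

lemma P_D: assumes f: "f \<in> S" shows "P i j (D k f) = D k (P i j f)"
  using f by (simp add: D_def weyl_simps P_d P_X P_P[of f i j])

text \<open>The double sums cancel after their indices are interchanged, since the X anticommute
  while the P commute. The terms with one d and one X cancel against the other order except for the
  deltas in \<open>d_X\<close>, each of which leaves one P.\<close>

lemma D_anticomm: assumes f: "f \<in> S" shows "D i (D k f) + D k (D i f) = - (P i k f + P i k f)"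
proof -
  have DD: "D i (D k f) = d i (d k f) - P i k f + (\<Sum>j\<in>UNIV. X j (d i (P k j f))) - (\<Sum>j\<in>UNIV. X j (d k (P i j f)))
      + (\<Sum>j\<in>UNIV. \<Sum>l\<in>UNIV. X j (X l (P i j (P k l f))))" for i k
  proof -
    have "d i (\<Sum>j\<in>UNIV. X j (P k j f)) = P k i f - (\<Sum>j\<in>UNIV. X j (d i (P k j f)))"
      using f by (simp add: weyl_simps d_X sum_subtractf)
    then show ?thesis
      using f by (simp add: D_def[of i] D_def[of k] weyl_simps P_d P_X sum_subtractf P_sym[of f k i])
  qed
  have "(\<Sum>j\<in>UNIV. \<Sum>l\<in>UNIV. X j (X l (P i j (P k l f)))) = (\<Sum>l\<in>UNIV. \<Sum>j\<in>UNIV. X j (X l (P i j (P k l f))))"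
    by (rule sum.swap)
  also have "\<dots> = - (\<Sum>l\<in>UNIV. \<Sum>j\<in>UNIV. X l (X j (P k l (P i j f))))"
  proof -
    have "X j (X l (P i j (P k l f))) = - X l (X j (P k l (P i j f)))" for j l
      using f X_X[of "P i j (P k l f)" j l] P_P[OF f, of i j k l] by (simp add: weyl_simps)
    then show ?thesis by (simp add: sum_negf)
  qed
  finally show ?thesis
    unfolding DD using d_d[OF f, of i k] by (simp add: P_sym[OF f, of k i])
qed

lemma D_central:
  assumes f: "f \<in> S"
  shows "D i (D j (D k f)) + D j (D i (D k f)) = D k (D i (D j f)) + D k (D j (D i f))"
proof -
  have "D i (D j (D k f)) + D j (D i (D k f)) = D k (- (P i j f + P i j f))"
    using f lin_closed[OF lin_D f] by (simp add: D_anticomm P_D lin_simps[OF lin_D] weyl_simps)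
  also have "\<dots> = D k (D i (D j f) + D j (D i f))"
    using f by (simp only: D_anticomm)
  finally show ?thesis using f by (simp add: lin_simps[OF lin_D])
qed

end

section \<open>Commutation identities for spinor derivatives, super-Laplacian and the operators of
  E\<close>

text \<open>The derivatives in t have disappeared: all that the identities use of them is the
  centrality \<open>D_central\<close> of the anticommutators. \<open>T_skew\<close> is the defining
  relation of the super Siegel plane, in the form of multiplication operators.\<close>

locale spinor_module = subspace_module scl S for scl :: "complex \<Rightarrow> 'v::ab_group_add \<Rightarrow> 'v" and S +
  fixes D X :: "'n::finite \<Rightarrow> 'v \<Rightarrow> 'v" and T :: "'n \<Rightarrow> 'n \<Rightarrow> 'v \<Rightarrow> 'v"
  assumes lin_D: "lin (D i)" and lin_X: "lin (X i)" and lin_T: "lin (T i j)"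
    and D_central: "f \<in> S \<Longrightarrow> D i (D j (D k f)) + D j (D i (D k f)) = D k (D i (D j f)) + D k (D j (D i f))"
    and D_X: "f \<in> S \<Longrightarrow> D i (X k f) = (if i = k then f else 0) - X k (D i f)"
    and D_T: "f \<in> S \<Longrightarrow> D i (T k l f) = T k l (D i f) - (if i = k then X l f else 0)"
    and X_X: "f \<in> S \<Longrightarrow> X i (X k f) = - X k (X i f)"
    and X_T: "f \<in> S \<Longrightarrow> X i (T k l f) = T k l (X i f)"
    and T_T: "f \<in> S \<Longrightarrow> T i j (T k l f) = T k l (T i j f)"
    and T_skew: "f \<in> S \<Longrightarrow> T i j f = T j i f - X i (X j f)"
begin

lemmas spinor_simps = lin_simps[OF lin_D] lin_simps[OF lin_X] lin_simps[OF lin_T]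

definition Lap :: "'n \<Rightarrow> 'n \<Rightarrow> 'v \<Rightarrow> 'v" where "Lap i j f = D i (D j f) - D j (D i f)"

definition Q :: "'n \<Rightarrow> 'v \<Rightarrow> 'v" where "Q i f = (\<Sum>j\<in>UNIV. T j i (D j f)) - scl (1/2) (X i f)"

lemma lin_Lap: "lin (Lap i j)"
  unfolding lin_def by (auto simp: Lap_def spinor_simps scale_right_diff_distrib)

lemma lin_Q: "lin (Q i)"
  unfolding lin_def
  by (auto simp: Q_def spinor_simps scale_right_diff_distrib scale_right_distrib scale_sum_right sum.distrib mult.commute)

lemma Lap_skew: "Lap j i f = - Lap i j f"
  by (simp add: Lap_def)

text \<open>Modulo the left ideal of L the last two factors of a word of length three commute.
  Writing ijk for the product of D_i, D_j, D_k, \<open>D_central\<close> then gives kij = 2 jik -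
  ijk and kji = 2 ijk - jik. These are equal as well, so 3 (ijk - jik) vanishes: this is the origin
  of the coefficient 3. The statement keeps track of the terms that were dropped.\<close>

lemma Lap_D:
  assumes f: "f \<in> S"
  shows "scl 3 (Lap i j (D k f)) = scl 2 (D i (Lap j k f)) - scl 2 (D j (Lap i k f)) - D k (Lap i j f)"
proof -
  have two: "scl 2 x = x + x" for x using scale_left_distrib[of 1 1 x] by simp
  have three: "scl 3 x = x + x + x" for x using scale_left_distrib[of 2 1 x] by (simp add: two)
  have kij: "D k (D i (D j f)) = D j (D i (D k f)) + D j (D k (D i f)) - D i (D k (D j f))"
    using D_central[OF f, of i k j] by (simp add: eq_diff_eq add.commute)
  have kji: "D k (D j (D i f)) = D i (D j (D k f)) + D i (D k (D j f)) - D j (D k (D i f))"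
    using D_central[OF f, of j k i] by (simp add: eq_diff_eq add.commute)
  have L: "Lap i j (D k f) = D i (D j (D k f)) - D j (D i (D k f))"
    "D i (Lap j k f) = D i (D j (D k f)) - D i (D k (D j f))"
    "D j (Lap i k f) = D j (D i (D k f)) - D j (D k (D i f))"
    "D k (Lap i j f) = D k (D i (D j f)) - D k (D j (D i f))"
    using f by (simp_all add: Lap_def spinor_simps)
  show ?thesis unfolding L kij kji two three by (simp add: algebra_simps)
qed

text \<open>Differentiating the coefficient T gives -X D, and moving D past the shift -1/2 X gives
  +1/2 X D. What remains is -1/2 X D, exactly the X-term of \<open>Q k (D a f)\<close>, so that it
  drops out of the commutator in \<open>comm_D_Q\<close>.\<close>

lemma D_Q:
  assumes f: "f \<in> S"
  shows "D a (Q k f) = (\<Sum>b\<in>UNIV. T b k (D a (D b f))) - scl (1/2) (X k (D a f)) - scl (1/2) (if a = k then f else 0)"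
proof -
  have half: "X k (D a f) = scl (1/2) (X k (D a f)) + scl (1/2) (X k (D a f))"
    by (simp flip: scale_left_distrib)
  have eq: "D a (Q k f) = (\<Sum>b\<in>UNIV. T b k (D a (D b f))) - X k (D a f)
      - scl (1/2) (if a = k then f else 0) + scl (1/2) (X k (D a f))"
    using f by (simp add: Q_def spinor_simps D_T D_X sum_subtractf scale_right_diff_distrib)
  have "s - x - c + h = s - h - c" if "x = h + h" for s x c h :: 'v
    by (simp add: that)
  from this[OF half] show ?thesis unfolding eq .
qed

lemma comm_D_Q:
  assumes f: "f \<in> S"
  shows "D k (Q i f) - Q i (D k f) = (\<Sum>j\<in>UNIV. T j i (Lap k j f)) - scl (1/2) (if k = i then f else 0)"
proof -
  have "(\<Sum>j\<in>UNIV. T j i (Lap k j f)) = (\<Sum>b\<in>UNIV. T b i (D k (D b f))) - (\<Sum>b\<in>UNIV. T b i (D b (D k f)))"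
    using f by (simp add: Lap_def spinor_simps sum_subtractf)
  then show ?thesis by (simp add: D_Q[OF f] Q_def[of i "D k f"])
qed

text \<open>Applying two spinor derivatives yields delta terms that are symmetric in i and j, hence
  vanish under antisymmetrization. The coefficient is 3/2 = 1 + 1/2: differentiating T contributes
  -X_k D_j D_i, which has the factors exchanged, and the shift contributes 1/2 X_k D_i D_j.\<close>

lemma Lap_Q:
  assumes f: "f \<in> S"
  shows "Lap i j (Q k f) = scl (3/2) (X k (Lap i j f)) + (\<Sum>a\<in>UNIV. T a k (Lap i j (D a f)))"
proof -
  let ?h = "scl (1/2)"
  have "D i (D j (Q k f)) = (\<Sum>a\<in>UNIV. T a k (D i (D j (D a f)))) - X k (D j (D i f))
      - ?h (if i = k then D j f else 0) + ?h (X k (D i (D j f))) - ?h (if j = k then D i f else 0)" for i j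
    using f by (simp add: D_Q spinor_simps D_T D_X sum_subtractf scale_right_diff_distrib)
  then have "Lap i j (Q k f) = (\<Sum>a\<in>UNIV. T a k (Lap i j (D a f))) + (X k (Lap i j f) + ?h (X k (Lap i j f)))"
    using f by (simp add: Lap_def spinor_simps sum_subtractf scale_right_diff_distrib)
  also have "X k (Lap i j f) + ?h (X k (Lap i j f)) = scl (3/2) (X k (Lap i j f))"
    using scale_left_distrib[of 1 "1/2" "X k (Lap i j f)"] by simp
  finally show ?thesis by (simp add: add.commute)
qed

lemma Q_Q:
  assumes f: "f \<in> S"
  shows "Q i (Q k f) = (\<Sum>a\<in>UNIV. \<Sum>b\<in>UNIV. T a i (T b k (D a (D b f))))
    - scl (1/2) (X k (\<Sum>a\<in>UNIV. T a i (D a f))) - scl (1/2) (X i (\<Sum>a\<in>UNIV. T a k (D a f)))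
    - scl (1/2) (T k i f) + scl (1/4) (X i (X k f))"
proof -
  have "(\<Sum>a\<in>UNIV. T a i (if a = k then f else 0)) = (\<Sum>a\<in>UNIV. if a = k then T k i f else 0)"
    by (intro sum.cong) (auto simp: spinor_simps)
  then have delta: "(\<Sum>a\<in>UNIV. T a i (if a = k then f else 0)) = T k i f" by simp
  have "(\<Sum>a\<in>UNIV. T a i (D a (Q k f))) = (\<Sum>a\<in>UNIV. \<Sum>b\<in>UNIV. T a i (T b k (D a (D b f))))
      - scl (1/2) (X k (\<Sum>a\<in>UNIV. T a i (D a f))) - scl (1/2) (T k i f)"
    using f delta by (simp add: D_Q spinor_simps sum_subtractf X_T flip: scale_sum_right)
  moreover have "scl (1/2) (X i (Q k f)) = scl (1/2) (X i (\<Sum>a\<in>UNIV. T a k (D a f))) - scl (1/4) (X i (X k f))"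
    using f by (simp add: Q_def spinor_simps scale_right_diff_distrib)
  ultimately show ?thesis by (simp add: Q_def[of i])
qed

text \<open>The lower-order terms cancel. Those with X, T and D are symmetric in i and k. The
  difference of the two T-terms is -1/2 X_i X_k by \<open>T_skew\<close>, and the anticommuting
  terms with coefficient 1/4 differ by +1/2 X_i X_k.\<close>

lemma comm_Q_Q:
  assumes f: "f \<in> S"
  shows "Q i (Q k f) - Q k (Q i f) = (\<Sum>a\<in>UNIV. \<Sum>b\<in>UNIV. T a i (T b k (Lap a b f)))"
proof -
  have "(\<Sum>a\<in>UNIV. \<Sum>b\<in>UNIV. T a k (T b i (D a (D b f)))) = (\<Sum>b\<in>UNIV. \<Sum>a\<in>UNIV. T a k (T b i (D a (D b f))))"
    by (rule sum.swap)
  also have "\<dots> = (\<Sum>a\<in>UNIV. \<Sum>b\<in>UNIV. T a i (T b k (D b (D a f))))"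
    using f by (intro sum.cong) (simp_all add: spinor_simps T_T)
  finally have swap: "(\<Sum>a\<in>UNIV. \<Sum>b\<in>UNIV. T a k (T b i (D a (D b f)))) = (\<Sum>a\<in>UNIV. \<Sum>b\<in>UNIV. T a i (T b k (D b (D a f))))" .
  have skew: "T k i f = T i k f + X i (X k f)"
    using T_skew[OF f, of k i] X_X[OF f, of k i] by simp
  have quarter: "scl (1/2) x = scl (1/4) x + scl (1/4) x" for x
    by (simp flip: scale_left_distrib)
  have "X k (X i f) = - X i (X k f)" by (rule X_X[OF f])
  then show ?thesis
    unfolding Q_Q[OF f] swap Lap_def
    using f by (simp add: spinor_simps sum_subtractf skew scale_right_distrib quarter[of "X i (X k f)"] algebra_simps)
qed

lemma comm_D_D: "D i (D k f) - D k (D i f) = Lap i k f"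
  by (simp add: Lap_def)

definition Dh :: "'n evec \<Rightarrow> 'v \<Rightarrow> 'v" where
  "Dh y f = (\<Sum>i\<in>UNIV. scl (fst y $ i) (D i f) + scl (snd y $ i) (Q i f))"

lemma lin_Dh: "lin (Dh y)"
  unfolding lin_def
  by (auto simp: Dh_def spinor_simps lin_simps[OF lin_Q] scale_right_diff_distrib scale_right_distrib scale_sum_right sum.distrib mult.commute)

text \<open>The defect of the Heisenberg relation as a function of the components g of the
  super-Laplacian. In this form it visibly vanishes on solutions and has the shape of an element of
  the left ideal.\<close>

definition comm_remainder :: "'n evec \<Rightarrow> 'n evec \<Rightarrow> ('n \<Rightarrow> 'n \<Rightarrow> 'v) \<Rightarrow> 'v" where
  "comm_remainder y z g = (\<Sum>i\<in>UNIV. \<Sum>k\<in>UNIV. scl (fst y $ i * fst z $ k) (g i k)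
      + scl (fst y $ i * snd z $ k) (\<Sum>j\<in>UNIV. T j k (g i j))
      - scl (snd y $ i * fst z $ k) (\<Sum>j\<in>UNIV. T j i (g k j))
      + scl (snd y $ i * snd z $ k) (\<Sum>a\<in>UNIV. \<Sum>b\<in>UNIV. T a i (T b k (g a b))))"

lemma comm_Dh:
  assumes f: "f \<in> S"
  shows "Dh y (Dh z f) - Dh z (Dh y f) = comm_remainder y z (\<lambda>i j. Lap i j f) - scl (symp y z / 2) f"
proof -
  let ?b = "\<lambda>i k. scl (fst y $ i * fst z $ k) (D i (D k f) - D k (D i f))
      + scl (fst y $ i * snd z $ k) (D i (Q k f) - Q k (D i f))
      - scl (snd y $ i * fst z $ k) (D k (Q i f) - Q i (D k f))
      + scl (snd y $ i * snd z $ k) (Q i (Q k f) - Q k (Q i f))"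
  have DD: "Dh y (Dh z f) = (\<Sum>i\<in>UNIV. \<Sum>k\<in>UNIV. scl (fst y $ i * fst z $ k) (D i (D k f))
      + scl (fst y $ i * snd z $ k) (D i (Q k f)) + scl (snd y $ i * fst z $ k) (Q i (D k f))
      + scl (snd y $ i * snd z $ k) (Q i (Q k f)))" for y z
    using f by (simp add: Dh_def spinor_simps lin_simps[OF lin_Q] scale_right_distrib scale_sum_right sum.distrib add_ac)
  have "Dh z (Dh y f) = (\<Sum>k\<in>UNIV. \<Sum>i\<in>UNIV. scl (fst y $ i * fst z $ k) (D k (D i f))
      + scl (snd y $ i * fst z $ k) (D k (Q i f)) + scl (fst y $ i * snd z $ k) (Q k (D i f))
      + scl (snd y $ i * snd z $ k) (Q k (Q i f)))"
    unfolding DD by (simp add: mult.commute)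
  also have "\<dots> = (\<Sum>i\<in>UNIV. \<Sum>k\<in>UNIV. scl (fst y $ i * fst z $ k) (D k (D i f))
      + scl (snd y $ i * fst z $ k) (D k (Q i f)) + scl (fst y $ i * snd z $ k) (Q k (D i f))
      + scl (snd y $ i * snd z $ k) (Q k (Q i f)))"
    by (rule sum.swap)
  finally have "Dh y (Dh z f) - Dh z (Dh y f) = (\<Sum>i\<in>UNIV. \<Sum>k\<in>UNIV. ?b i k)"
    unfolding DD by (simp add: sum_subtractf[symmetric] scale_right_diff_distrib algebra_simps)
  \<comment> \<open>The deltas of \<open>comm_D_Q\<close> enter twice, with opposite signs of the
    coefficients, and on the diagonal they assemble to the symplectic form.\<close>
  also have "\<dots> = (\<Sum>i\<in>UNIV. \<Sum>k\<in>UNIV. (scl (fst y $ i * fst z $ k) (Lap i k f)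
      + scl (fst y $ i * snd z $ k) (\<Sum>j\<in>UNIV. T j k (Lap i j f))
      - scl (snd y $ i * fst z $ k) (\<Sum>j\<in>UNIV. T j i (Lap k j f))
      + scl (snd y $ i * snd z $ k) (\<Sum>a\<in>UNIV. \<Sum>b\<in>UNIV. T a i (T b k (Lap a b f))))
      - (if i = k then scl ((fst y $ i * snd z $ i - snd y $ i * fst z $ i) / 2) f else 0))"
    unfolding comm_D_D comm_D_Q[OF f] comm_Q_Q[OF f]
    by (intro sum.cong refl)
      (auto simp: scale_right_diff_distrib diff_divide_distrib scale_left_diff_distrib algebra_simps)
  also have "\<dots> = comm_remainder y z (\<lambda>i j. Lap i j f)
      - (\<Sum>i\<in>UNIV. scl ((fst y $ i * snd z $ i - snd y $ i * fst z $ i) / 2) f)"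
    unfolding comm_remainder_def by (simp add: sum_subtractf)
  also have "(\<Sum>i\<in>UNIV. scl ((fst y $ i * snd z $ i - snd y $ i * fst z $ i) / 2) f) = scl (symp y z / 2) f"
    by (simp add: symp_def sum_divide_distrib flip: scale_sum_left)
  finally show ?thesis .
qed

text \<open>Every term on the right of \<open>Lap_D\<close> contains some component applied to f;
  division by 3 gives the claim for D_k. Then \<open>Lap_Q\<close> reduces the case of Q_k to that
  of D_a.\<close>

lemma Lap_Dh_eq_zero:
  assumes f: "f \<in> S" and L: "\<And>i j. Lap i j f = 0"
  shows "Lap i j (Dh y f) = 0"
proof -
  have D: "Lap i j (D k f) = 0" for i j k
    using Lap_D[OF f, of i j k] L by (simp add: spinor_simps)
  then have Q: "Lap i j (Q k f) = 0" for k
    using Lap_Q[OF f, of i j k] L by (simp add: spinor_simps)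
  show ?thesis
    using f D Q by (simp add: Dh_def lin_simps[OF lin_Lap] spinor_simps lin_simps[OF lin_Q])
qed

end

section \<open>Grassmann algebra\<close>

lemma gsign_Un_left:
  fixes A B C :: "'n::{finite,linorder} set"
  assumes "A \<inter> B = {}" shows "gsign (A \<union> B) C = gsign A C * gsign B C"
proof -
  have "{(a, b). a \<in> A \<union> B \<and> b \<in> C \<and> b < a} = {(a, b). a \<in> A \<and> b \<in> C \<and> b < a} \<union> {(a, b). a \<in> B \<and> b \<in> C \<and> b < a}"
    by auto
  moreover have "{(a, b). a \<in> A \<and> b \<in> C \<and> b < a} \<inter> {(a, b). a \<in> B \<and> b \<in> C \<and> b < a} = {}"
    using assms by auto
  ultimately show ?thesis by (simp add: gsign_def card_Un_disjoint power_add)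
qed

lemma gsign_Un_right:
  fixes A B C :: "'n::{finite,linorder} set"
  assumes "B \<inter> C = {}" shows "gsign A (B \<union> C) = gsign A B * gsign A C"
proof -
  have "{(a, b). a \<in> A \<and> b \<in> B \<union> C \<and> b < a} = {(a, b). a \<in> A \<and> b \<in> B \<and> b < a} \<union> {(a, b). a \<in> A \<and> b \<in> C \<and> b < a}"
    by auto
  moreover have "{(a, b). a \<in> A \<and> b \<in> B \<and> b < a} \<inter> {(a, b). a \<in> A \<and> b \<in> C \<and> b < a} = {}"
    using assms by auto
  ultimately show ?thesis by (simp add: gsign_def card_Un_disjoint power_add)
qed

lemma gsign_square: "gsign A B * gsign A B = 1"
  by (simp add: gsign_def flip: power_mult_distrib)

lemma gsign_square_left: "gsign A B * (gsign A B * x) = x"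
  by (simp add: gsign_square flip: mult.assoc)

lemma neg_one_power_cancel: "(-1) ^ n * ((-1) ^ n * x) = (x :: complex)"
  by (cases "even n") auto

text \<open>Each element of A is either below or above i, so it is counted in exactly one of the two
  signs.\<close>

lemma gsign_swap:
  fixes i :: "'n::{finite,linorder}"
  assumes "i \<notin> A" shows "gsign {i} A * gsign A {i} = (-1) ^ card A"
proof -
  have "{(a, b). a \<in> {i} \<and> b \<in> A \<and> b < a} = (\<lambda>b. (i, b)) ` {b \<in> A. b < i}" by auto
  then have 1: "card {(a, b). a \<in> {i} \<and> b \<in> A \<and> b < a} = card {b \<in> A. b < i}"
    by (simp add: card_image inj_on_def)
  have "{(a, b). a \<in> A \<and> b \<in> {i} \<and> b < a} = (\<lambda>a. (a, i)) ` {a \<in> A. i < a}" by auto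
  then have 2: "card {(a, b). a \<in> A \<and> b \<in> {i} \<and> b < a} = card {a \<in> A. i < a}"
    by (simp add: card_image inj_on_def)
  have "A = {b \<in> A. b < i} \<union> {a \<in> A. i < a}" using assms by (auto simp: not_less_iff_gr_or_eq)
  then have "card A = card ({b \<in> A. b < i} \<union> {a \<in> A. i < a})" by (rule arg_cong)
  also have "\<dots> = card {b \<in> A. b < i} + card {a \<in> A. i < a}"
    by (rule card_Un_disjoint) auto
  finally have "card A = card {b \<in> A. b < i} + card {a \<in> A. i < a}" .
  then show ?thesis unfolding gsign_def 1 2 by (simp add: power_add)
qed

lemma gsign_swap':
  fixes i :: "'n::{finite,linorder}"
  assumes "i \<notin> A" shows "gsign A {i} = (-1) ^ card A * gsign {i} A"
proof -
  have "gsign A {i} = gsign {i} A * (gsign {i} A * gsign A {i})" by (simp add: gsign_square_left)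
  then show ?thesis unfolding gsign_swap[OF assms] by simp
qed

text \<open>Both sides sum over decompositions of D into three disjoint blocks, with the product of
  the three pairwise signs.\<close>

lemma gmul_assoc: "gmul (gmul a b) c = gmul a (gmul b (c :: 'n::{finite,linorder} grass))"
proof
  fix D :: "'n set"
  let ?F = "\<lambda>A B. gsign A B * gsign A (D - A - B) * gsign B (D - A - B) * (a A * b B * c (D - A - B))"
  have "gmul (gmul a b) c D = (\<Sum>E\<in>Pow D. \<Sum>A\<in>Pow E. ?F A (E - A))"
    unfolding gmul_def sum_distrib_left sum_distrib_right
  proof (intro sum.cong refl)
    fix E A assume EA: "E \<in> Pow D" "A \<in> Pow E"
    then have "D - A - (E - A) = D - E" "A \<union> (E - A) = E" by auto
    then show "gsign E (D - E) * (gsign A (E - A) * a A * b (E - A)) * c (D - E) = ?F A (E - A)"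
      using gsign_Un_left[of A "E - A" "D - E"] by simp
  qed
  also have "\<dots> = (\<Sum>(E, A)\<in>(SIGMA E:Pow D. Pow E). ?F A (E - A))"
    by (simp add: sum.Sigma)
  also have "\<dots> = (\<Sum>(A, B)\<in>(SIGMA A:Pow D. Pow (D - A)). ?F A B)"
    by (rule sum.reindex_bij_witness[of _ "\<lambda>(A, B). (A \<union> B, A)" "\<lambda>(E, A). (A, E - A)"]) auto
  also have "\<dots> = (\<Sum>A\<in>Pow D. \<Sum>B\<in>Pow (D - A). ?F A B)"
    by (simp add: sum.Sigma)
  also have "\<dots> = gmul a (gmul b c) D"
    unfolding gmul_def sum_distrib_left sum_distrib_right
  proof (intro sum.cong refl)
    fix A B assume AB: "A \<in> Pow D" "B \<in> Pow (D - A)"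
    then have "B \<union> (D - A - B) = D - A" by auto
    then show "?F A B = gsign A (D - A) * a A * (gsign B (D - A - B) * b B * c (D - A - B))"
      using gsign_Un_right[of B "D - A - B" A] by simp
  qed
  finally show "gmul (gmul a b) c D = gmul a (gmul b c) D" .
qed

section \<open>Parity, product rule and commutation with xi in the Grassmann algebra\<close>

definition gscl :: "complex \<Rightarrow> 'n grass \<Rightarrow> 'n grass" where "gscl c a = (\<lambda>A. c * a A)"

definition gone :: "'n grass" where "gone = (\<lambda>A. if A = {} then 1 else 0)"

definition gpar :: "'n grass \<Rightarrow> 'n grass" where "gpar a = (\<lambda>A. (-1) ^ card A * a A)"

lemma gmul_add_left: "gmul (a + b) c = gmul a c + gmul b c"
  and gmul_add_right: "gmul a (b + c) = gmul a b + gmul a c"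
  and gmul_scl_left: "gmul (gscl k a) b = gscl k (gmul a b)"
  and gmul_scl_right: "gmul a (gscl k b) = gscl k (gmul a b)"
  by (simp_all add: fun_eq_iff gmul_def gscl_def algebra_simps sum.distrib sum_distrib_left)

lemma gmul_zero [simp]: "gmul 0 a = 0" "gmul a 0 = 0"
  by (simp_all add: fun_eq_iff gmul_def)

lemma gmul_uminus: "gmul (- a) b = - gmul a b" "gmul a (- b) = - gmul a b"
  by (simp_all add: fun_eq_iff gmul_def sum_negf)

lemma gmul_diff_left: "gmul (a - b) c = gmul a c - gmul b c"
  and gmul_diff_right: "gmul a (b - c) = gmul a b - gmul a c"
  using gmul_add_left[of a "- b" c] gmul_add_right[of a b "- c"] by (simp_all add: gmul_uminus)

lemma gmul_sum_left: "gmul (\<Sum>i\<in>I. a i) c = (\<Sum>i\<in>I. gmul (a i) c)"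
  and gmul_sum_right: "gmul c (\<Sum>i\<in>I. a i) = (\<Sum>i\<in>I. gmul c (a i))"
  by (induction I rule: infinite_finite_induct) (simp_all add: gmul_add_left gmul_add_right)

lemma gmul_one [simp]: "gmul gone (a :: 'n::{finite,linorder} grass) = a"
proof
  fix C :: "'n set"
  have "gmul gone a C = (\<Sum>A\<in>Pow C. if A = {} then a C else 0)"
    unfolding gmul_def gone_def by (intro sum.cong) (auto simp: gsign_def)
  then show "gmul gone a C = a C" by simp
qed

lemma d_xi_linear: "d_xi i (a + b) = d_xi i a + d_xi i b" "d_xi i (gscl k a) = gscl k (d_xi i a)"
  "d_xi i (- a) = - d_xi i a" "d_xi i (a - b) = d_xi i a - d_xi i b" "d_xi i 0 = 0"
  by (auto simp: fun_eq_iff d_xi_def gscl_def algebra_simps)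

lemma d_xi_anticomm: "d_xi i (d_xi k a) = - d_xi k (d_xi i (a :: 'n::{finite,linorder} grass))"
proof
  fix A :: "'n set"
  show "d_xi i (d_xi k a) A = (- d_xi k (d_xi i a)) A"
  proof (cases "i \<in> A \<or> k \<in> A \<or> i = k")
    case False
    have "gsign {k} (insert i A) = gsign {k} {i} * gsign {k} A" "gsign {i} (insert k A) = gsign {i} {k} * gsign {i} A"
      using False gsign_Un_right[of "{i}" A "{k}"] gsign_Un_right[of "{k}" A "{i}"] by auto
    moreover have "gsign {k} {i} = - gsign {i} {k}" using False by (auto simp: gsign_sing)
    ultimately show ?thesis using False by (auto simp: d_xi_def insert_commute)
  qed (auto simp: d_xi_def)
qed

text \<open>For i outside C, the subsets of \<open>insert i C\<close> are sorted by the factor that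
  receives i. If it is the right factor, i has to pass the left one, which costs the sign in
  \<open>gpar\<close>.\<close>

lemma d_xi_gmul:
  "d_xi i (gmul a b) = gmul (d_xi i a) b + gmul (gpar a) (d_xi i (b :: 'n::{finite,linorder} grass))"
proof
  fix C :: "'n set"
  show "d_xi i (gmul a b) C = (gmul (d_xi i a) b + gmul (gpar a) (d_xi i b)) C"
  proof (cases "i \<in> C")
    case False
    have "gmul a b (insert i C) = (\<Sum>A\<in>Pow C. gsign A (insert i C - A) * a A * b (insert i C - A))
        + (\<Sum>A\<in>insert i ` Pow C. gsign A (insert i C - A) * a A * b (insert i C - A))"
      unfolding gmul_def Pow_insert using False by (intro sum.union_disjoint) auto
    also have "(\<Sum>A\<in>insert i ` Pow C. gsign A (insert i C - A) * a A * b (insert i C - A)) =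
        (\<Sum>A\<in>Pow C. gsign (insert i A) (C - A) * a (insert i A) * b (C - A))"
      using False by (subst sum.reindex) (auto simp: inj_on_def insert_Diff_if intro!: sum.cong arg_cong2[of _ _ _ _ "\<lambda>X Y. gsign X Y * _ X * _ Y"])
    finally have exp: "d_xi i (gmul a b) C =
        (\<Sum>A\<in>Pow C. gsign {i} C * (gsign A (insert i C - A) * a A * b (insert i C - A)))
        + (\<Sum>A\<in>Pow C. gsign {i} C * (gsign (insert i A) (C - A) * a (insert i A) * b (C - A)))"
      using False by (simp add: d_xi_def sum_distrib_left distrib_left)
    have t1: "gsign {i} C * (gsign A (insert i C - A) * a A * b (insert i C - A)) = gsign A (C - A) * gpar a A * d_xi i b (C - A)"
      and t2: "gsign {i} C * (gsign (insert i A) (C - A) * a (insert i A) * b (C - A)) = gsign A (C - A) * d_xi i a A * b (C - A)"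
      if A: "A \<in> Pow C" for A
    proof -
      have iA: "i \<notin> A" "i \<notin> C - A" "insert i C - A = insert i (C - A)" "A \<inter> (C - A) = {}" "A \<union> (C - A) = C" using A False by auto
      have C: "gsign {i} C = gsign {i} A * gsign {i} (C - A)"
        using gsign_Un_right[OF iA(4), of "{i}"] iA(5) by simp
      have 1: "gsign A (insert i (C - A)) = gsign A {i} * gsign A (C - A)"
        using gsign_Un_right[of "{i}" "C - A" A] iA by simp
      have 2: "gsign (insert i A) (C - A) = gsign {i} (C - A) * gsign A (C - A)"
        using gsign_Un_left[of "{i}" A "C - A"] iA by simp
      show "gsign {i} C * (gsign A (insert i C - A) * a A * b (insert i C - A)) = gsign A (C - A) * gpar a A * d_xi i b (C - A)"
        unfolding C iA(3) 1 gsign_swap'[OF iA(1)] gpar_def d_xi_def using iA by (simp add: mult_ac gsign_square gsign_square_left)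
      show "gsign {i} C * (gsign (insert i A) (C - A) * a (insert i A) * b (C - A)) = gsign A (C - A) * d_xi i a A * b (C - A)"
        unfolding C 2 d_xi_def using iA by (simp add: mult_ac gsign_square gsign_square_left)
    qed
    have "d_xi i (gmul a b) C = (\<Sum>A\<in>Pow C. gsign A (C - A) * gpar a A * d_xi i b (C - A))
        + (\<Sum>A\<in>Pow C. gsign A (C - A) * d_xi i a A * b (C - A))"
      unfolding exp by (intro arg_cong2[of _ _ _ _ "(+)"] sum.cong refl t1 t2)
    then show ?thesis by (simp add: gmul_def)
  next
    case True
    define C' where "C' = C - {i}"
    have C': "C = insert i C'" "i \<notin> C'" using True by (auto simp: C'_def)
    have e1: "gmul (d_xi i a) b C = (\<Sum>A\<in>Pow C'. gsign A (C - A) * d_xi i a A * b (C - A))"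
      unfolding gmul_def by (intro sum.mono_neutral_right) (auto simp: C' d_xi_def)
    have "gmul (gpar a) (d_xi i b) C = (\<Sum>A\<in>insert i ` Pow C'. gsign A (C - A) * gpar a A * d_xi i b (C - A))"
      unfolding gmul_def
    proof (intro sum.mono_neutral_right)
      show "\<forall>A\<in>Pow C - insert i ` Pow C'. gsign A (C - A) * gpar a A * d_xi i b (C - A) = 0"
      proof
        fix A assume A: "A \<in> Pow C - insert i ` Pow C'"
        have "i \<notin> A"
        proof
          assume "i \<in> A"
          then have "A = insert i (A - {i})" "A - {i} \<in> Pow C'" using A by (auto simp: C')
          then show False using A by blast
        qed
        then show "gsign A (C - A) * gpar a A * d_xi i b (C - A) = 0" by (simp add: d_xi_def C')
      qed
    qed (auto simp: C')
    also have "\<dots> = (\<Sum>A\<in>Pow C'. gsign (insert i A) (C' - A) * gpar a (insert i A) * d_xi i b (C' - A))"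
    proof (subst sum.reindex)
      show "inj_on (insert i) (Pow C')" using C'(2) by (auto simp: inj_on_def)
      show "sum ((\<lambda>A. gsign A (C - A) * gpar a A * d_xi i b (C - A)) \<circ> insert i) (Pow C') =
          (\<Sum>A\<in>Pow C'. gsign (insert i A) (C' - A) * gpar a (insert i A) * d_xi i b (C' - A))"
      proof (intro sum.cong refl)
        fix A assume "A \<in> Pow C'"
        then have "C - insert i A = C' - A" using C' by auto
        then show "((\<lambda>A. gsign A (C - A) * gpar a A * d_xi i b (C - A)) \<circ> insert i) A =
            gsign (insert i A) (C' - A) * gpar a (insert i A) * d_xi i b (C' - A)" by simp
      qed
    qed
    finally have "(gmul (d_xi i a) b + gmul (gpar a) (d_xi i b)) C =
        (\<Sum>A\<in>Pow C'. gsign A (C - A) * d_xi i a A * b (C - A)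
          + gsign (insert i A) (C' - A) * gpar a (insert i A) * d_xi i b (C' - A))"
      by (simp add: sum.distrib e1)
    \<comment> \<open>For i in C the derivative is zero, so the right side must cancel. The set A in
      the first product is paired with \<open>insert i A\<close> in the second; the element i added
      to it makes the sign in \<open>gpar\<close> opposite.\<close>
    also have "\<dots> = 0"
    proof (intro sum.neutral ballI)
      fix A assume A: "A \<in> Pow C'"
      have iA: "i \<notin> A" "i \<notin> C' - A" "C - A = insert i (C' - A)" "finite A" using A C' by auto
      have 1: "gsign A (insert i (C' - A)) = gsign A {i} * gsign A (C' - A)"
        using gsign_Un_right[of "{i}" "C' - A" A] iA by simp
      have 2: "gsign (insert i A) (C' - A) = gsign {i} (C' - A) * gsign A (C' - A)"
        using gsign_Un_left[of "{i}" A "C' - A"] iA by simp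
      show "gsign A (C - A) * d_xi i a A * b (C - A)
          + gsign (insert i A) (C' - A) * gpar a (insert i A) * d_xi i b (C' - A) = 0"
        unfolding iA(3) 1 2 gsign_swap'[OF iA(1)] gpar_def d_xi_def using iA by (simp add: mult_ac gsign_square gsign_square_left)
    qed
    finally show ?thesis using True by (simp add: d_xi_def)
  qed
qed

lemma gpar_gxi: "gpar (gxi j) = - gxi j"
  by (auto simp: gpar_def gxi_def fun_eq_iff)

lemma d_xi_gxi: "d_xi i (gxi j) = (if i = j then gone else 0)"
proof
  fix A :: "'a set"
  have "i \<notin> A \<and> insert i A = {j} \<longleftrightarrow> i = j \<and> A = {}" by auto
  then show "d_xi i (gxi j) A = (if i = j then gone else 0) A"
    by (auto simp: d_xi_def gxi_def gone_def gsign_def)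
qed

lemma d_xi_gmul_gxi:
  "d_xi i (gmul (gxi j) a) = (if i = j then a else 0) - gmul (gxi j) (d_xi i (a :: 'n::{finite,linorder} grass))"
  by (simp add: d_xi_gmul gpar_gxi d_xi_gxi gmul_uminus)

lemma gxi_gxi: "gmul (gxi i) (gxi j) = - gmul (gxi j) (gxi (i :: 'n::{finite,linorder}))"
  by (auto simp: fun_eq_iff gmul_gxi_gxi insert_commute[of i j])

lemma gmul_gxi_anticomm: "gmul (gxi i) (gmul (gxi j) a) = - gmul (gxi j) (gmul (gxi i) (a :: 'n::{finite,linorder} grass))"
  unfolding gmul_assoc[symmetric] gxi_gxi[of i j] by (simp add: gmul_uminus)

text \<open>Moving xi_j from the right to the left past a monomial of degree d costs (-1)^d, which
  \<open>gpar\<close> compensates.\<close>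

lemma gmul_gxi_right: "gmul (gpar a) (gxi j) = gmul (gxi j) (a :: 'n::{finite,linorder} grass)"
proof
  fix C :: "'n set"
  have vanish: "gsign A (C - A) * gpar a A * gxi j (C - A) = 0" if "A \<in> Pow C" "A \<noteq> C - {j} \<or> j \<notin> C" for A
  proof -
    have "C - A \<noteq> {j}" using that by blast
    then show ?thesis by (simp add: gxi_def)
  qed
  show "gmul (gpar a) (gxi j) C = gmul (gxi j) a C"
  proof (cases "j \<in> C")
    case True
    define B where "B = C - {j}"
    have B: "C - B = {j}" "j \<notin> B" "B \<in> Pow C" using True by (auto simp: B_def)
    have "gmul (gpar a) (gxi j) C = (\<Sum>A\<in>{B}. gsign A (C - A) * gpar a A * gxi j (C - A))"
      unfolding gmul_def by (rule sum.mono_neutral_right) (use B vanish B_def in auto)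
    also have "\<dots> = gsign B {j} * gpar a B" by (simp add: B(1)) (simp add: gxi_def)
    also have "\<dots> = gsign {j} B * a B"
      unfolding gsign_swap'[OF B(2)] gpar_def
      using neg_one_power_cancel[of "card B" "gsign {j} B * a B"] by (simp only: mult_ac)
    also have "\<dots> = gmul (gxi j) a C" using True by (simp add: gmul_gxi B_def)
    finally show ?thesis .
  next
    case False
    then have "gmul (gpar a) (gxi j) C = 0" unfolding gmul_def by (intro sum.neutral) (use vanish in auto)
    then show ?thesis using False by (simp add: gmul_gxi)
  qed
qed

lemma gpar_gpar [simp]: "gpar (gpar a) = a"
  by (simp add: gpar_def fun_eq_iff neg_one_power_cancel)

lemma gmul_gxi_Leibniz: "gmul (gxi j) (gmul a b) = gmul (gpar a) (gmul (gxi j) (b :: 'n::{finite,linorder} grass))"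
  by (simp add: gmul_gxi_right flip: gmul_assoc)

lemma gpar_linear: "gpar (a + b) = gpar a + gpar b" "gpar (- a) = - gpar a" "gpar 0 = 0"
  "gpar (a - b) = gpar a - gpar b" "gpar (gscl k a) = gscl k (gpar a)"
  by (auto simp: gpar_def gscl_def fun_eq_iff algebra_simps)

lemma gpar_gmul: "gpar (gmul a b) = gmul (gpar a) (gpar (b :: 'n::{finite,linorder} grass))"
proof
  fix C :: "'n set"
  show "gpar (gmul a b) C = gmul (gpar a) (gpar b) C"
    unfolding gpar_def gmul_def sum_distrib_left
  proof (intro sum.cong refl)
    fix A assume "A \<in> Pow C"
    then have "card C = card A + card (C - A)" by (metis Pow_iff card_Diff_subset card_mono finite le_add_diff_inverse)
    then show "(-1) ^ card C * (gsign A (C - A) * a A * b (C - A)) = gsign A (C - A) * ((-1) ^ card A * a A) * ((-1) ^ card (C - A) * b (C - A))"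
      by (simp add: power_add)
  qed
qed

lemma gpar_d_xi: "gpar (d_xi i a) = - d_xi i (gpar (a :: 'n::{finite,linorder} grass))"
  by (auto simp: fun_eq_iff gpar_def d_xi_def)

section \<open>Superfunctions\<close>

definition fscl :: "complex \<Rightarrow> 'n sfun \<Rightarrow> 'n sfun" where "fscl c f = (\<lambda>v A. c * f v A)"

lemma fscl_apply: "fscl c f v = gscl c (f v)"
  by (simp add: fscl_def gscl_def)

abbreviation sfuns :: "'n::{finite,linorder} cmat set \<Rightarrow> 'n sfun set" where
  "sfuns \<equiv> sect sfun_sheaf"

lemma mem_sfuns: "f \<in> sfuns V \<longleftrightarrow> (\<forall>A. holo_on V (\<lambda>v. f v A)) \<and> (\<forall>v. v \<notin> V \<longrightarrow> f v = 0)"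
  by (auto simp: sfun_sheaf_def fun_eq_iff)

lemma sfuns_holo: "f \<in> sfuns V \<Longrightarrow> holo_on V (\<lambda>v. f v A)"
  and sfuns_outside: "f \<in> sfuns V \<Longrightarrow> v \<notin> V \<Longrightarrow> f v = 0"
  unfolding mem_sfuns by blast+

lemma rest_sfun: "rest sfun_sheaf V f = (\<lambda>v. if v \<in> V then f v else 0)"
  by (auto simp: sfun_sheaf_def fun_eq_iff)

lemma sfunsI:
  assumes "\<And>A. holo_on V (\<lambda>v. f v A)" "\<And>v. v \<notin> V \<Longrightarrow> f v = 0" shows "f \<in> sfuns V"
  using assms unfolding mem_sfuns by blast

text \<open>Sections over V vanish outside V, but the raw derivative of such an extension by zero
  need not be meaningful there; hence the restriction. \<open>s_dt\<close> is cut off for the same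
  reason.\<close>

definition sD :: "'n::{finite,linorder} cmat set \<Rightarrow> 'n \<Rightarrow> 'n sfun \<Rightarrow> 'n sfun" where
  "sD V i f = rest sfun_sheaf V (spinor_fun i f)"

definition sX :: "'n::{finite,linorder} \<Rightarrow> 'n sfun \<Rightarrow> 'n sfun" where
  "sX i f = (\<lambda>v. gmul (gxi i) (f v))"

definition sT :: "'n::{finite,linorder} \<Rightarrow> 'n \<Rightarrow> 'n sfun \<Rightarrow> 'n sfun" where
  "sT k l f = (\<lambda>v. gmul (t_fun k l v) (f v))"

definition s_d :: "'n::{finite,linorder} \<Rightarrow> 'n sfun \<Rightarrow> 'n sfun" where
  "s_d i f = (\<lambda>v. d_xi i (f v))"

definition s_dt :: "'n::{finite,linorder} cmat set \<Rightarrow> 'n \<Rightarrow> 'n \<Rightarrow> 'n sfun \<Rightarrow> 'n sfun" where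
  "s_dt V i j f = (\<lambda>v A. if v \<in> V then dsym i j (\<lambda>v. f v A) v else 0)"

lemma t_fun_eq: "t_fun i j v = gscl (v $ i $ j) gone - gscl (1/2) (gmul (gxi i) (gxi j))"
  by (auto simp: t_fun_def gscl_def gone_def fun_eq_iff)

lemma sT_eq: "sT i j f v = gscl (v $ i $ j) (f v) - gscl (1/2) (gmul (gxi i) (gmul (gxi j) (f v)))"
  by (simp add: sT_def t_fun_eq gmul_diff_left gmul_scl_left gmul_assoc)

lemma gpar_t_fun: "gpar (t_fun i j v) = t_fun i j v"
  by (auto simp: gpar_def t_fun_def gmul_gxi_gxi fun_eq_iff)

section \<open>Superfunctions over a fixed open set as a module for the abstract operators\<close>

context
  fixes V :: "'n::{finite,linorder} cmat set"
  assumes V: "siegel_open V"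
begin

lemmas holo_cong = holo_on_cong[OF V] and holo_const = holo_on_const[OF V] and holo_nth = holo_on_nth[OF V]
  and holo_add = holo_on_add[OF V] and holo_mult = holo_on_mult[OF V] and holo_sum = holo_on_sum[OF V]

lemma holo_t_fun: "holo_on V (\<lambda>v. t_fun i j v A)"
proof -
  have "holo_on V (\<lambda>v. (if A = {} then 1 else 0) * v $ i $ j + - (gmul (gxi i) (gxi j) A / 2))"
    by (intro holo_add holo_mult holo_const holo_nth)
  then show ?thesis by (rule holo_cong[rotated]) (simp add: t_fun_def)
qed

lemma sfuns_gmul:
  assumes g: "\<And>A. holo_on V (\<lambda>v. g v A)" and f: "f \<in> sfuns V"
  shows "(\<lambda>v. gmul (g v) (f v)) \<in> sfuns V"
proof (rule sfunsI)
  fix C show "holo_on V (\<lambda>v. gmul (g v) (f v) C)"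
    unfolding gmul_def by (intro holo_sum holo_mult holo_const g sfuns_holo[OF f])
qed (simp add: sfuns_outside[OF f])

lemma sfuns_d: "f \<in> sfuns V \<Longrightarrow> s_d i f \<in> sfuns V"
proof (rule sfunsI)
  assume f: "f \<in> sfuns V"
  fix A show "holo_on V (\<lambda>v. s_d i f v A)"
    unfolding s_d_def d_xi_def
    by (cases "i \<in> A") (simp_all only: if_True if_False holo_const holo_mult[OF holo_const sfuns_holo[OF f]] simp_thms)
qed (simp add: s_d_def sfuns_outside d_xi_def fun_eq_iff)

lemma sfuns_dt: "f \<in> sfuns V \<Longrightarrow> s_dt V i j f \<in> sfuns V"
proof (rule sfunsI)
  assume f: "f \<in> sfuns V"
  fix A show "holo_on V (\<lambda>v. s_dt V i j f v A)"
    by (rule holo_cong[OF _ holo_on_dsym[OF V sfuns_holo[OF f]]]) (simp add: s_dt_def)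
qed (simp add: s_dt_def zero_fun_def)

lemma subspace_module_sfuns: "subspace_module fscl (sfuns V)"
proof -
  interpret vector_space "fscl :: complex \<Rightarrow> 'n sfun \<Rightarrow> 'n sfun"
    by unfold_locales (auto simp: fscl_def fun_eq_iff algebra_simps)
  have "f + g \<in> sfuns V" if "f \<in> sfuns V" "g \<in> sfuns V" for f g
    using that by (intro sfunsI) (auto simp: plus_fun_def[of f g] plus_fun_apply sfuns_outside intro: holo_add sfuns_holo)
  moreover have "fscl c f \<in> sfuns V" if "f \<in> sfuns V" for c f
    using that by (intro sfunsI) (auto simp: fscl_def sfuns_outside zero_fun_def intro: holo_mult holo_const sfuns_holo)
  moreover have "0 \<in> sfuns V" by (intro sfunsI) (auto simp: holo_const)
  ultimately show ?thesis by unfold_locales (auto simp: subspace_def)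
qed

interpretation M: subspace_module fscl "sfuns V" by (rule subspace_module_sfuns)

lemma M_linI:
  assumes "\<And>f. f \<in> sfuns V \<Longrightarrow> F f \<in> sfuns V" "\<And>f g v. f \<in> sfuns V \<Longrightarrow> g \<in> sfuns V \<Longrightarrow> F (f + g) v = F f v + F g v"
    "\<And>f c v. f \<in> sfuns V \<Longrightarrow> F (fscl c f) v = gscl c (F f v)"
  shows "M.lin F"
  unfolding M.lin_def using assms by (auto simp: fun_eq_iff fscl_apply)

lemma lin_dt: "M.lin (s_dt V i j)"
proof (rule M_linI)
  fix f g v assume f: "f \<in> sfuns V" and g: "g \<in> sfuns V"
  show "s_dt V i j (f + g) v = s_dt V i j f v + s_dt V i j g v"
    by (auto simp: s_dt_def fun_eq_iff dsym_add[OF V sfuns_holo[OF f] sfuns_holo[OF g]])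
next
  fix f v c assume f: "f \<in> sfuns V"
  show "s_dt V i j (fscl c f) v = gscl c (s_dt V i j f v)"
    by (auto simp: s_dt_def fscl_def gscl_def fun_eq_iff dsym_cmult[OF V sfuns_holo[OF f]])
qed (rule sfuns_dt)

lemma dt_d: assumes f: "f \<in> sfuns V" shows "s_dt V i j (s_d k f) = s_d k (s_dt V i j f)"
  by (auto simp: s_dt_def s_d_def d_xi_def fun_eq_iff dsym_const[OF V] dsym_cmult[OF V sfuns_holo[OF f]])

lemma dt_X: assumes f: "f \<in> sfuns V" shows "s_dt V i j (sX k f) = sX k (s_dt V i j f)"
  by (auto simp: s_dt_def sX_def gmul_gxi fun_eq_iff dsym_const[OF V] dsym_cmult[OF V sfuns_holo[OF f]])

lemma dt_dt: assumes f: "f \<in> sfuns V" shows "s_dt V i j (s_dt V k l f) = s_dt V k l (s_dt V i j f)"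
proof (intro ext)
  fix v A
  show "s_dt V i j (s_dt V k l f) v A = s_dt V k l (s_dt V i j f) v A"
  proof (cases "v \<in> V")
    case True
    \<comment> \<open>The cut-off inner derivative agrees with \<open>dsym\<close> on V, and by
      locality the outer derivative cannot distinguish them.\<close>
    have "dsym i j (\<lambda>v. s_dt V k l f v A) v = dsym i j (dsym k l (\<lambda>v. f v A)) v" for i j k l
      by (rule dsym_cong[OF V True]) (simp add: s_dt_def)
    moreover have "dsym i j (dsym k l (\<lambda>v. f v A)) v = dsym k l (dsym i j (\<lambda>v. f v A)) v"
      by (rule dsym_commute[OF V sfuns_holo[OF f] True])
    ultimately show ?thesis using True
      by (simp add: s_dt_def[of V i j "s_dt V k l f"] s_dt_def[of V k l "s_dt V i j f"])
  qed (simp add: s_dt_def)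
qed

lemma dt_gmul:
  assumes f: "f \<in> sfuns V" and g: "g \<in> sfuns V"
  shows "s_dt V i j (\<lambda>v. gmul (f v) (g v)) v = gmul (s_dt V i j f v) (g v) + gmul (f v) (s_dt V i j g v)"
proof (cases "v \<in> V")
  case True
  note F = sfuns_holo[OF f] and G = sfuns_holo[OF g]
  show ?thesis
  proof
    fix C
    have "s_dt V i j (\<lambda>v. gmul (f v) (g v)) v C = (\<Sum>A\<in>Pow C. dsym i j (\<lambda>v. (gsign A (C - A) * f v A) * g v (C - A)) v)"
      using True by (simp add: s_dt_def gmul_def dsym_sum[OF V] holo_mult holo_const F G)
    also have "\<dots> = (\<Sum>A\<in>Pow C. gsign A (C - A) * dsym i j (\<lambda>v. f v A) v * g v (C - A)
        + gsign A (C - A) * f v A * dsym i j (\<lambda>v. g v (C - A)) v)"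
    proof (intro sum.cong refl)
      fix A
      show "dsym i j (\<lambda>v. (gsign A (C - A) * f v A) * g v (C - A)) v = gsign A (C - A) * dsym i j (\<lambda>v. f v A) v * g v (C - A)
        + gsign A (C - A) * f v A * dsym i j (\<lambda>v. g v (C - A)) v"
        by (subst dsym_mult[OF V holo_mult[OF holo_const F] G True]) (simp add: dsym_cmult[OF V F True])
    qed
    also have "\<dots> = (gmul (s_dt V i j f v) (g v) + gmul (f v) (s_dt V i j g v)) C"
      using True by (simp add: gmul_def s_dt_def sum.distrib)
    finally show "s_dt V i j (\<lambda>v. gmul (f v) (g v)) v C = (gmul (s_dt V i j f v) (g v) + gmul (f v) (s_dt V i j g v)) C" .
  qed
next
  case False
  then have "s_dt V i j h v = 0" for h :: "'n sfun" by (simp add: s_dt_def zero_fun_def)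
  then show ?thesis by simp
qed

lemma super_weyl_sfuns: "super_weyl fscl (sfuns V) s_d sX (s_dt V)"
proof unfold_locales
  show "M.lin (s_d i)" for i
    by (rule M_linI) (simp_all add: sfuns_d, simp_all add: s_d_def d_xi_linear fscl_apply)
  show "M.lin (sX i)" for i
  proof (rule M_linI)
    show "sX i f \<in> sfuns V" if "f \<in> sfuns V" for f
      unfolding sX_def by (rule sfuns_gmul[OF holo_const that])
  qed (simp_all add: sX_def gmul_add_right fscl_apply gmul_scl_right)
  show "M.lin (s_dt V i j)" for i j by (rule lin_dt)
  show "s_dt V i j f = s_dt V j i f" if "f \<in> sfuns V" for i j f
    unfolding s_dt_def by (subst dsym_swap) (rule refl)
  fix f :: "'n sfun" assume f: "f \<in> sfuns V"
  show "s_dt V i j (s_dt V k l f) = s_dt V k l (s_dt V i j f)" for i j k l by (rule dt_dt[OF f])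
  show "s_dt V i j (s_d k f) = s_d k (s_dt V i j f)" for i j k by (rule dt_d[OF f])
  show "s_dt V i j (sX k f) = sX k (s_dt V i j f)" for i j k by (rule dt_X[OF f])
  show "s_d i (s_d k f) = - s_d k (s_d i f)" for i k
    by (rule ext) (simp add: s_d_def d_xi_anticomm[of i k])
  show "s_d i (sX k f) = (if i = k then f else 0) - sX k (s_d i f)" for i k
    by (rule ext) (simp add: s_d_def sX_def d_xi_gmul_gxi)
  show "sX i (sX k f) = - sX k (sX i f)" for i k
    by (rule ext) (simp add: sX_def gmul_gxi_anticomm[of i k])
qed

interpretation W: super_weyl fscl "sfuns V" s_d sX "s_dt V" by (rule super_weyl_sfuns)

lemma sum_sfun_apply: "(\<Sum>i\<in>I. g i) v A = (\<Sum>i\<in>I. (g i v A :: complex))"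
  by (induction I rule: infinite_finite_induct) simp_all

lemma sum_grass_apply: "(\<Sum>i\<in>I. g i) v = (\<Sum>i\<in>I. (g i v :: 'n grass))" for g :: "_ \<Rightarrow> 'n sfun"
  by (induction I rule: infinite_finite_induct) simp_all

lemma sD_eq: assumes "f \<in> sfuns V" shows "sD V i f = W.D i f"
proof
  fix v
  show "sD V i f v = W.D i f v"
  proof (cases "v \<in> V")
    case True
    have dt: "d_t i j f v = s_dt V i j f v" for j using True by (simp add: fun_eq_iff s_dt_def d_t_eq)
    show ?thesis
    proof
      fix A show "sD V i f v A = W.D i f v A"
        using True by (simp add: sD_def rest_sfun W.D_def spinor_fun_def s_d_def sX_def sum_sfun_apply dt)
    qed
  next
    case False
    have "W.D i f \<in> sfuns V" by (rule M.lin_closed[OF W.lin_D assms])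
    then show ?thesis using False sfuns_outside by (simp add: sD_def rest_sfun)
  qed
qed

text \<open>In the even part of D_i the factor xi_j stands in front and must pass f, so the second
  summand acquires the same \<open>gpar\<close> as in the product rule for the derivative in
  xi.\<close>

lemma sD_gmul:
  assumes f: "f \<in> sfuns V" and g: "g \<in> sfuns V"
  shows "sD V i (\<lambda>v. gmul (f v) (g v)) v = gmul (sD V i f v) (g v) + gmul (gpar (f v)) (sD V i g v)"
proof -
  have fg: "(\<lambda>v. gmul (f v) (g v)) \<in> sfuns V" by (rule sfuns_gmul[OF sfuns_holo[OF f] g])
  have D: "W.D i h v = d_xi i (h v) - (\<Sum>j\<in>UNIV. gmul (gxi j) (s_dt V i j h v))" for h
    by (simp add: W.D_def s_d_def sX_def sum_grass_apply)
  have "gmul (gxi j) (s_dt V i j (\<lambda>v. gmul (f v) (g v)) v) =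
      gmul (gmul (gxi j) (s_dt V i j f v)) (g v) + gmul (gpar (f v)) (gmul (gxi j) (s_dt V i j g v))" for j
    by (simp add: dt_gmul[OF f g] gmul_add_right gmul_assoc gmul_gxi_Leibniz[of j "f v"])
  then show ?thesis
    unfolding sD_eq[OF fg] sD_eq[OF f] sD_eq[OF g] D
    by (simp add: d_xi_gmul sum.distrib gmul_diff_left gmul_diff_right gmul_sum_left gmul_sum_right)
qed

lemma sD_cong:
  assumes "siegel_open W" "W \<subseteq> V" "v \<in> W" "\<And>w. w \<in> W \<Longrightarrow> f w = g w"
  shows "spinor_fun i f v = spinor_fun i g v"
proof -
  have "d_t i j f v A = d_t i j g v A" for j A
    unfolding d_t_eq by (rule dsym_cong[OF assms(1,3)]) (simp add: assms(4))
  then have dt: "d_t i j f v = d_t i j g v" for j by (simp add: fun_eq_iff)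
  show ?thesis by (rule ext) (simp add: spinor_fun_def assms(3,4) dt)
qed

lemma sfuns_rest_t: "rest sfun_sheaf V (t_fun k l) \<in> sfuns V"
  unfolding rest_sfun
proof (rule sfunsI)
  show "holo_on V (\<lambda>v. (if v \<in> V then t_fun k l v else 0) A)" for A
    by (rule holo_cong[OF _ holo_t_fun]) simp
qed simp

text \<open>The relations of D with X and T are the product rule \<open>sD_gmul\<close> together
  with the values \<open>spinor_fun_xi\<close> and \<open>spinor_fun_t\<close>.
  \<open>T_skew\<close> holds because points of V are symmetric matrices.\<close>

lemma spinor_module_sfuns: "spinor_module fscl (sfuns V) (sD V) sX sT"
proof unfold_locales
  have lin_cong: "M.lin F" if "M.lin G" "\<And>f. f \<in> sfuns V \<Longrightarrow> F f = G f" for F G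
    using that(1) unfolding M.lin_def by (simp add: that(2))
  show "M.lin (sD V i)" for i by (rule lin_cong[OF W.lin_D sD_eq])
  show "M.lin (sX i)" for i by (rule W.lin_X)
  have lin_T: "M.lin (sT k l)" for k l
  proof (rule M_linI)
    show "sT k l f \<in> sfuns V" if "f \<in> sfuns V" for f
      unfolding sT_def by (rule sfuns_gmul[OF holo_t_fun that])
  qed (simp_all add: sT_def gmul_add_right fscl_apply gmul_scl_right)
  then show "M.lin (sT k l)" for k l .
  fix f :: "'n sfun" assume f: "f \<in> sfuns V"
  have Dc: "W.D i f \<in> sfuns V" if "f \<in> sfuns V" for i f by (rule M.lin_closed[OF W.lin_D that])
  have Xc: "sX i f \<in> sfuns V" if "f \<in> sfuns V" for i f by (rule M.lin_closed[OF W.lin_X that])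
  show "sD V i (sD V j (sD V k f)) + sD V j (sD V i (sD V k f)) = sD V k (sD V i (sD V j f)) + sD V k (sD V j (sD V i f))" for i j k
    using W.D_central[OF f, of i j k] f by (simp only: sD_eq Dc)
  show "sD V i (sX k f) = (if i = k then f else 0) - sX k (sD V i f)" for i k
  proof -
    \<comment> \<open>\<open>xi_fun k\<close> does not vanish outside V; cutting it off makes it a
      section over V, to which the product rule applies.\<close>
    have gx: "rest sfun_sheaf V (xi_fun k) \<in> sfuns V"
      unfolding rest_sfun
    proof (rule sfunsI)
      show "holo_on V (\<lambda>v. (if v \<in> V then xi_fun k v else 0) A)" for A
        by (rule holo_cong[OF _ holo_const[of "gxi k A"]]) (simp add: xi_fun_def)
    qed simp
    have eq: "sX k f = (\<lambda>v. gmul (rest sfun_sheaf V (xi_fun k) v) (f v))"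
      by (auto simp: fun_eq_iff sX_def rest_sfun xi_fun_def sfuns_outside[OF f])
    show ?thesis
    proof
      fix v
      show "sD V i (sX k f) v = ((if i = k then f else 0) - sX k (sD V i f)) v"
      proof (cases "v \<in> V")
        case True
        have "spinor_fun i (rest sfun_sheaf V (xi_fun k)) v = spinor_fun i (xi_fun k) v"
          by (rule sD_cong[OF V order.refl True]) (simp add: rest_sfun)
        also have "\<dots> = (if i = k then gone else 0)" by (auto simp: fun_eq_iff spinor_fun_xi gone_def)
        finally have "sD V i (rest sfun_sheaf V (xi_fun k)) v = (if i = k then gone else 0)"
          using True by (simp add: sD_def rest_sfun)
        moreover have "rest sfun_sheaf V (xi_fun k) v = gxi k" using True by (simp add: rest_sfun xi_fun_def)
        ultimately show ?thesis unfolding eq sD_gmul[OF gx f] by (simp add: gpar_gxi gmul_uminus sX_def)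
      next
        case False
        then show ?thesis using sfuns_outside[OF f False] by (simp add: sD_def rest_sfun sX_def)
      qed
    qed
  qed
  show "sD V i (sT k l f) = sT k l (sD V i f) - (if i = k then sX l f else 0)" for i k l
  proof -
    have eq: "sT k l f = (\<lambda>v. gmul (rest sfun_sheaf V (t_fun k l) v) (f v))"
      by (auto simp: fun_eq_iff sT_def rest_sfun sfuns_outside[OF f])
    show ?thesis
    proof
      fix v
      show "sD V i (sT k l f) v = (sT k l (sD V i f) - (if i = k then sX l f else 0)) v"
      proof (cases "v \<in> V")
        case True
        have "spinor_fun i (rest sfun_sheaf V (t_fun k l)) v = spinor_fun i (t_fun k l) v"
          by (rule sD_cong[OF V order.refl True]) (simp add: rest_sfun)
        also have "\<dots> = (if i = k then - gxi l else 0)" by (auto simp: fun_eq_iff spinor_fun_t xi_fun_def)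
        finally have "sD V i (rest sfun_sheaf V (t_fun k l)) v = (if i = k then - gxi l else 0)"
          using True by (simp add: sD_def rest_sfun)
        then show ?thesis unfolding eq sD_gmul[OF sfuns_rest_t f] using True
          by (simp add: rest_sfun[of V "t_fun k l"] gpar_t_fun gmul_uminus sX_def sT_def)
      next
        case False
        then show ?thesis using sfuns_outside[OF f False] by (simp add: sD_def rest_sfun sX_def sT_def)
      qed
    qed
  qed
  show "sX i (sX k f) = - sX k (sX i f)" for i k by (rule W.X_X[OF f])
  have X_T: "sX i (sT k l f) = sT k l (sX i f)" for i k l f
    by (rule ext) (simp only: sX_def sT_def gmul_gxi_Leibniz[of i "t_fun k l _"] gpar_t_fun)
  then show "sX i (sT k l f) = sT k l (sX i f)" for i k l .
  show "sT i j (sT k l f) = sT k l (sT i j f)" for i j k l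
  proof
    fix v
    \<comment> \<open>t_ij is a number plus a multiple of xi_i xi_j, and \<open>X_T\<close> moves
      the second summand past t_kl.\<close>
    have "gmul (t_fun k l v) (sX i (sX j f) v) = sX i (sX j (sT k l f)) v"
      unfolding X_T by (simp add: sT_def)
    then show "sT i j (sT k l f) v = sT k l (sT i j f) v"
      unfolding sT_eq[of i j "sT k l f"] unfolding sT_def[of k l "sT i j f"] sT_eq[of i j f]
      by (simp add: gmul_diff_right gmul_scl_right sX_def sT_def)
  qed
  show "sT i j f = sT j i f - sX i (sX j f)" for i j
  proof
    fix v
    show "sT i j f v = (sT j i f - sX i (sX j f)) v"
    proof (cases "v \<in> V")
      case True
      then have s: "v $ i $ j = v $ j $ i" using siegel_sym siegel_openD[OF V] by blast
      have "gmul (gxi j) (gmul (gxi i) (f v)) = - gmul (gxi i) (gmul (gxi j) (f v))" by (rule gmul_gxi_anticomm)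
      then show ?thesis
        by (simp add: sT_eq s sX_def) (simp add: fun_eq_iff gscl_def)
    qed (simp add: sT_def sX_def sfuns_outside[OF f])
  qed
qed

end

section \<open>Endomorphisms of sheaves\<close>

lemma on_sect_apply: "siegel_open V \<Longrightarrow> V \<subseteq> U \<Longrightarrow> s \<in> sect F V \<Longrightarrow> on_sect F U \<phi> V s = \<phi> V s"
  by (simp add: on_sect_def)

lemma on_sect_eqI:
  assumes "\<And>V s. siegel_open V \<Longrightarrow> V \<subseteq> U \<Longrightarrow> s \<in> sect F V \<Longrightarrow> \<phi> V s = \<psi> V s"
  shows "on_sect F U \<phi> = on_sect F U \<psi>"
  by (intro ext) (auto simp: on_sect_def assms)

lemma on_sect_on_sect: "W \<subseteq> U \<Longrightarrow> on_sect F W (on_sect F U \<phi>) = on_sect F W \<phi>"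
  by (intro on_sect_eqI) (auto simp: on_sect_apply)

lemma on_sect_idem [simp]: "on_sect F U (on_sect F U \<phi>) = on_sect F U \<phi>"
  by (rule on_sect_on_sect) simp

text \<open>Presheaf laws for the bare record \<open>vsheaf\<close>. The record has no zero section;
  \<open>vscl F 0 t\<close>, for any section t over V, takes its place.\<close>

locale vpresheaf =
  fixes F :: "('n::finite cmat, 's) vsheaf"
  assumes vadd_closed: "siegel_open V \<Longrightarrow> s \<in> sect F V \<Longrightarrow> t \<in> sect F V \<Longrightarrow> vadd F s t \<in> sect F V"
    and vscl_closed: "siegel_open V \<Longrightarrow> s \<in> sect F V \<Longrightarrow> vscl F c s \<in> sect F V"
    and vadd_assoc: "siegel_open V \<Longrightarrow> s \<in> sect F V \<Longrightarrow> t \<in> sect F V \<Longrightarrow> u \<in> sect F V \<Longrightarrow>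
      vadd F (vadd F s t) u = vadd F s (vadd F t u)"
    and vadd_commute: "siegel_open V \<Longrightarrow> s \<in> sect F V \<Longrightarrow> t \<in> sect F V \<Longrightarrow> vadd F s t = vadd F t s"
    and vadd_zero: "siegel_open V \<Longrightarrow> s \<in> sect F V \<Longrightarrow> t \<in> sect F V \<Longrightarrow> vadd F s (vscl F 0 t) = s"
    and vscl_add_left: "siegel_open V \<Longrightarrow> s \<in> sect F V \<Longrightarrow> vscl F (c + d) s = vadd F (vscl F c s) (vscl F d s)"
    and vscl_add_right: "siegel_open V \<Longrightarrow> s \<in> sect F V \<Longrightarrow> t \<in> sect F V \<Longrightarrow>
      vscl F c (vadd F s t) = vadd F (vscl F c s) (vscl F c t)"
    and vscl_vscl: "siegel_open V \<Longrightarrow> s \<in> sect F V \<Longrightarrow> vscl F c (vscl F d s) = vscl F (c * d) s"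
    and vscl_one: "siegel_open V \<Longrightarrow> s \<in> sect F V \<Longrightarrow> vscl F 1 s = s"
    and rest_closed: "siegel_open V \<Longrightarrow> siegel_open W \<Longrightarrow> W \<subseteq> V \<Longrightarrow> s \<in> sect F V \<Longrightarrow> rest F W s \<in> sect F W"
    and rest_vadd: "siegel_open V \<Longrightarrow> siegel_open W \<Longrightarrow> W \<subseteq> V \<Longrightarrow> s \<in> sect F V \<Longrightarrow> t \<in> sect F V \<Longrightarrow>
      rest F W (vadd F s t) = vadd F (rest F W s) (rest F W t)"
    and rest_vscl: "siegel_open V \<Longrightarrow> siegel_open W \<Longrightarrow> W \<subseteq> V \<Longrightarrow> s \<in> sect F V \<Longrightarrow>
      rest F W (vscl F c s) = vscl F c (rest F W s)"
begin

lemma sheaf_EndI: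
  assumes "\<And>V s. siegel_open V \<Longrightarrow> V \<subseteq> U \<Longrightarrow> s \<in> sect F V \<Longrightarrow> \<phi> V s \<in> sect F V"
    and "\<And>V s t. siegel_open V \<Longrightarrow> V \<subseteq> U \<Longrightarrow> s \<in> sect F V \<Longrightarrow> t \<in> sect F V \<Longrightarrow> \<phi> V (vadd F s t) = vadd F (\<phi> V s) (\<phi> V t)"
    and "\<And>V c s. siegel_open V \<Longrightarrow> V \<subseteq> U \<Longrightarrow> s \<in> sect F V \<Longrightarrow> \<phi> V (vscl F c s) = vscl F c (\<phi> V s)"
    and "\<And>V W s. siegel_open V \<Longrightarrow> V \<subseteq> U \<Longrightarrow> siegel_open W \<Longrightarrow> W \<subseteq> V \<Longrightarrow> s \<in> sect F V \<Longrightarrow> rest F W (\<phi> V s) = \<phi> W (rest F W s)"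
  shows "on_sect F U \<phi> \<in> carrier (sheaf_End F U)"
  unfolding sheaf_End_def
  by (auto simp: on_sect_apply assms vadd_closed vscl_closed rest_closed on_sect_apply[OF _ order_trans])

lemma sheaf_EndD:
  assumes "\<phi> \<in> carrier (sheaf_End F U)" "siegel_open V" "V \<subseteq> U"
  shows "s \<in> sect F V \<Longrightarrow> \<phi> V s \<in> sect F V"
    and "s \<in> sect F V \<Longrightarrow> t \<in> sect F V \<Longrightarrow> \<phi> V (vadd F s t) = vadd F (\<phi> V s) (\<phi> V t)"
    and "s \<in> sect F V \<Longrightarrow> \<phi> V (vscl F c s) = vscl F c (\<phi> V s)"
    and "s \<in> sect F V \<Longrightarrow> siegel_open W \<Longrightarrow> W \<subseteq> V \<Longrightarrow> rest F W (\<phi> V s) = \<phi> W (rest F W s)"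
  using assms by (auto simp: sheaf_End_def)

lemma sheaf_End_normal: "\<phi> \<in> carrier (sheaf_End F U) \<Longrightarrow> on_sect F U \<phi> = \<phi>"
  by (simp add: sheaf_End_def)

lemma sheaf_End_eqI:
  assumes "\<phi> \<in> carrier (sheaf_End F U)" "\<psi> \<in> carrier (sheaf_End F U)"
    "\<And>V s. siegel_open V \<Longrightarrow> V \<subseteq> U \<Longrightarrow> s \<in> sect F V \<Longrightarrow> \<phi> V s = \<psi> V s"
  shows "\<phi> = \<psi>"
  using on_sect_eqI[of U F \<phi> \<psi>] assms by (simp add: sheaf_End_normal)

lemma sheaf_End_apply:
  assumes "siegel_open V" "V \<subseteq> U" "s \<in> sect F V"
  shows "(\<phi> \<oplus>\<^bsub>sheaf_End F U\<^esub> \<psi>) V s = vadd F (\<phi> V s) (\<psi> V s)"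
    and "(\<phi> \<otimes>\<^bsub>sheaf_End F U\<^esub> \<psi>) V s = \<phi> V (\<psi> V s)"
    and "(c \<odot>\<^bsub>sheaf_End F U\<^esub> \<phi>) V s = vscl F c (\<phi> V s)"
    and "\<one>\<^bsub>sheaf_End F U\<^esub> V s = s"
    and "\<zero>\<^bsub>sheaf_End F U\<^esub> V s = vscl F 0 s"
  using assms by (simp_all add: sheaf_End_def on_sect_apply)

lemma vadd_left_commute:
  assumes "siegel_open V" "s \<in> sect F V" "t \<in> sect F V" "u \<in> sect F V"
  shows "vadd F s (vadd F t u) = vadd F t (vadd F s u)"
  using vadd_assoc[of V s t u] vadd_assoc[of V t s u] vadd_commute[of V s t] assms by simp

lemma sheaf_End_closed:
  shows "\<phi> \<in> carrier (sheaf_End F U) \<Longrightarrow> \<psi> \<in> carrier (sheaf_End F U) \<Longrightarrow> \<phi> \<oplus>\<^bsub>sheaf_End F U\<^esub> \<psi> \<in> carrier (sheaf_End F U)"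
    and "\<phi> \<in> carrier (sheaf_End F U) \<Longrightarrow> \<psi> \<in> carrier (sheaf_End F U) \<Longrightarrow> \<phi> \<otimes>\<^bsub>sheaf_End F U\<^esub> \<psi> \<in> carrier (sheaf_End F U)"
    and "\<phi> \<in> carrier (sheaf_End F U) \<Longrightarrow> c \<odot>\<^bsub>sheaf_End F U\<^esub> \<phi> \<in> carrier (sheaf_End F U)"
    and "\<one>\<^bsub>sheaf_End F U\<^esub> \<in> carrier (sheaf_End F U)"
    and "\<zero>\<^bsub>sheaf_End F U\<^esub> \<in> carrier (sheaf_End F U)"
proof -
  have ops: "\<phi> \<oplus>\<^bsub>sheaf_End F U\<^esub> \<psi> = on_sect F U (\<lambda>V s. vadd F (\<phi> V s) (\<psi> V s))"
    "\<phi> \<otimes>\<^bsub>sheaf_End F U\<^esub> \<psi> = on_sect F U (\<lambda>V s. \<phi> V (\<psi> V s))"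
    "c \<odot>\<^bsub>sheaf_End F U\<^esub> \<phi> = on_sect F U (\<lambda>V s. vscl F c (\<phi> V s))" for \<phi> \<psi>
    by (simp_all add: sheaf_End_def)
  show "\<one>\<^bsub>sheaf_End F U\<^esub> \<in> carrier (sheaf_End F U)"
    by (simp add: sheaf_End_def[of F U, THEN arg_cong[of _ _ one]] sheaf_EndI)
  have "\<zero>\<^bsub>sheaf_End F U\<^esub> = on_sect F U (\<lambda>V s. vscl F 0 s)" by (simp add: sheaf_End_def)
  then show "\<zero>\<^bsub>sheaf_End F U\<^esub> \<in> carrier (sheaf_End F U)"
    by (simp only:) (rule sheaf_EndI; simp add: vscl_closed vscl_add_right vscl_vscl rest_vscl)
  assume p: "\<phi> \<in> carrier (sheaf_End F U)"
  show "c \<odot>\<^bsub>sheaf_End F U\<^esub> \<phi> \<in> carrier (sheaf_End F U)"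
    unfolding ops
    by (rule sheaf_EndI) (simp_all add: vscl_closed vscl_add_right vscl_vscl rest_vscl sheaf_EndD[OF p] mult.commute)
  assume q: "\<psi> \<in> carrier (sheaf_End F U)"
  show "\<phi> \<oplus>\<^bsub>sheaf_End F U\<^esub> \<psi> \<in> carrier (sheaf_End F U)"
    unfolding ops
  proof (rule sheaf_EndI)
    fix V s t assume V: "siegel_open V" "V \<subseteq> U" and st: "s \<in> sect F V" "t \<in> sect F V"
    note P = sheaf_EndD[OF p V] and Q = sheaf_EndD[OF q V]
    show "vadd F (\<phi> V (vadd F s t)) (\<psi> V (vadd F s t)) = vadd F (vadd F (\<phi> V s) (\<psi> V s)) (vadd F (\<phi> V t) (\<psi> V t))"
      using st P(1) Q(1) vadd_closed[OF V(1)] vadd_left_commute[OF V(1), of "\<phi> V t" "\<psi> V s" "\<psi> V t"]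
      by (simp add: P(2) Q(2) vadd_assoc[OF V(1)])
  next
    fix V W s assume *: "siegel_open V" "V \<subseteq> U" "siegel_open W" "W \<subseteq> V" "s \<in> sect F V"
    show "rest F W (vadd F (\<phi> V s) (\<psi> V s)) = vadd F (\<phi> W (rest F W s)) (\<psi> W (rest F W s))"
      using * by (simp add: rest_vadd[OF *(1,3,4)] sheaf_EndD[OF p *(1,2)] sheaf_EndD[OF q *(1,2)])
  qed (simp_all add: vadd_closed vscl_add_right sheaf_EndD[OF p] sheaf_EndD[OF q])
  show "\<phi> \<otimes>\<^bsub>sheaf_End F U\<^esub> \<psi> \<in> carrier (sheaf_End F U)"
    unfolding ops
  proof (rule sheaf_EndI)
    fix V W s assume *: "siegel_open V" "V \<subseteq> U" "siegel_open W" "W \<subseteq> V" "s \<in> sect F V"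
    show "rest F W (\<phi> V (\<psi> V s)) = \<phi> W (\<psi> W (rest F W s))"
      using * by (simp add: sheaf_EndD[OF p *(1,2)] sheaf_EndD[OF q *(1,2)])
  qed (simp_all add: sheaf_EndD[OF p] sheaf_EndD[OF q])
qed

lemma calgebra_sheaf_End: "calgebra (sheaf_End F U)"
proof -
  let ?E = "sheaf_End F U"
  note eqI = sheaf_End_eqI[where U = U] and c = sheaf_End_closed[where U = U] and a = sheaf_End_apply and D = sheaf_EndD
  have zero: "\<zero>\<^bsub>?E\<^esub> \<oplus>\<^bsub>?E\<^esub> x = x" if x: "x \<in> carrier ?E" for x
    by (rule eqI[OF c(1)[OF c(5) x] x])
      (simp add: a D[OF x] vadd_zero vadd_commute[of _ "vscl F 0 _"] vscl_closed)
  have neg: "(-1) \<odot>\<^bsub>?E\<^esub> x \<oplus>\<^bsub>?E\<^esub> x = \<zero>\<^bsub>?E\<^esub>" if x: "x \<in> carrier ?E" for x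
  proof (rule eqI[OF c(1)[OF c(3)[OF x] x] c(5)])
    fix V s assume V: "siegel_open V" "V \<subseteq> U" and s: "s \<in> sect F V"
    have xs: "x V s \<in> sect F V" using D(1)[OF x V s] .
    have "vadd F (vscl F (-1) (x V s)) (x V s) = vscl F 0 (x V s)"
      using vscl_add_left[OF V(1) xs, of "-1" 1] vscl_one[OF V(1) xs] by simp
    \<comment> \<open>The zero of the algebra is \<open>vscl F 0 s\<close>, with s in place of its
      image under x. Adding the two zero multiples shows that they agree.\<close>
    also have "\<dots> = vadd F (vscl F 0 (x V s)) (vscl F 0 s)"
      using vadd_zero[OF V(1) vscl_closed[OF V(1) xs] s] by simp
    also have "\<dots> = vscl F 0 s"
      using vadd_zero[OF V(1) vscl_closed[OF V(1) s, of 0] xs] vadd_commute[OF V(1) vscl_closed[OF V(1) xs] vscl_closed[OF V(1) s]] by simp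
    finally show "((-1) \<odot>\<^bsub>?E\<^esub> x \<oplus>\<^bsub>?E\<^esub> x) V s = \<zero>\<^bsub>?E\<^esub> V s" using V s by (simp add: a)
  qed
  have "ring ?E"
  proof (rule ringI)
    show "abelian_group ?E"
    proof (rule abelian_groupI)
      fix x y z assume x: "x \<in> carrier ?E" and y: "y \<in> carrier ?E" and z: "z \<in> carrier ?E"
      show "x \<oplus>\<^bsub>?E\<^esub> y \<oplus>\<^bsub>?E\<^esub> z = x \<oplus>\<^bsub>?E\<^esub> (y \<oplus>\<^bsub>?E\<^esub> z)"
        by (rule eqI) (simp_all add: c x y z a vadd_assoc D[OF x] D[OF y] D[OF z])
    next
      fix x y assume x: "x \<in> carrier ?E" and y: "y \<in> carrier ?E"
      show "x \<oplus>\<^bsub>?E\<^esub> y = y \<oplus>\<^bsub>?E\<^esub> x"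
      proof (rule eqI[OF c(1)[OF x y] c(1)[OF y x]])
        fix V s assume V: "siegel_open V" "V \<subseteq> U" and s: "s \<in> sect F V"
        show "(x \<oplus>\<^bsub>?E\<^esub> y) V s = (y \<oplus>\<^bsub>?E\<^esub> x) V s"
          using vadd_commute[OF V(1) D(1)[OF x V s] D(1)[OF y V s]] V s by (simp add: a)
      qed
    next
      fix x assume x: "x \<in> carrier ?E"
      show "\<exists>y\<in>carrier ?E. y \<oplus>\<^bsub>?E\<^esub> x = \<zero>\<^bsub>?E\<^esub>" using neg[OF x] c(3)[OF x] by blast
    qed (simp_all add: c zero)
    show "Group.monoid ?E"
    proof (rule monoidI)
      fix x y z assume x: "x \<in> carrier ?E" and y: "y \<in> carrier ?E" and z: "z \<in> carrier ?E"
      show "x \<otimes>\<^bsub>?E\<^esub> y \<otimes>\<^bsub>?E\<^esub> z = x \<otimes>\<^bsub>?E\<^esub> (y \<otimes>\<^bsub>?E\<^esub> z)"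
        by (rule eqI) (simp_all add: c x y z a D[OF x] D[OF y] D[OF z])
    next
      fix x assume x: "x \<in> carrier ?E"
      show "\<one>\<^bsub>?E\<^esub> \<otimes>\<^bsub>?E\<^esub> x = x" by (rule eqI) (simp_all add: c x a D[OF x])
      show "x \<otimes>\<^bsub>?E\<^esub> \<one>\<^bsub>?E\<^esub> = x" by (rule eqI) (simp_all add: c x a D[OF x])
    qed (simp_all add: c)
    fix x y z assume x: "x \<in> carrier ?E" and y: "y \<in> carrier ?E" and z: "z \<in> carrier ?E"
    show "(x \<oplus>\<^bsub>?E\<^esub> y) \<otimes>\<^bsub>?E\<^esub> z = x \<otimes>\<^bsub>?E\<^esub> z \<oplus>\<^bsub>?E\<^esub> y \<otimes>\<^bsub>?E\<^esub> z"
      by (rule eqI) (simp_all add: c x y z a D[OF x] D[OF y] D[OF z])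
    show "z \<otimes>\<^bsub>?E\<^esub> (x \<oplus>\<^bsub>?E\<^esub> y) = z \<otimes>\<^bsub>?E\<^esub> x \<oplus>\<^bsub>?E\<^esub> z \<otimes>\<^bsub>?E\<^esub> y"
      by (rule eqI) (simp_all add: c x y z a D[OF x] D[OF y] D[OF z])
  qed
  moreover have "calgebra_axioms ?E"
  proof
    fix x assume x: "x \<in> carrier ?E"
    show "c \<odot>\<^bsub>?E\<^esub> x \<in> carrier ?E" for c by (rule c(3)[OF x])
    show "(c + d) \<odot>\<^bsub>?E\<^esub> x = c \<odot>\<^bsub>?E\<^esub> x \<oplus>\<^bsub>?E\<^esub> d \<odot>\<^bsub>?E\<^esub> x" for c d
      by (rule eqI) (simp_all add: c x a D[OF x] vscl_add_left)
    show "c \<odot>\<^bsub>?E\<^esub> (d \<odot>\<^bsub>?E\<^esub> x) = (c * d) \<odot>\<^bsub>?E\<^esub> x" for c d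
      by (rule eqI) (simp_all add: c x a D[OF x] vscl_vscl)
    show "1 \<odot>\<^bsub>?E\<^esub> x = x"
      by (rule eqI) (simp_all add: c x a D[OF x] vscl_one)
    fix y assume y: "y \<in> carrier ?E"
    show "k \<odot>\<^bsub>?E\<^esub> (x \<oplus>\<^bsub>?E\<^esub> y) = k \<odot>\<^bsub>?E\<^esub> x \<oplus>\<^bsub>?E\<^esub> k \<odot>\<^bsub>?E\<^esub> y" for k
      by (rule eqI) (simp_all add: c x y a D[OF x] D[OF y] vscl_add_right)
    show "(k \<odot>\<^bsub>?E\<^esub> x) \<otimes>\<^bsub>?E\<^esub> y = k \<odot>\<^bsub>?E\<^esub> (x \<otimes>\<^bsub>?E\<^esub> y)" for k
      by (rule eqI) (simp_all add: c x y a D[OF x] D[OF y])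
    show "x \<otimes>\<^bsub>?E\<^esub> (k \<odot>\<^bsub>?E\<^esub> y) = k \<odot>\<^bsub>?E\<^esub> (x \<otimes>\<^bsub>?E\<^esub> y)" for k
      by (rule eqI) (simp_all add: c x y a D[OF x] D[OF y])
  qed
  ultimately show ?thesis by (rule calgebra.intro)
qed

text \<open>For products, \<psi> has to map sections to sections: the restricted \<phi> is undefined
  on other arguments.\<close>

lemma sheaf_End_restrict:
  assumes W: "W \<subseteq> U"
  shows "\<phi> \<in> carrier (sheaf_End F U) \<Longrightarrow> on_sect F W \<phi> \<in> carrier (sheaf_End F W)"
    and "on_sect F W (\<phi> \<oplus>\<^bsub>sheaf_End F U\<^esub> \<psi>) = on_sect F W \<phi> \<oplus>\<^bsub>sheaf_End F W\<^esub> on_sect F W \<psi>"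
    and "\<psi> \<in> carrier (sheaf_End F U) \<Longrightarrow> on_sect F W (\<phi> \<otimes>\<^bsub>sheaf_End F U\<^esub> \<psi>) = on_sect F W \<phi> \<otimes>\<^bsub>sheaf_End F W\<^esub> on_sect F W \<psi>"
    and "on_sect F W (c \<odot>\<^bsub>sheaf_End F U\<^esub> \<phi>) = c \<odot>\<^bsub>sheaf_End F W\<^esub> on_sect F W \<phi>"
    and "on_sect F W \<one>\<^bsub>sheaf_End F U\<^esub> = \<one>\<^bsub>sheaf_End F W\<^esub>"
proof -
  have sub: "V \<subseteq> U" if "V \<subseteq> W" for V using that W by blast
  show "on_sect F W \<phi> \<in> carrier (sheaf_End F W)" if p: "\<phi> \<in> carrier (sheaf_End F U)"
    by (rule sheaf_EndI) (simp_all add: sheaf_EndD[OF p] sub)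
  show "on_sect F W (\<phi> \<oplus>\<^bsub>sheaf_End F U\<^esub> \<psi>) = on_sect F W \<phi> \<oplus>\<^bsub>sheaf_End F W\<^esub> on_sect F W \<psi>"
    unfolding sheaf_End_def by (auto intro!: on_sect_eqI simp: on_sect_apply sub)
  show "on_sect F W (\<phi> \<otimes>\<^bsub>sheaf_End F U\<^esub> \<psi>) = on_sect F W \<phi> \<otimes>\<^bsub>sheaf_End F W\<^esub> on_sect F W \<psi>" if q: "\<psi> \<in> carrier (sheaf_End F U)"
    using sheaf_EndD(1)[OF q] unfolding sheaf_End_def by (auto intro!: on_sect_eqI simp: on_sect_apply sub)
  show "on_sect F W (c \<odot>\<^bsub>sheaf_End F U\<^esub> \<phi>) = c \<odot>\<^bsub>sheaf_End F W\<^esub> on_sect F W \<phi>"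
    unfolding sheaf_End_def by (auto intro!: on_sect_eqI simp: on_sect_apply sub)
  show "on_sect F W \<one>\<^bsub>sheaf_End F U\<^esub> = \<one>\<^bsub>sheaf_End F W\<^esub>"
    unfolding sheaf_End_def by (auto intro!: on_sect_eqI simp: on_sect_apply sub)
qed

end

section \<open>Differential operators and the ideal of the super-Laplacian\<close>

lemma sfun_sheaf_ops: "vadd sfun_sheaf f g = f + g" "vscl sfun_sheaf c f = fscl c f"
  by (auto simp: sfun_sheaf_def fun_eq_iff fscl_def)

lemma fscl_zero [simp]: "fscl 0 f = 0" "fscl c 0 = 0" "fscl 1 f = f"
  by (simp_all add: fscl_def fun_eq_iff)

lemma vpresheaf_sfun: "vpresheaf (sfun_sheaf :: ('n::{finite,linorder} cmat, 'n sfun) vsheaf)"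
proof
  fix V W :: "'n cmat set" and s t :: "'n sfun" and c :: complex
  assume V: "siegel_open V" and s: "s \<in> sfuns V"
  interpret M: subspace_module fscl "sfuns V" by (rule subspace_module_sfuns[OF V])
  show "vscl sfun_sheaf c s \<in> sfuns V" using s by (simp add: sfun_sheaf_ops)
  show "vscl sfun_sheaf (c + d) s = vadd sfun_sheaf (vscl sfun_sheaf c s) (vscl sfun_sheaf d s)" for d
    by (simp add: sfun_sheaf_ops M.scale_left_distrib)
  show "vscl sfun_sheaf c (vscl sfun_sheaf d s) = vscl sfun_sheaf (c * d) s" for d
    by (simp add: sfun_sheaf_ops)
  assume W: "siegel_open W" "W \<subseteq> V"
  interpret N: subspace_module fscl "sfuns W" by (rule subspace_module_sfuns[OF W(1)])
  show "rest sfun_sheaf W s \<in> sfuns W"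
    unfolding rest_sfun
  proof (rule sfunsI)
    show "holo_on W (\<lambda>v. (if v \<in> W then s v else 0) A)" for A
      by (rule holo_on_cong[OF W(1) _ holo_on_subset[OF sfuns_holo[OF s] W(2)]]) simp
  qed simp
qed (auto simp: sfun_sheaf_ops rest_sfun fun_eq_iff fscl_def algebra_simps,
    auto simp: subspace_module.S_closed[OF subspace_module_sfuns])

interpretation O: vpresheaf sfun_sheaf
  by (rule vpresheaf_sfun)

interpretation OA: calgebra "oper_alg U" for U :: "'n::{finite,linorder} cmat set"
  by (rule O.calgebra_sheaf_End)

lemma oper_apply:
  assumes "siegel_open V" "V \<subseteq> U" "f \<in> sfuns V"
  shows "(P \<oplus>\<^bsub>oper_alg U\<^esub> Q) V f = P V f + Q V f"
    and "(P \<otimes>\<^bsub>oper_alg U\<^esub> Q) V f = P V (Q V f)"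
    and "(c \<odot>\<^bsub>oper_alg U\<^esub> P) V f = fscl c (P V f)"
    and "\<one>\<^bsub>oper_alg U\<^esub> V f = f"
    and "\<zero>\<^bsub>oper_alg U\<^esub> V f = 0"
  using O.sheaf_End_apply[OF assms] by (simp_all add: sfun_sheaf_ops)

lemma oper_minus_apply:
  assumes "siegel_open V" "V \<subseteq> U" "f \<in> sfuns V" "P \<in> carrier (oper_alg U)" "Q \<in> carrier (oper_alg U)"
  shows "(P \<ominus>\<^bsub>oper_alg U\<^esub> Q) V f = P V f - Q V f"
  using assms by (simp add: OA.minus_eq_smult oper_apply) (simp add: fscl_def fun_eq_iff)

lemma oper_finsum_apply:
  assumes "siegel_open V" "V \<subseteq> U" "f \<in> sfuns V" "finite I" "\<And>i. i \<in> I \<Longrightarrow> P i \<in> carrier (oper_alg U)"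
  shows "finsum (oper_alg U) P I V f = (\<Sum>i\<in>I. P i V f)"
  using assms(4,5)
proof (induction I)
  case (insert i I)
  then have "P \<in> I \<rightarrow> carrier (oper_alg U)" "P i \<in> carrier (oper_alg U)" by auto
  with insert show ?case using assms(1-3) by (simp add: oper_apply)
qed (use assms(1-3) in \<open>simp add: oper_apply\<close>)

lemma oper_lin:
  assumes "P \<in> carrier (oper_alg U)" "siegel_open V" "V \<subseteq> U"
  shows "f \<in> sfuns V \<Longrightarrow> P V f \<in> sfuns V" "f \<in> sfuns V \<Longrightarrow> g \<in> sfuns V \<Longrightarrow> P V (f + g) = P V f + P V g"
    "f \<in> sfuns V \<Longrightarrow> P V (fscl c f) = fscl c (P V f)"
  using O.sheaf_EndD[OF assms] by (simp_all add: sfun_sheaf_ops)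

lemmas oper_eqI = O.sheaf_End_eqI

text \<open>Sections vanish outside their domain, so compatibility with restriction is to be tested
  only at points of the smaller set.\<close>

lemma oper_carrierI:
  fixes \<phi> :: "'n::{finite,linorder} oper"
  assumes lin: "\<And>V. siegel_open V \<Longrightarrow> V \<subseteq> U \<Longrightarrow> \<phi> V \<in> {F. (\<forall>f\<in>sfuns V. F f \<in> sfuns V) \<and> (\<forall>f\<in>sfuns V. \<forall>g\<in>sfuns V. F (f + g) = F f + F g) \<and>
      (\<forall>c. \<forall>f\<in>sfuns V. F (fscl c f) = fscl c (F f))}"
    and res: "\<And>V W f v. siegel_open V \<Longrightarrow> V \<subseteq> U \<Longrightarrow> siegel_open W \<Longrightarrow> W \<subseteq> V \<Longrightarrow> f \<in> sfuns V \<Longrightarrow> v \<in> W \<Longrightarrow>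
      \<phi> V f v = \<phi> W (rest sfun_sheaf W f) v"
  shows "oper_on U \<phi> \<in> carrier (oper_alg U)"
proof (rule O.sheaf_EndI)
  fix V W :: "'n cmat set" and f assume *: "siegel_open V" "V \<subseteq> U" "siegel_open W" "W \<subseteq> V" "f \<in> sfuns V"
  have "\<phi> W (rest sfun_sheaf W f) \<in> sfuns W"
    using lin[of W] O.rest_closed[OF *(1,3,4,5)] *(2,3,4) by auto
  then show "rest sfun_sheaf W (\<phi> V f) = \<phi> W (rest sfun_sheaf W f)"
    unfolding rest_sfun[of W "\<phi> V f"] using res[OF *] sfuns_outside[of "\<phi> W (rest sfun_sheaf W f)" W]
    by (intro ext[of "\<lambda>v. if v \<in> W then \<phi> V f v else 0"]) (simp split: if_splits)
qed (use lin in \<open>auto simp: sfun_sheaf_ops\<close>)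

section \<open>Spinor derivatives, multiplications and the operators of E as sheaf
  endomorphisms\<close>

context
  fixes U :: "'n::{finite,linorder} cmat set"
  assumes U: "siegel_open U"
begin

lemma mult_op_carrier:
  assumes g: "\<And>A. holo_on U (\<lambda>v. g v A)"
  shows "mult_op U g \<in> carrier (oper_alg U)"
  unfolding mult_op_def
proof (rule oper_carrierI)
  fix V assume V: "siegel_open V" "V \<subseteq> U"
  have "(\<lambda>v. gmul (g v) (f v)) \<in> sfuns V" if "f \<in> sfuns V" for f
    by (rule sfuns_gmul[OF V(1) holo_on_subset[OF g V(2)] that])
  then show "(\<lambda>f v. gmul (g v) (f v)) \<in> {F. (\<forall>f\<in>sfuns V. F f \<in> sfuns V) \<and> (\<forall>f\<in>sfuns V. \<forall>g\<in>sfuns V. F (f + g) = F f + F g) \<and>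
      (\<forall>c. \<forall>f\<in>sfuns V. F (fscl c f) = fscl c (F f))}"
    by (auto simp: fun_eq_iff fscl_apply gmul_add_right gmul_scl_right)
qed (simp add: rest_sfun)

lemma mult_op_apply:
  "siegel_open V \<Longrightarrow> V \<subseteq> U \<Longrightarrow> f \<in> sfuns V \<Longrightarrow> mult_op U g V f = (\<lambda>v. gmul (g v) (f v))"
  by (simp add: mult_op_def on_sect_apply)

lemma mult_op_xi: "mult_op U (xi_fun i) \<in> carrier (oper_alg U)"
  "siegel_open V \<Longrightarrow> V \<subseteq> U \<Longrightarrow> f \<in> sfuns V \<Longrightarrow> mult_op U (xi_fun i) V f = sX i f"
  by (rule mult_op_carrier) (simp_all add: xi_fun_def holo_on_const[OF U] mult_op_apply sX_def)

lemma mult_op_t: "mult_op U (t_fun i j) \<in> carrier (oper_alg U)"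
  "siegel_open V \<Longrightarrow> V \<subseteq> U \<Longrightarrow> f \<in> sfuns V \<Longrightarrow> mult_op U (t_fun i j) V f = sT i j f"
  by (rule mult_op_carrier) (simp_all add: holo_t_fun[OF U] mult_op_apply sT_def)

lemma spinor_apply: "siegel_open V \<Longrightarrow> V \<subseteq> U \<Longrightarrow> f \<in> sfuns V \<Longrightarrow> spinor U i V f = sD V i f"
  by (simp add: spinor_def on_sect_apply sD_def)

lemma spinor_carrier: "spinor U i \<in> carrier (oper_alg U)"
  unfolding spinor_def
proof (rule oper_carrierI)
  fix V assume V: "siegel_open V" "V \<subseteq> U"
  interpret SM: spinor_module fscl "sfuns V" "sD V" sX sT by (rule spinor_module_sfuns[OF V(1)])
  show "(\<lambda>f. rest sfun_sheaf V (spinor_fun i f)) \<in> {F. (\<forall>f\<in>sfuns V. F f \<in> sfuns V) \<and> (\<forall>f\<in>sfuns V. \<forall>g\<in>sfuns V. F (f + g) = F f + F g) \<and>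
      (\<forall>c. \<forall>f\<in>sfuns V. F (fscl c f) = fscl c (F f))}"
    using SM.lin_D[of i] unfolding SM.lin_def sD_def by blast
next
  fix V W f v assume *: "siegel_open V" "V \<subseteq> U" "siegel_open W" "W \<subseteq> V" "f \<in> sfuns V" "v \<in> W"
  have "spinor_fun i f v = spinor_fun i (rest sfun_sheaf W f) v"
    by (rule sD_cong[OF *(1,3,4,6)]) (simp add: rest_sfun)
  then show "rest sfun_sheaf V (spinor_fun i f) v = rest sfun_sheaf W (spinor_fun i (rest sfun_sheaf W f)) v"
    using * by (auto simp: rest_sfun[of V "spinor_fun i f"] rest_sfun[of W "spinor_fun i _"])
qed

lemma super_lap_carrier: "super_lap U i j \<in> carrier (oper_alg U)"
  by (simp add: super_lap_def spinor_carrier)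

lemma D_q_carrier: "D_q U i \<in> carrier (oper_alg U)"
  by (simp add: D_q_def spinor_carrier mult_op_t mult_op_xi Pi_def)

lemma D_half_carrier: "D_half U y \<in> carrier (oper_alg U)"
  by (simp add: D_half_def spinor_carrier D_q_carrier Pi_def)

context
  fixes V assumes V: "siegel_open V" "V \<subseteq> U"
begin

interpretation SM: spinor_module fscl "sfuns V" "sD V" sX sT by (rule spinor_module_sfuns[OF V(1)])

lemma super_lap_apply: "f \<in> sfuns V \<Longrightarrow> super_lap U i j V f = SM.Lap i j f"
  using V by (simp add: super_lap_def oper_minus_apply spinor_carrier oper_apply spinor_apply SM.Lap_def SM.lin_closed[OF SM.lin_D])

lemma D_q_apply: "f \<in> sfuns V \<Longrightarrow> D_q U i V f = SM.Q i f"
  using V by (simp add: D_q_def oper_minus_apply oper_finsum_apply spinor_carrier mult_op_t mult_op_xi Pi_def oper_apply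
      spinor_apply SM.Q_def SM.lin_closed[OF SM.lin_D])

lemma D_half_apply: "f \<in> sfuns V \<Longrightarrow> D_half U y V f = SM.Dh y f"
  using V by (simp add: D_half_def oper_finsum_apply spinor_carrier D_q_carrier oper_apply spinor_apply D_q_apply SM.Dh_def sum.distrib)

end

end

lemma oper_on_ops:
  fixes U :: "'n::{finite,linorder} cmat set"
  assumes U: "siegel_open U" and W: "siegel_open W" "W \<subseteq> U"
  shows oper_on_super_lap: "oper_on W (super_lap U i j) = super_lap W i j"
    and oper_on_D_half: "oper_on W (D_half U y) = D_half W y"
proof -
  note eqI = oper_eqI[where U = W]
  have sub: "V \<subseteq> U" if "V \<subseteq> W" for V using that W by blast
  show "oper_on W (super_lap U i j) = super_lap W i j"
    by (rule eqI[OF O.sheaf_End_restrict(1)[OF W(2) super_lap_carrier[OF U]] super_lap_carrier[OF W(1)]])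
      (simp add: on_sect_apply super_lap_apply[OF U _ sub] super_lap_apply[OF W(1)])
  show "oper_on W (D_half U y) = D_half W y"
    by (rule eqI[OF O.sheaf_End_restrict(1)[OF W(2) D_half_carrier[OF U]] D_half_carrier[OF W(1)]])
      (simp add: on_sect_apply D_half_apply[OF U _ sub] D_half_apply[OF W(1)])
qed

section \<open>Membership in the sheaf of differential operators\<close>

lemma gpar_parity: "has_parity q f \<Longrightarrow> gpar (f v) = (if q then - f v else f v)"
  unfolding has_parity_def gpar_def fun_eq_iff by (auto simp: fun_eq_iff) (metis neg_one_even_power neg_one_odd_power mult_1 mult_minus1 mult_zero_right)+

text \<open>This places the spinor derivatives among the generators of the differential operators.
  On a function of parity q the sign \<open>gpar\<close> of the product rule is the Leibniz sign of
  an odd derivation.\<close>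

lemma spinor_vector_field:
  fixes U :: "'n::{finite,linorder} cmat set"
  assumes U: "siegel_open U" shows "spinor U i \<in> vector_fields U True"
  unfolding vector_fields_def
proof (intro CollectI conjI allI impI ballI)
  show "spinor U i \<in> carrier (oper_alg U)" by (rule spinor_carrier[OF U])
  fix V q f assume V: "siegel_open V" "V \<subseteq> U" and f: "f \<in> sfuns V" and q: "has_parity q f"
  interpret W: super_weyl fscl "sfuns V" s_d sX "s_dt V" by (rule super_weyl_sfuns[OF V(1)])
  note app = spinor_apply[OF U V]
  have par: "odd (card B) = q" if "f v B \<noteq> 0" for v B using q that by (auto simp: has_parity_def)
  have parA: "f v B = 0" if "odd (card B) \<noteq> q" for v B using par that by blast
  show "has_parity (True \<noteq> q) (spinor U i V f)"
    unfolding has_parity_def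
  proof (intro allI impI)
    fix v A assume nz: "spinor U i V f v A \<noteq> 0"
    show "odd (card A) = (True \<noteq> q)"
    proof (rule ccontr)
      assume c: "odd (card A) \<noteq> (True \<noteq> q)"
      have 1: "d_xi i (f v) A = 0" using c by (auto simp: d_xi_def intro!: parA)
      have 2: "gmul (gxi j) (d_t i j f v) A = 0" for j
      proof (cases "j \<in> A")
        case True
        then have "odd (card (A - {j})) \<noteq> q" using c by (auto simp: card_Diff_singleton_if)
        \<comment> \<open>Removing j flips the parity of the index set, so this coefficient vanishes
          identically and not just at v; hence its derivative vanishes too.\<close>
        then have "(\<lambda>v. f v (A - {j})) = (\<lambda>v. 0)" using parA by (simp add: fun_eq_iff)
        then have "d_t i j f v (A - {j}) = 0" unfolding d_t_eq by (simp add: dsym_const[OF U])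
        then show ?thesis by (simp add: gmul_gxi)
      qed (simp add: gmul_gxi)
      have "spinor U i V f v A = 0"
        unfolding app[OF f] by (simp add: sD_def rest_sfun spinor_fun_def 1 2)
      then show False using nz by simp
    qed
  qed
  fix g assume g: "g \<in> sfuns V"
  have fg: "(\<lambda>v. gmul (f v) (g v)) \<in> sfuns V" by (rule sfuns_gmul[OF V(1) sfuns_holo[OF f] g])
  show "spinor U i V (\<lambda>v. gmul (f v) (g v)) =
      (\<lambda>v A. gmul (spinor U i V f v) (g v) A + (if True \<and> q then - 1 else 1) * gmul (f v) (spinor U i V g v) A)"
    unfolding app[OF f] app[OF g] app[OF fg]
    by (intro ext) (simp add: sD_gmul[OF V(1) f g] gpar_parity[OF q] gmul_uminus)
qed

lemma siegel_open_Int: "siegel_open U \<Longrightarrow> siegel_open W \<Longrightarrow> siegel_open (U \<inter> W)"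
  by (rule openin_Int)

lemma oper_on_vector_field:
  fixes U :: "'n::{finite,linorder} cmat set"
  assumes W: "W \<subseteq> U" and X: "X \<in> vector_fields U p" shows "oper_on W X \<in> vector_fields W p"
  unfolding vector_fields_def
proof (intro CollectI conjI allI impI ballI)
  show "oper_on W X \<in> carrier (oper_alg W)"
    using X O.sheaf_End_restrict(1)[OF W] by (simp add: vector_fields_def)
  fix V q f assume V: "siegel_open V" "V \<subseteq> W" and f: "f \<in> sfuns V" and q: "has_parity q f"
  have VU: "V \<subseteq> U" using V W by blast
  show "has_parity (p \<noteq> q) (oper_on W X V f)"
    using X V VU f q unfolding vector_fields_def by (simp add: on_sect_apply)
  fix g assume g: "g \<in> sfuns V"
  have fg: "(\<lambda>v. gmul (f v) (g v)) \<in> sfuns V" by (rule sfuns_gmul[OF V(1) sfuns_holo[OF f] g])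
  show "oper_on W X V (\<lambda>v. gmul (f v) (g v)) =
      (\<lambda>v A. gmul (oper_on W X V f v) (g v) A + (if p \<and> q then - 1 else 1) * gmul (f v) (oper_on W X V g v) A)"
    unfolding on_sect_apply[OF V f] on_sect_apply[OF V g] on_sect_apply[OF V fg]
    using X V VU f g q unfolding vector_fields_def by blast
qed

context
  fixes U :: "'n::{finite,linorder} cmat set"
  assumes U: "siegel_open U"
begin

lemma diff_gen_carrier: "P \<in> diff_gen U \<Longrightarrow> P \<in> carrier (oper_alg U)"
proof (induction rule: diff_gen.induct)
  case (fn g)
  then show ?case by (intro mult_op_carrier[OF U] sfuns_holo)
qed (simp_all add: vector_fields_def)

lemma diff_ops_carrier: "P \<in> diff_ops U \<Longrightarrow> P \<in> carrier (oper_alg U)"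
  by (simp add: diff_ops_def)

lemma diff_gen_restrict:
  assumes W: "siegel_open W" "W \<subseteq> U"
  shows "P \<in> diff_gen U \<Longrightarrow> oper_on W P \<in> diff_gen W"
proof (induction rule: diff_gen.induct)
  case (fn g)
  \<comment> \<open>A generator over W must come from a section over W, so g is cut off. The
    multiplication is the same, as its arguments vanish outside their own smaller domains.\<close>
  have "oper_on W (mult_op U g) = mult_op W (rest sfun_sheaf W g)"
    unfolding mult_op_def on_sect_on_sect[OF W(2)]
  proof (rule on_sect_eqI, rule ext)
    fix V f v assume V: "siegel_open V" "V \<subseteq> W" "f \<in> sfuns V"
    show "gmul (g v) (f v) = gmul (rest sfun_sheaf W g v) (f v)"
      using V(2) sfuns_outside[OF V(3), of v] by (cases "v \<in> V") (auto simp: rest_sfun)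
  qed
  then show ?case using diff_gen.fn[OF O.rest_closed[OF U W fn]] by simp
next
  case (vf X p)
  then show ?case by (intro diff_gen.vf oper_on_vector_field[OF W(2)])
next
  case (add P Q)
  then show ?case by (simp add: O.sheaf_End_restrict(2)[OF W(2)] diff_gen.add)
next
  case (mult P Q)
  then show ?case by (simp add: O.sheaf_End_restrict(3)[OF W(2)] diff_gen_carrier diff_gen.mult)
qed

lemma diff_ops_gen: "P \<in> diff_gen U \<Longrightarrow> P \<in> diff_ops U"
  using diff_gen_carrier[of P] U by (auto simp: diff_ops_def O.sheaf_End_normal intro!: exI[of _ U])

lemma diff_ops_local:
  assumes "P \<in> diff_ops U" "x \<in> U"
  obtains W where "siegel_open W" "x \<in> W" "W \<subseteq> U" "oper_on W P \<in> diff_gen W"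
  using assms unfolding diff_ops_def by blast

end

lemma diff_ops_restrict:
  fixes U :: "'n::{finite,linorder} cmat set"
  assumes U: "siegel_open U" and W: "siegel_open W" "W \<subseteq> U" and P: "P \<in> diff_ops U"
  shows "oper_on W P \<in> diff_ops W"
  unfolding diff_ops_def
proof (intro CollectI conjI ballI)
  show "oper_on W P \<in> carrier (oper_alg W)"
    by (rule O.sheaf_End_restrict(1)[OF W(2) diff_ops_carrier[OF U P]])
  fix x assume x: "x \<in> W"
  obtain N where N: "siegel_open N" "x \<in> N" "N \<subseteq> U" "oper_on N P \<in> diff_gen N"
    using diff_ops_local[OF U P] x W(2) by blast
  have WN: "siegel_open (W \<inter> N)" by (rule siegel_open_Int[OF W(1) N(1)])
  have "oper_on (W \<inter> N) (oper_on N P) \<in> diff_gen (W \<inter> N)"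
    by (rule diff_gen_restrict[OF N(1) WN _ N(4)]) simp
  then have "oper_on (W \<inter> N) (oper_on W P) \<in> diff_gen (W \<inter> N)"
    by (simp add: on_sect_on_sect)
  then show "\<exists>N. siegel_open N \<and> x \<in> N \<and> N \<subseteq> W \<and> oper_on N (oper_on W P) \<in> diff_gen N"
    using WN x N(2) by (intro exI[of _ "W \<inter> N"]) auto
qed

context
  fixes U :: "'n::{finite,linorder} cmat set"
  assumes U: "siegel_open U"
begin

lemma diff_ops_common:
  assumes "P \<in> diff_ops U" "Q \<in> diff_ops U" "x \<in> U"
  obtains W where "siegel_open W" "x \<in> W" "W \<subseteq> U" "oper_on W P \<in> diff_gen W" "oper_on W Q \<in> diff_gen W"
proof -
  obtain N where N: "siegel_open N" "x \<in> N" "N \<subseteq> U" "oper_on N P \<in> diff_gen N"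
    using diff_ops_local[OF U assms(1,3)] by blast
  obtain W where W: "siegel_open W" "x \<in> W" "W \<subseteq> N" "oper_on W (oper_on N Q) \<in> diff_gen W"
    using diff_ops_local[OF N(1) diff_ops_restrict[OF U N(1,3) assms(2)] N(2)] by blast
  have "oper_on W (oper_on N P) \<in> diff_gen W" by (rule diff_gen_restrict[OF N(1) W(1,3) N(4)])
  then show thesis using that[OF W(1,2)] W(3,4) N(3) by (simp add: on_sect_on_sect[OF W(3)])
qed

lemma diff_ops_add: "P \<in> diff_ops U \<Longrightarrow> Q \<in> diff_ops U \<Longrightarrow> P \<oplus>\<^bsub>oper_alg U\<^esub> Q \<in> diff_ops U"
  and diff_ops_mult: "P \<in> diff_ops U \<Longrightarrow> Q \<in> diff_ops U \<Longrightarrow> P \<otimes>\<^bsub>oper_alg U\<^esub> Q \<in> diff_ops U"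
proof -
  assume PQ: "P \<in> diff_ops U" "Q \<in> diff_ops U"
  note car = PQ[THEN diff_ops_carrier[OF U]]
  have loc: "\<exists>W. siegel_open W \<and> x \<in> W \<and> W \<subseteq> U \<and> oper_on W (P \<oplus>\<^bsub>oper_alg U\<^esub> Q) \<in> diff_gen W"
    "\<exists>W. siegel_open W \<and> x \<in> W \<and> W \<subseteq> U \<and> oper_on W (P \<otimes>\<^bsub>oper_alg U\<^esub> Q) \<in> diff_gen W" if x: "x \<in> U" for x
  proof -
    obtain W where W: "siegel_open W" "x \<in> W" "W \<subseteq> U" "oper_on W P \<in> diff_gen W" "oper_on W Q \<in> diff_gen W"
      using diff_ops_common[OF PQ x] by blast
    show "\<exists>W. siegel_open W \<and> x \<in> W \<and> W \<subseteq> U \<and> oper_on W (P \<oplus>\<^bsub>oper_alg U\<^esub> Q) \<in> diff_gen W"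
      using W diff_gen.add[OF W(4,5)] by (intro exI[of _ W]) (simp add: O.sheaf_End_restrict(2)[OF W(3)])
    show "\<exists>W. siegel_open W \<and> x \<in> W \<and> W \<subseteq> U \<and> oper_on W (P \<otimes>\<^bsub>oper_alg U\<^esub> Q) \<in> diff_gen W"
      using W diff_gen.mult[OF W(4,5)] by (intro exI[of _ W]) (simp add: O.sheaf_End_restrict(3)[OF W(3) car(2)])
  qed
  show "P \<oplus>\<^bsub>oper_alg U\<^esub> Q \<in> diff_ops U" "P \<otimes>\<^bsub>oper_alg U\<^esub> Q \<in> diff_ops U"
    using loc car unfolding diff_ops_def by auto
qed

lemma diff_ops_mult_op: "g \<in> sfuns U \<Longrightarrow> mult_op U g \<in> diff_ops U"
  by (intro diff_ops_gen[OF U] diff_gen.fn)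

lemma mult_op_rest: "mult_op U (rest sfun_sheaf U g) = mult_op U g"
  unfolding mult_op_def
proof (rule on_sect_eqI, rule ext)
  fix V f v assume V: "siegel_open V" "V \<subseteq> U" "f \<in> sfuns V"
  show "gmul (rest sfun_sheaf U g v) (f v) = gmul (g v) (f v)"
    using V(2) sfuns_outside[OF V(3), of v] by (cases "v \<in> V") (auto simp: rest_sfun)
qed

lemma sfuns_rest_const: "rest sfun_sheaf U (\<lambda>v. a) \<in> sfuns U"
  unfolding rest_sfun
proof (rule sfunsI)
  show "holo_on U (\<lambda>v. (if v \<in> U then a else 0) A)" for A
    by (rule holo_on_cong[OF U _ holo_on_const[OF U, of "a A"]]) simp
qed simp

lemma diff_ops_xi: "mult_op U (xi_fun i) \<in> diff_ops U"
  unfolding xi_fun_def by (subst mult_op_rest[symmetric]) (rule diff_ops_mult_op[OF sfuns_rest_const])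

lemma diff_ops_t: "mult_op U (t_fun i j) \<in> diff_ops U"
  by (subst mult_op_rest[symmetric]) (rule diff_ops_mult_op[OF sfuns_rest_t[OF U]])

lemma diff_ops_spinor: "spinor U i \<in> diff_ops U"
  by (rule diff_ops_gen[OF U diff_gen.vf[OF spinor_vector_field[OF U]]])

text \<open>A scalar multiple is the product with a constant superfunction, which is one of the
  generators of the differential operators.\<close>

lemma diff_ops_smult: assumes P: "P \<in> diff_ops U" shows "c \<odot>\<^bsub>oper_alg U\<^esub> P \<in> diff_ops U"
proof -
  let ?m = "mult_op U (\<lambda>v. gscl c gone)"
  have m: "?m \<in> diff_ops U" by (subst mult_op_rest[symmetric]) (rule diff_ops_mult_op[OF sfuns_rest_const])
  have "?m \<otimes>\<^bsub>oper_alg U\<^esub> P = c \<odot>\<^bsub>oper_alg U\<^esub> P"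
  proof (rule oper_eqI[where U = U])
    fix V f assume V: "siegel_open V" "V \<subseteq> U" "f \<in> sfuns V"
    show "(?m \<otimes>\<^bsub>oper_alg U\<^esub> P) V f = (c \<odot>\<^bsub>oper_alg U\<^esub> P) V f"
      using oper_lin(1)[OF diff_ops_carrier[OF U P] V(1,2,3)] V
      by (simp add: oper_apply mult_op_apply[OF U] gmul_scl_left) (simp add: fscl_def gscl_def)
  qed (simp_all add: diff_ops_carrier[OF U] m P)
  then show ?thesis using diff_ops_mult[OF m P] by simp
qed

lemma diff_ops_one: "\<one>\<^bsub>oper_alg U\<^esub> \<in> diff_ops U"
proof -
  have "\<one>\<^bsub>oper_alg U\<^esub> = mult_op U (\<lambda>v. gone)"
    by (rule oper_eqI[where U = U]) (simp_all add: mult_op_carrier[OF U] holo_on_const[OF U] oper_apply mult_op_apply[OF U])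
  then show ?thesis by (metis mult_op_rest diff_ops_mult_op[OF sfuns_rest_const])
qed

lemma diff_ops_zero: "\<zero>\<^bsub>oper_alg U\<^esub> \<in> diff_ops U"
  using diff_ops_smult[OF diff_ops_one, of 0] by simp

lemma diff_ops_minus: "P \<in> diff_ops U \<Longrightarrow> Q \<in> diff_ops U \<Longrightarrow> P \<ominus>\<^bsub>oper_alg U\<^esub> Q \<in> diff_ops U"
  by (simp add: OA.minus_eq_smult diff_ops_carrier[OF U] diff_ops_add diff_ops_smult)

lemma diff_ops_finsum: "finite I \<Longrightarrow> (\<And>i. i \<in> I \<Longrightarrow> P i \<in> diff_ops U) \<Longrightarrow> finsum (oper_alg U) P I \<in> diff_ops U"
  by (induction I rule: finite_induct)
    (simp_all add: diff_ops_zero diff_ops_add diff_ops_carrier[OF U] Pi_def)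

lemma diff_ops_D_half: "D_half U y \<in> diff_ops U"
  by (simp add: D_half_def D_q_def diff_ops_finsum diff_ops_minus diff_ops_mult diff_ops_spinor diff_ops_add diff_ops_smult
      diff_ops_t diff_ops_xi)

section \<open>The left ideal generated by the super-Laplacian\<close>

lemma finite_pairs [simp]: "finite {(i, j). i < (j :: 'n)}"
  by (rule finite_subset[of _ UNIV]) auto

lemma lap_idealE:
  assumes "P \<in> lap_ideal U"
  obtains Q where "\<And>i j. Q i j \<in> diff_ops U"
    "P = finsum (oper_alg U) (\<lambda>p. Q (fst p) (snd p) \<otimes>\<^bsub>oper_alg U\<^esub> super_lap U (fst p) (snd p)) {(i, j). i < j}"
  using assms unfolding lap_ideal_def case_prod_beta' by blast

lemma lap_idealI:
  assumes "\<And>i j. Q i j \<in> diff_ops U"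
  shows "finsum (oper_alg U) (\<lambda>p. Q (fst p) (snd p) \<otimes>\<^bsub>oper_alg U\<^esub> super_lap U (fst p) (snd p)) {(i, j). i < j} \<in> lap_ideal U"
  using assms unfolding lap_ideal_def case_prod_beta' by blast

lemma lap_ideal_carrier: assumes "P \<in> lap_ideal U" shows "P \<in> carrier (oper_alg U)"
proof -
  obtain Q where Q: "\<And>i j. Q i j \<in> diff_ops U"
    "P = finsum (oper_alg U) (\<lambda>p. Q (fst p) (snd p) \<otimes>\<^bsub>oper_alg U\<^esub> super_lap U (fst p) (snd p)) {(i, j). i < j}"
    using lap_idealE[OF assms] by blast
  show ?thesis unfolding Q(2) by (simp add: Q(1) diff_ops_carrier[OF U] super_lap_carrier[OF U] Pi_def)
qed

lemma lap_ideal_add: assumes "P \<in> lap_ideal U" "P' \<in> lap_ideal U" shows "P \<oplus>\<^bsub>oper_alg U\<^esub> P' \<in> lap_ideal U"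
proof -
  note c = diff_ops_carrier[OF U] super_lap_carrier[OF U]
  obtain Q where Q: "\<And>i j. Q i j \<in> diff_ops U"
    "P = finsum (oper_alg U) (\<lambda>p. Q (fst p) (snd p) \<otimes>\<^bsub>oper_alg U\<^esub> super_lap U (fst p) (snd p)) {(i, j). i < j}"
    using lap_idealE[OF assms(1)] by blast
  obtain Q' where Q': "\<And>i j. Q' i j \<in> diff_ops U"
    "P' = finsum (oper_alg U) (\<lambda>p. Q' (fst p) (snd p) \<otimes>\<^bsub>oper_alg U\<^esub> super_lap U (fst p) (snd p)) {(i, j). i < j}"
    using lap_idealE[OF assms(2)] by blast
  have "P \<oplus>\<^bsub>oper_alg U\<^esub> P' = finsum (oper_alg U) (\<lambda>p. (Q (fst p) (snd p) \<oplus>\<^bsub>oper_alg U\<^esub> Q' (fst p) (snd p)) \<otimes>\<^bsub>oper_alg U\<^esub> super_lap U (fst p) (snd p)) {(i, j). i < j}"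
    unfolding Q(2) Q'(2) by (simp add: OA.l_distr c Q(1) Q'(1) Pi_def OA.finsum_addf)
  then show ?thesis
    using lap_idealI[of "\<lambda>i j. Q i j \<oplus>\<^bsub>oper_alg U\<^esub> Q' i j"] Q(1) Q'(1) by (simp add: diff_ops_add)
qed

lemma lap_ideal_lmult: assumes R: "R \<in> diff_ops U" and "P \<in> lap_ideal U" shows "R \<otimes>\<^bsub>oper_alg U\<^esub> P \<in> lap_ideal U"
proof -
  note c = diff_ops_carrier[OF U] super_lap_carrier[OF U]
  obtain Q where Q: "\<And>i j. Q i j \<in> diff_ops U"
    "P = finsum (oper_alg U) (\<lambda>p. Q (fst p) (snd p) \<otimes>\<^bsub>oper_alg U\<^esub> super_lap U (fst p) (snd p)) {(i, j). i < j}"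
    using lap_idealE[OF assms(2)] by blast
  have "R \<otimes>\<^bsub>oper_alg U\<^esub> P = finsum (oper_alg U) (\<lambda>p. (R \<otimes>\<^bsub>oper_alg U\<^esub> Q (fst p) (snd p)) \<otimes>\<^bsub>oper_alg U\<^esub> super_lap U (fst p) (snd p)) {(i, j). i < j}"
    unfolding Q(2) by (subst OA.finsum_rdistr) (simp_all add: OA.m_assoc c Q(1) R Pi_def)
  then show ?thesis
    using lap_idealI[of "\<lambda>i j. R \<otimes>\<^bsub>oper_alg U\<^esub> Q i j"] Q(1) R by (simp add: diff_ops_mult)
qed

lemma lap_ideal_smult: assumes "P \<in> lap_ideal U" shows "c \<odot>\<^bsub>oper_alg U\<^esub> P \<in> lap_ideal U"
  using lap_ideal_lmult[OF diff_ops_smult[OF diff_ops_one, of c] assms] lap_ideal_carrier[OF assms]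
  by (simp add: OA.smult_mult_left)

text \<open>For i < j this takes a coefficient function that is one at a single pair. The components
  with i > j are negatives of generators and those with i = j are zero.\<close>

lemma lap_ideal_super_lap: "super_lap U i j \<in> lap_ideal U"
proof -
  have less: "super_lap U i j \<in> lap_ideal U" if ij: "i < j" for i j
  proof -
    let ?Q = "\<lambda>a b. if (a, b) = (i, j) then \<one>\<^bsub>oper_alg U\<^esub> else \<zero>\<^bsub>oper_alg U\<^esub>"
    have Q: "?Q a b \<in> diff_ops U" for a b by (simp add: diff_ops_one diff_ops_zero)
    have "finsum (oper_alg U) (\<lambda>p. ?Q (fst p) (snd p) \<otimes>\<^bsub>oper_alg U\<^esub> super_lap U (fst p) (snd p)) {(i, j). i < j} =
        finsum (oper_alg U) (\<lambda>p. if (i, j) = p then super_lap U (fst p) (snd p) else \<zero>\<^bsub>oper_alg U\<^esub>) {(i, j). i < j}"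
      by (intro OA.add.finprod_cong') (auto simp: super_lap_carrier[OF U])
    also have "\<dots> = super_lap U i j"
      using OA.add.finprod_singleton[where i = "(i, j)" and A = "{(i, j). i < j}" and U = U and f = "\<lambda>p. super_lap U (fst p) (snd p)"] ij
      by (simp add: super_lap_carrier[OF U] Pi_def)
    finally show ?thesis using lap_idealI[of ?Q, OF Q] by simp
  qed
  consider "i < j" | "j < i" | "i = j" by (meson linorder_neqE)
  then show ?thesis
  proof cases
    case 2
    have "super_lap U i j = (-1) \<odot>\<^bsub>oper_alg U\<^esub> super_lap U j i"
      by (simp add: super_lap_def OA.minus_eq_smult OA.smult_add_right OA.smult_smult spinor_carrier[OF U] OA.a_comm)
    then show ?thesis using lap_ideal_smult[OF less[OF 2]] by simp
  next
    case 3
    then have "super_lap U i j = 0 \<odot>\<^bsub>oper_alg U\<^esub> super_lap U i j"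
      using super_lap_carrier[OF U, of i j] by (simp add: super_lap_def OA.minus_eq_zero_iff spinor_carrier[OF U])
    moreover have "\<zero>\<^bsub>oper_alg U\<^esub> \<in> lap_ideal U"
    proof -
      have "finsum (oper_alg U) (\<lambda>p. \<zero>\<^bsub>oper_alg U\<^esub> \<otimes>\<^bsub>oper_alg U\<^esub> super_lap U (fst p) (snd p)) {(i, j). i < j} = \<zero>\<^bsub>oper_alg U\<^esub>"
        by (simp add: super_lap_carrier[OF U])
      then show ?thesis using lap_idealI[of "\<lambda>i j. \<zero>\<^bsub>oper_alg U\<^esub>", OF diff_ops_zero] by simp
    qed
    ultimately show ?thesis by (simp add: super_lap_carrier[OF U])
  qed (rule less)
qed

lemma lap_ideal_zero: "\<zero>\<^bsub>oper_alg U\<^esub> \<in> lap_ideal U"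
  using lap_ideal_smult[OF lap_ideal_super_lap, of 0] by (simp add: super_lap_carrier[OF U])

lemma lap_ideal_finsum: "finite I \<Longrightarrow> (\<And>i. i \<in> I \<Longrightarrow> P i \<in> lap_ideal U) \<Longrightarrow> finsum (oper_alg U) P I \<in> lap_ideal U"
  by (induction I rule: finite_induct) (simp_all add: lap_ideal_zero lap_ideal_add lap_ideal_carrier Pi_def)

end

section \<open>Right multiplication by the operators of E, and the Heisenberg relation modulo the
  ideal\<close>

context
  fixes U :: "'n::{finite,linorder} cmat set"
  assumes U: "siegel_open U"
begin

lemmas oper_carriers = spinor_carrier[OF U] super_lap_carrier[OF U] D_q_carrier[OF U] D_half_carrier[OF U]
  mult_op_xi(1)[OF U] mult_op_t(1)[OF U]

lemmas lap_ideal_intros = lap_ideal_add[OF U] lap_ideal_lmult[OF U] lap_ideal_smult[OF U] lap_ideal_super_lap[OF U]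
  lap_ideal_finsum[OF U]

text \<open>This is \<open>Lap_D\<close> divided by 3, read as an identity of endomorphisms, which
  are equal once they agree on all sections.\<close>

lemma super_lap_spinor_ideal: "super_lap U i j \<otimes>\<^bsub>oper_alg U\<^esub> spinor U k \<in> lap_ideal U"
proof -
  let ?R = "(2/3) \<odot>\<^bsub>oper_alg U\<^esub> (spinor U i \<otimes>\<^bsub>oper_alg U\<^esub> super_lap U j k)
    \<oplus>\<^bsub>oper_alg U\<^esub> ((-2/3) \<odot>\<^bsub>oper_alg U\<^esub> (spinor U j \<otimes>\<^bsub>oper_alg U\<^esub> super_lap U i k)
    \<oplus>\<^bsub>oper_alg U\<^esub> (-1/3) \<odot>\<^bsub>oper_alg U\<^esub> (spinor U k \<otimes>\<^bsub>oper_alg U\<^esub> super_lap U i j))"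
  have "?R \<in> lap_ideal U"
    by (intro lap_ideal_intros diff_ops_spinor[OF U])
  moreover have "super_lap U i j \<otimes>\<^bsub>oper_alg U\<^esub> spinor U k = ?R"
  proof (rule oper_eqI[where U = U])
    fix V f assume V: "siegel_open V" "V \<subseteq> U" and f: "f \<in> sfuns V"
    interpret SM: spinor_module fscl "sfuns V" "sD V" sX sT by (rule spinor_module_sfuns[OF V(1)])
    note app = oper_apply[OF V] spinor_apply[OF U V] super_lap_apply[OF U V] SM.lin_closed[OF SM.lin_D] SM.lin_closed[OF SM.lin_Lap]
    have "fscl (1/3) (fscl 3 (SM.Lap i j (sD V k f))) =
        fscl (1/3) (fscl 2 (sD V i (SM.Lap j k f)) - fscl 2 (sD V j (SM.Lap i k f)) - sD V k (SM.Lap i j f))"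
      using SM.Lap_D[OF f, of i j k] by simp
    then have eq: "SM.Lap i j (sD V k f) = fscl (2/3) (sD V i (SM.Lap j k f)) + (fscl (-2/3) (sD V j (SM.Lap i k f))
        + fscl (-1/3) (sD V k (SM.Lap i j f)))"
      by (simp add: SM.scale_right_diff_distrib SM.scale_minus_left)
    have L: "(super_lap U i j \<otimes>\<^bsub>oper_alg U\<^esub> spinor U k) V f = SM.Lap i j (sD V k f)"
      using f by (simp add: app)
    have R: "?R V f = fscl (2/3) (sD V i (SM.Lap j k f)) + (fscl (-2/3) (sD V j (SM.Lap i k f))
        + fscl (-1/3) (sD V k (SM.Lap i j f)))"
      using f by (simp only: app)
    show "(super_lap U i j \<otimes>\<^bsub>oper_alg U\<^esub> spinor U k) V f = ?R V f"
      unfolding L R by (rule eq)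
  qed (simp_all add: oper_carriers)
  ultimately show ?thesis by simp
qed

text \<open>By \<open>Lap_Q\<close> the product is a combination of L_ij and the products L_ij D_a
  with coefficients on the left; the latter are covered by
  \<open>super_lap_spinor_ideal\<close>.\<close>

lemma super_lap_D_q_ideal: "super_lap U i j \<otimes>\<^bsub>oper_alg U\<^esub> D_q U k \<in> lap_ideal U"
proof -
  let ?R = "(3/2) \<odot>\<^bsub>oper_alg U\<^esub> (mult_op U (xi_fun k) \<otimes>\<^bsub>oper_alg U\<^esub> super_lap U i j)
    \<oplus>\<^bsub>oper_alg U\<^esub> finsum (oper_alg U) (\<lambda>a. mult_op U (t_fun a k) \<otimes>\<^bsub>oper_alg U\<^esub> (super_lap U i j \<otimes>\<^bsub>oper_alg U\<^esub> spinor U a)) UNIV"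
  have "?R \<in> lap_ideal U"
    by (intro lap_ideal_intros diff_ops_xi[OF U] diff_ops_t[OF U] super_lap_spinor_ideal finite)
  moreover have "super_lap U i j \<otimes>\<^bsub>oper_alg U\<^esub> D_q U k = ?R"
  proof (rule oper_eqI[where U = U])
    fix V f assume V: "siegel_open V" "V \<subseteq> U" and f: "f \<in> sfuns V"
    interpret SM: spinor_module fscl "sfuns V" "sD V" sX sT by (rule spinor_module_sfuns[OF V(1)])
    note app = oper_apply[OF V] oper_finsum_apply[OF V] spinor_apply[OF U V] super_lap_apply[OF U V] D_q_apply[OF U V] mult_op_xi(2)[OF U V] mult_op_t(2)[OF U V]
          SM.lin_closed[OF SM.lin_D] SM.lin_closed[OF SM.lin_Lap] SM.lin_closed[OF SM.lin_Q] oper_carriers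
    have L: "(super_lap U i j \<otimes>\<^bsub>oper_alg U\<^esub> D_q U k) V f = SM.Lap i j (SM.Q k f)"
      using f by (simp add: app)
    have R: "?R V f = fscl (3/2) (sX k (SM.Lap i j f)) + (\<Sum>a\<in>UNIV. sT a k (SM.Lap i j (sD V a f)))"
      using f by (simp add: app)
    show "(super_lap U i j \<otimes>\<^bsub>oper_alg U\<^esub> D_q U k) V f = ?R V f"
      unfolding L R by (rule SM.Lap_Q[OF f])
  qed (simp_all add: oper_carriers Pi_def)
  ultimately show ?thesis by simp
qed

lemma super_lap_D_half_ideal: "super_lap U i j \<otimes>\<^bsub>oper_alg U\<^esub> D_half U y \<in> lap_ideal U"
proof -
  have "super_lap U i j \<otimes>\<^bsub>oper_alg U\<^esub> D_half U y = finsum (oper_alg U)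
     (\<lambda>k. (fst y $ k) \<odot>\<^bsub>oper_alg U\<^esub> (super_lap U i j \<otimes>\<^bsub>oper_alg U\<^esub> spinor U k)
       \<oplus>\<^bsub>oper_alg U\<^esub> (snd y $ k) \<odot>\<^bsub>oper_alg U\<^esub> (super_lap U i j \<otimes>\<^bsub>oper_alg U\<^esub> D_q U k)) UNIV"
    unfolding D_half_def by (subst OA.finsum_rdistr) (simp_all add: oper_carriers Pi_def OA.r_distr OA.smult_mult_right)
  also have "\<dots> \<in> lap_ideal U"
    by (intro lap_ideal_intros super_lap_spinor_ideal super_lap_D_q_ideal finite)
  finally show ?thesis .
qed

text \<open>Makes right multiplication by the operators of E well defined on the quotient, although
  the ideal is defined as a left ideal only.\<close>

lemma lap_ideal_D_half: assumes "P \<in> lap_ideal U" shows "P \<otimes>\<^bsub>oper_alg U\<^esub> D_half U y \<in> lap_ideal U"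
proof -
  note c = diff_ops_carrier[OF U]
  obtain Q where Q: "\<And>i j. Q i j \<in> diff_ops U"
    "P = finsum (oper_alg U) (\<lambda>p. Q (fst p) (snd p) \<otimes>\<^bsub>oper_alg U\<^esub> super_lap U (fst p) (snd p)) {(i, j). i < j}"
    using lap_idealE[OF U assms] by blast
  have "P \<otimes>\<^bsub>oper_alg U\<^esub> D_half U y =
      finsum (oper_alg U) (\<lambda>p. Q (fst p) (snd p) \<otimes>\<^bsub>oper_alg U\<^esub> (super_lap U (fst p) (snd p) \<otimes>\<^bsub>oper_alg U\<^esub> D_half U y)) {(i, j). i < j}"
    unfolding Q(2) by (subst OA.finsum_ldistr) (simp_all add: OA.m_assoc c Q(1) oper_carriers Pi_def finite_pairs[OF U])
  also have "\<dots> \<in> lap_ideal U"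
    by (intro lap_ideal_intros Q(1) super_lap_D_half_ideal finite_pairs[OF U])
  finally show ?thesis .
qed

text \<open>\<open>?R\<close> is \<open>comm_remainder\<close> with the components of the
  super-Laplacian as arguments, hence a left combination of them. In this order of the factors the
  scalar part of the commutator is -omega(y,z)/2, which the added multiple of the identity
  removes.\<close>

lemma comm_D_half_ideal:
  "(D_half U y \<otimes>\<^bsub>oper_alg U\<^esub> D_half U z \<ominus>\<^bsub>oper_alg U\<^esub> D_half U z \<otimes>\<^bsub>oper_alg U\<^esub> D_half U y)
    \<oplus>\<^bsub>oper_alg U\<^esub> (symp y z / 2) \<odot>\<^bsub>oper_alg U\<^esub> \<one>\<^bsub>oper_alg U\<^esub> \<in> lap_ideal U" (is "?C \<in> _")
proof -
  let ?A = "oper_alg U" and ?L = "super_lap U" and ?t = "\<lambda>i j. mult_op U (t_fun i j)"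
  let ?R = "finsum ?A (\<lambda>i. finsum ?A (\<lambda>k.
      (fst y $ i * fst z $ k) \<odot>\<^bsub>?A\<^esub> ?L i k
      \<oplus>\<^bsub>?A\<^esub> ((fst y $ i * snd z $ k) \<odot>\<^bsub>?A\<^esub> finsum ?A (\<lambda>j. ?t j k \<otimes>\<^bsub>?A\<^esub> ?L i j) UNIV
      \<oplus>\<^bsub>?A\<^esub> ((- (snd y $ i * fst z $ k)) \<odot>\<^bsub>?A\<^esub> finsum ?A (\<lambda>j. ?t j i \<otimes>\<^bsub>?A\<^esub> ?L k j) UNIV
      \<oplus>\<^bsub>?A\<^esub> (snd y $ i * snd z $ k) \<odot>\<^bsub>?A\<^esub> finsum ?A (\<lambda>a. finsum ?A (\<lambda>b. ?t a i \<otimes>\<^bsub>?A\<^esub> (?t b k \<otimes>\<^bsub>?A\<^esub> ?L a b)) UNIV) UNIV))) UNIV) UNIV"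
  have "?R \<in> lap_ideal U"
    by (intro lap_ideal_intros diff_ops_t[OF U] finite)
  moreover have "?C = ?R"
  proof (rule oper_eqI[where U = U])
    fix V f assume V: "siegel_open V" "V \<subseteq> U" and f: "f \<in> sfuns V"
    interpret SM: spinor_module fscl "sfuns V" "sD V" sX sT by (rule spinor_module_sfuns[OF V(1)])
    note app = oper_apply[OF V] oper_finsum_apply[OF V] spinor_apply[OF U V] super_lap_apply[OF U V] D_half_apply[OF U V]
      mult_op_t(2)[OF U V] SM.lin_closed[OF SM.lin_Lap] SM.lin_closed[OF SM.lin_T] SM.lin_closed[OF SM.lin_Dh] oper_carriers
    have C: "?C V f = SM.Dh y (SM.Dh z f) - SM.Dh z (SM.Dh y f) + fscl (symp y z / 2) f"
      using f by (simp add: oper_minus_apply[OF V] app)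
    have R: "?R V f = SM.comm_remainder y z (\<lambda>i j. SM.Lap i j f)"
      using f by (simp add: app Pi_def SM.comm_remainder_def SM.scale_minus_left sum.distrib sum_subtractf sum_negf)
    show "?C V f = ?R V f"
      unfolding C R SM.comm_Dh[OF f] by simp
  qed (simp_all add: oper_carriers Pi_def)
  ultimately show ?thesis by simp
qed

text \<open>Lets congruences known on different neighbourhoods of a point be compared on their
  intersection.\<close>

lemma lap_ideal_restrict:
  assumes W: "siegel_open W" "W \<subseteq> U" and P: "P \<in> lap_ideal U"
  shows "oper_on W P \<in> lap_ideal W"
proof -
  note c = diff_ops_carrier[OF U]
  obtain Q where Q: "\<And>i j. Q i j \<in> diff_ops U"
    "P = finsum (oper_alg U) (\<lambda>p. Q (fst p) (snd p) \<otimes>\<^bsub>oper_alg U\<^esub> super_lap U (fst p) (snd p)) {(i, j). i < j}"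
    using lap_idealE[OF U P] by blast
  have zero: "oper_on W \<zero>\<^bsub>oper_alg U\<^esub> = \<zero>\<^bsub>oper_alg W\<^esub>"
    using O.sheaf_End_restrict(4)[OF W(2), of 0 "\<one>\<^bsub>oper_alg U\<^esub>"] O.sheaf_End_restrict(1)[OF W(2) OA.one_closed] by simp
  have fin: "oper_on W (finsum (oper_alg U) R I) = finsum (oper_alg W) (\<lambda>i. oper_on W (R i)) I"
    if "finite I" "\<And>i. i \<in> I \<Longrightarrow> R i \<in> carrier (oper_alg U)" for I :: "('n \<times> 'n) set" and R
    using that
    by (induction I) (simp_all add: zero O.sheaf_End_restrict(1,2)[OF W(2)] Pi_def)
  have "oper_on W P = finsum (oper_alg W) (\<lambda>p. oper_on W (Q (fst p) (snd p)) \<otimes>\<^bsub>oper_alg W\<^esub> super_lap W (fst p) (snd p)) {(i, j). i < j}"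
    unfolding Q(2)
    by (subst fin) (simp_all add: O.sheaf_End_restrict(3)[OF W(2)] c Q(1) oper_carriers oper_on_super_lap[OF U W] finite_pairs[OF U])
  then show ?thesis
    using lap_idealI[OF W(1), of "\<lambda>i j. oper_on W (Q i j)"] diff_ops_restrict[OF U W Q(1)] by simp
qed

end

section \<open>The sheaf of solutions\<close>

context spinor_module begin

lemma Dh_linear:
  "Dh (evec_scale a y + evec_scale b z) f = scl a (Dh y f) + scl b (Dh z f)"
  by (simp add: Dh_def evec_scale_def scale_left_distrib scale_right_distrib scale_sum_right sum.distrib add_ac)

end

lemma D_half_linear:
  fixes U :: "'n::{finite,linorder} cmat set"
  assumes U: "siegel_open U"
  shows "D_half U (evec_scale a y + evec_scale b z) = a \<odot>\<^bsub>oper_alg U\<^esub> D_half U y \<oplus>\<^bsub>oper_alg U\<^esub> b \<odot>\<^bsub>oper_alg U\<^esub> D_half U z"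
proof (rule oper_eqI[where U = U])
  fix V f assume V: "siegel_open V" "V \<subseteq> U" and f: "f \<in> sfuns V"
  interpret SM: spinor_module fscl "sfuns V" "sD V" sX sT by (rule spinor_module_sfuns[OF V(1)])
  show "D_half U (evec_scale a y + evec_scale b z) V f = (a \<odot>\<^bsub>oper_alg U\<^esub> D_half U y \<oplus>\<^bsub>oper_alg U\<^esub> b \<odot>\<^bsub>oper_alg U\<^esub> D_half U z) V f"
    unfolding D_half_apply[OF U V f] SM.Dh_linear by (simp only: oper_apply[OF V f] D_half_apply[OF U V f])
qed (simp_all add: D_half_carrier[OF U])

lemma siegel_open_siegel [simp]: "siegel_open siegel"
  by simp

text \<open>Skew-symmetry extends the condition from pairs i < j to all pairs, as the abstract
  lemmas require.\<close>

lemma mem_ker: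
  fixes V :: "'n::{finite,linorder} cmat set"
  assumes V: "siegel_open V"
  shows "f \<in> sect ker_sheaf V \<longleftrightarrow> f \<in> sfuns V \<and> (\<forall>i j. super_lap V i j V f = 0)"
proof (cases "f \<in> sfuns V")
  case True
  interpret SM: spinor_module fscl "sfuns V" "sD V" sX sT by (rule spinor_module_sfuns[OF V])
  have "super_lap V i j V f = 0" if l: "\<And>i j. i < j \<Longrightarrow> super_lap V i j V f = 0" for i j
    using l[of i j] l[of j i] SM.Lap_skew[of j i f] SM.Lap_def[of i i f]
    by (cases i j rule: linorder_cases) (simp_all add: super_lap_apply[OF V V order.refl True])
  moreover have "(\<lambda>v A. 0) = (0 :: 'n sfun)" by (simp add: fun_eq_iff)
  ultimately show ?thesis using True by (auto simp: ker_sheaf_def)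
qed (simp add: ker_sheaf_def)

lemma ker_sheaf_ops: "vadd ker_sheaf = (+)" "vscl ker_sheaf = fscl" "rest ker_sheaf = rest sfun_sheaf"
  by (auto simp: ker_sheaf_def fun_eq_iff sfun_sheaf_ops)

lemma vpresheaf_ker: "vpresheaf (ker_sheaf :: ('n::{finite,linorder} cmat, 'n sfun) vsheaf)"
proof
  fix V W :: "'n cmat set" and s :: "'n sfun" and c :: complex
  assume V: "siegel_open V" and s: "s \<in> sect ker_sheaf V"
  interpret M: subspace_module fscl "sfuns V" by (rule subspace_module_sfuns[OF V])
  have s': "s \<in> sfuns V" "\<And>i j. super_lap V i j V s = 0" using s by (simp_all add: mem_ker[OF V])
  note lin = oper_lin[OF super_lap_carrier[OF V] V order.refl]
  show "vscl ker_sheaf c s \<in> sect ker_sheaf V"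
    using s' by (simp add: ker_sheaf_ops mem_ker[OF V] lin)
  show "vscl ker_sheaf (c + d) s = vadd ker_sheaf (vscl ker_sheaf c s) (vscl ker_sheaf d s)" for d
    by (simp add: ker_sheaf_ops M.scale_left_distrib)
  show "vscl ker_sheaf c (vscl ker_sheaf d s) = vscl ker_sheaf (c * d) s" for d
    by (simp add: ker_sheaf_ops)
  show "vscl ker_sheaf 1 s = s" by (simp add: ker_sheaf_ops)
  show "vadd ker_sheaf s t \<in> sect ker_sheaf V" if "t \<in> sect ker_sheaf V" for t
    using s' that by (simp add: ker_sheaf_ops mem_ker[OF V] lin)
  assume W: "siegel_open W" "W \<subseteq> V"
  have "super_lap W i j W (rest sfun_sheaf W s) = rest sfun_sheaf W (super_lap V i j V s)" for i j
    using O.sheaf_EndD(4)[OF super_lap_carrier[OF V] V order.refl s'(1) W, of i j]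
      O.rest_closed[OF V W s'(1)]
    by (simp add: oper_on_super_lap[OF V W, symmetric] on_sect_apply[OF W(1) order.refl])
  moreover have "rest sfun_sheaf W (0 :: 'n sfun) = 0" by (auto simp: rest_sfun fun_eq_iff)
  ultimately show "rest ker_sheaf W s \<in> sect ker_sheaf W"
    using s' O.rest_closed[OF V W s'(1)] by (simp add: ker_sheaf_ops mem_ker[OF W(1)])
qed (auto simp: ker_sheaf_ops rest_sfun fun_eq_iff fscl_def algebra_simps)

interpretation K: vpresheaf ker_sheaf
  by (rule vpresheaf_ker)

interpretation KA: calgebra "sheaf_End ker_sheaf siegel :: 'n::{finite,linorder} oper calg"
  by (rule K.calgebra_sheaf_End)

lemma ker_sfuns: "siegel_open V \<Longrightarrow> f \<in> sect ker_sheaf V \<Longrightarrow> f \<in> sfuns V"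
  by (simp add: mem_ker)

section \<open>The operators of E on solutions, with products in reversed order\<close>

lemma D_half_ker:
  fixes V :: "'n::{finite,linorder} cmat set"
  assumes V: "siegel_open V" and f: "f \<in> sect ker_sheaf V"
  shows "D_half siegel y V f \<in> sect ker_sheaf V"
proof -
  interpret SM: spinor_module fscl "sfuns V" "sD V" sX sT by (rule spinor_module_sfuns[OF V])
  have f': "f \<in> sfuns V" using ker_sfuns[OF V f] .
  note lap = super_lap_apply[OF V V order.refl]
  have "SM.Lap i j f = 0" for i j using f lap[OF f', of i j] by (simp add: mem_ker[OF V])
  then have "SM.Lap i j (SM.Dh y f) = 0" for i j by (rule SM.Lap_Dh_eq_zero[OF f'])
  then show ?thesis
    using SM.lin_closed[OF SM.lin_Dh f'] lap
    by (simp add: mem_ker[OF V] D_half_apply[OF siegel_open_siegel V siegel_openD[OF V] f'])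
qed

text \<open>On a solution the remainder in \<open>comm_Dh\<close> vanishes and the scalar
  -omega(y,z)/2 is left. Exchanging the two factors gives the plus sign.\<close>

lemma D_half_comm_ker:
  fixes V :: "'n::{finite,linorder} cmat set"
  assumes V: "siegel_open V" and f: "f \<in> sect ker_sheaf V"
  shows "D_half siegel z V (D_half siegel y V f) - D_half siegel y V (D_half siegel z V f) = fscl (symp y z / 2) f"
proof -
  interpret SM: spinor_module fscl "sfuns V" "sD V" sX sT by (rule spinor_module_sfuns[OF V])
  have f': "f \<in> sfuns V" using ker_sfuns[OF V f] .
  have "SM.Lap i j f = 0" for i j
    using f super_lap_apply[OF V V order.refl f', of i j] by (simp add: mem_ker[OF V])
  then have r: "SM.comm_remainder y z (\<lambda>i j. SM.Lap i j f) = 0"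
    by (simp add: SM.comm_remainder_def SM.lin_zero[OF SM.lin_T])
  have "SM.Dh z (SM.Dh y f) - SM.Dh y (SM.Dh z f) = - (SM.Dh y (SM.Dh z f) - SM.Dh z (SM.Dh y f))" by simp
  also have "\<dots> = fscl (symp y z / 2) f" unfolding SM.comm_Dh[OF f'] r by simp
  finally show ?thesis
    by (simp add: D_half_apply[OF siegel_open_siegel V siegel_openD[OF V]] f' SM.lin_closed[OF SM.lin_Dh])
qed

lemma ker_act_apply:
  assumes "siegel_open V" "f \<in> sect ker_sheaf V"
  shows "ker_act y V f = D_half siegel y V f"
  by (simp add: ker_act_def on_sect_apply[OF assms(1) siegel_openD[OF assms(1)] assms(2)])

lemma ker_act_carrier: "ker_act y \<in> carrier End_Ker"
  unfolding ker_act_def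
proof (rule K.sheaf_EndI)
  fix V W :: "'a cmat set" and s assume *: "siegel_open V" "V \<subseteq> siegel" "siegel_open W" "W \<subseteq> V" "s \<in> sect ker_sheaf V"
  show "rest ker_sheaf W (D_half siegel y V s) = D_half siegel y W (rest ker_sheaf W s)"
    unfolding ker_sheaf_ops
    by (rule O.sheaf_EndD(4)[OF D_half_carrier[OF siegel_open_siegel] *(1,2) ker_sfuns[OF *(1,5)] *(3,4)])
qed (simp_all add: D_half_ker ker_sheaf_ops oper_lin[OF D_half_carrier[OF siegel_open_siegel]] ker_sfuns)

lemma ker_act_linear:
  "ker_act (evec_scale a y + evec_scale b z) = a \<odot>\<^bsub>End_Ker\<^esub> ker_act y \<oplus>\<^bsub>End_Ker\<^esub> b \<odot>\<^bsub>End_Ker\<^esub> ker_act z"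
proof (rule K.sheaf_End_eqI)
  fix V :: "'a cmat set" and s assume V: "siegel_open V" "V \<subseteq> siegel" and s: "s \<in> sect ker_sheaf V"
  show "ker_act (evec_scale a y + evec_scale b z) V s = (a \<odot>\<^bsub>End_Ker\<^esub> ker_act y \<oplus>\<^bsub>End_Ker\<^esub> b \<odot>\<^bsub>End_Ker\<^esub> ker_act z) V s"
    unfolding K.sheaf_End_apply[OF V s] ker_act_apply[OF V(1) s] D_half_linear[OF siegel_open_siegel]
    by (simp only: oper_apply[OF V ker_sfuns[OF V(1) s]] ker_sheaf_ops)
qed (simp_all add: ker_act_carrier)

lemma ker_act_comm:
  "ker_act z \<otimes>\<^bsub>End_Ker\<^esub> ker_act y \<ominus>\<^bsub>End_Ker\<^esub> ker_act y \<otimes>\<^bsub>End_Ker\<^esub> ker_act z = (symp y z / 2) \<odot>\<^bsub>End_Ker\<^esub> \<one>\<^bsub>End_Ker\<^esub>"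
proof (rule K.sheaf_End_eqI)
  fix V :: "'a cmat set" and s assume V: "siegel_open V" "V \<subseteq> siegel" and s: "s \<in> sect ker_sheaf V"
  have m: "x + fscl (-1) w = x - w" for x w :: "'a sfun" by (simp add: fscl_def fun_eq_iff)
  show "(ker_act z \<otimes>\<^bsub>End_Ker\<^esub> ker_act y \<ominus>\<^bsub>End_Ker\<^esub> ker_act y \<otimes>\<^bsub>End_Ker\<^esub> ker_act z) V s = ((symp y z / 2) \<odot>\<^bsub>End_Ker\<^esub> \<one>\<^bsub>End_Ker\<^esub>) V s"
    unfolding KA.minus_eq_smult[OF KA.m_closed[OF ker_act_carrier ker_act_carrier] KA.m_closed[OF ker_act_carrier ker_act_carrier]]
      K.sheaf_End_apply[OF V s] ker_act_apply[OF V(1) s] ker_act_apply[OF V(1) D_half_ker[OF V(1) s]] ker_sheaf_ops m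
    by (rule D_half_comm_ker[OF V(1) s])
qed (simp_all add: ker_act_carrier)

section \<open>The parity operator and the action on solutions with composition as product\<close>

lemma parity_fun_apply: "parity_fun f v = gpar (f v)"
  by (simp add: parity_fun_def gpar_def)

lemma parity_fun_parity [simp]: "parity_fun (parity_fun f) = f"
  by (rule ext) (simp add: parity_fun_apply)

lemma parity_fun_linear: "parity_fun (f + g) = parity_fun f + parity_fun g" "parity_fun (fscl c f) = fscl c (parity_fun f)"
  "parity_fun (- f) = - parity_fun f" "parity_fun (f - g) = parity_fun f - parity_fun g" "parity_fun 0 = 0"
  by (rule ext, simp add: parity_fun_apply gpar_linear fscl_apply)+

lemma parity_fun_sum: "parity_fun (\<Sum>i\<in>I. f i) = (\<Sum>i\<in>I. parity_fun (f i :: 'n::{finite,linorder} sfun))"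
  by (intro ext) (simp add: parity_fun_def sum_distrib_left sum_sfun_apply[OF siegel_open_siegel])

context
  fixes V :: "'n::{finite,linorder} cmat set"
  assumes V: "siegel_open V"
begin

interpretation W: super_weyl fscl "sfuns V" s_d sX "s_dt V" by (rule super_weyl_sfuns[OF V])
interpretation SM: spinor_module fscl "sfuns V" "sD V" sX sT by (rule spinor_module_sfuns[OF V])

lemma sfuns_parity: assumes f: "f \<in> sfuns V" shows "parity_fun f \<in> sfuns V"
proof (rule sfunsI)
  show "holo_on V (\<lambda>v. parity_fun f v A)" for A
    unfolding parity_fun_def by (intro holo_on_mult[OF V] holo_on_const[OF V] sfuns_holo[OF f])
qed (simp add: parity_fun_apply sfuns_outside[OF f] gpar_linear)

lemma sX_parity: "sX i (parity_fun f) = - parity_fun (sX i f)"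
  by (rule ext) (simp add: sX_def parity_fun_apply gpar_gmul gpar_gxi gmul_uminus)

lemma sT_parity: "sT i j (parity_fun f) = parity_fun (sT i j f)"
  by (rule ext) (simp add: sT_def parity_fun_apply gpar_gmul gpar_t_fun)

text \<open>Derivatives in xi and multiplications by xi are odd and derivatives in t are even, so
  both parts of D_i anticommute with parity.\<close>

lemma sD_parity: assumes f: "f \<in> sfuns V" shows "sD V i (parity_fun f) = - parity_fun (sD V i f)"
proof -
  have d: "s_d i (parity_fun f) = - parity_fun (s_d i f)"
    by (rule ext) (simp add: s_d_def parity_fun_apply gpar_d_xi)
  have dt: "s_dt V i j (parity_fun f) = parity_fun (s_dt V i j f)" for j
    by (intro ext) (simp add: s_dt_def parity_fun_def dsym_cmult[OF V sfuns_holo[OF f]])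
  show ?thesis
    unfolding sD_eq[OF V f] sD_eq[OF V sfuns_parity[OF f]] W.D_def d dt sX_parity
    by (simp add: parity_fun_linear parity_fun_sum sum_negf)
qed

lemma Q_parity: assumes f: "f \<in> sfuns V" shows "SM.Q i (parity_fun f) = - parity_fun (SM.Q i f)"
proof -
  have "sT j i (- parity_fun (sD V j f)) = - parity_fun (sT j i (sD V j f))" for j
    using W.lin_neg[OF SM.lin_T sfuns_parity[OF W.lin_closed[OF SM.lin_D f]]] by (simp add: sT_parity)
  then show ?thesis
    by (simp add: SM.Q_def sD_parity[OF f] sX_parity parity_fun_linear parity_fun_sum sum_negf)
qed

lemma Dh_parity: assumes f: "f \<in> sfuns V" shows "SM.Dh y (parity_fun f) = - parity_fun (SM.Dh y f)"
  by (simp add: SM.Dh_def sD_parity[OF f] Q_parity[OF f] parity_fun_linear parity_fun_sum sum_negf sum.distrib sum_subtractf)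

lemma Lap_parity: assumes f: "f \<in> sfuns V" shows "SM.Lap i j (parity_fun f) = parity_fun (SM.Lap i j f)"
proof -
  have "sD V i (sD V j (parity_fun f)) = parity_fun (sD V i (sD V j f))" for i j
    using W.lin_neg[OF SM.lin_D sfuns_parity[OF W.lin_closed[OF SM.lin_D f]]]
    by (simp add: sD_parity[OF f] sD_parity[OF W.lin_closed[OF SM.lin_D f]])
  then show ?thesis by (simp add: SM.Lap_def parity_fun_linear)
qed

lemma parity_ker: assumes f: "f \<in> sect ker_sheaf V" shows "parity_fun f \<in> sect ker_sheaf V"
proof -
  have f': "f \<in> sfuns V" using ker_sfuns[OF V f] .
  note lap = super_lap_apply[OF V V order.refl]
  show ?thesis
    using f by (simp add: mem_ker[OF V] sfuns_parity[OF f'] lap[OF f'] lap[OF sfuns_parity[OF f']] Lap_parity[OF f'] parity_fun_linear)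
qed

lemma D_half_parity:
  assumes f: "f \<in> sfuns V" shows "D_half siegel y V (parity_fun f) = - parity_fun (D_half siegel y V f)"
  by (simp only: D_half_apply[OF siegel_open_siegel V siegel_openD[OF V]] f sfuns_parity[OF f] Dh_parity[OF f])

end

lemma rest_parity: "rest sfun_sheaf W (parity_fun f) = parity_fun (rest sfun_sheaf W f)"
  by (rule ext) (simp add: rest_sfun parity_fun_apply gpar_linear)

lemma ker_act_parity_apply:
  assumes "siegel_open V" "f \<in> sect ker_sheaf V"
  shows "ker_act_parity y V f = D_half siegel y V (parity_fun f)"
  by (simp add: ker_act_parity_def on_sect_apply[OF assms(1) siegel_openD[OF assms(1)] assms(2)])

lemma ker_act_parity_carrier: "ker_act_parity y \<in> carrier End_Ker"
  unfolding ker_act_parity_def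
proof (rule K.sheaf_EndI)
  fix V W :: "'a cmat set" and s assume *: "siegel_open V" "V \<subseteq> siegel" "siegel_open W" "W \<subseteq> V" "s \<in> sect ker_sheaf V"
  show "rest ker_sheaf W (D_half siegel y V (parity_fun s)) = D_half siegel y W (parity_fun (rest ker_sheaf W s))"
    unfolding ker_sheaf_ops rest_parity[symmetric]
    by (rule O.sheaf_EndD(4)[OF D_half_carrier[OF siegel_open_siegel] *(1,2) ker_sfuns[OF *(1) parity_ker[OF *(1,5)]] *(3,4)])
qed (simp_all add: D_half_ker parity_ker ker_sheaf_ops parity_fun_linear oper_lin[OF D_half_carrier[OF siegel_open_siegel]] ker_sfuns)

lemma ker_act_parity_linear:
  "ker_act_parity (evec_scale a y + evec_scale b z) =
    a \<odot>\<^bsub>End_Ker\<^esub> ker_act_parity y \<oplus>\<^bsub>End_Ker\<^esub> b \<odot>\<^bsub>End_Ker\<^esub> ker_act_parity z"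
proof (rule K.sheaf_End_eqI)
  fix V :: "'a cmat set" and s assume V: "siegel_open V" "V \<subseteq> siegel" and s: "s \<in> sect ker_sheaf V"
  show "ker_act_parity (evec_scale a y + evec_scale b z) V s =
      (a \<odot>\<^bsub>End_Ker\<^esub> ker_act_parity y \<oplus>\<^bsub>End_Ker\<^esub> b \<odot>\<^bsub>End_Ker\<^esub> ker_act_parity z) V s"
    unfolding K.sheaf_End_apply[OF V s] ker_act_parity_apply[OF V(1) s] D_half_linear[OF siegel_open_siegel]
    by (simp only: oper_apply[OF V ker_sfuns[OF V(1) parity_ker[OF V(1) s]]] ker_sheaf_ops)
qed (simp_all add: ker_act_parity_carrier)

lemma ker_act_parity_comm:
  "ker_act_parity y \<otimes>\<^bsub>End_Ker\<^esub> ker_act_parity z \<ominus>\<^bsub>End_Ker\<^esub> ker_act_parity z \<otimes>\<^bsub>End_Ker\<^esub> ker_act_parity y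
    = (symp y z / 2) \<odot>\<^bsub>End_Ker\<^esub> \<one>\<^bsub>End_Ker\<^esub>"
proof (rule K.sheaf_End_eqI)
  fix V :: "'a cmat set" and s assume V: "siegel_open V" "V \<subseteq> siegel" and s: "s \<in> sect ker_sheaf V"
  \<comment> \<open>One parity operator is moved past the odd operator of z, which costs a sign, and
    then cancels against the other. The sign reverses the commutator of the plain operators.\<close>
  have "ker_act_parity y V (ker_act_parity z V s) = - D_half siegel y V (D_half siegel z V s)" for y z
  proof -
    have D: "D_half siegel z V s \<in> sect ker_sheaf V" by (rule D_half_ker[OF V(1) s])
    have z: "ker_act_parity z V s = - parity_fun (D_half siegel z V s)"
      unfolding ker_act_parity_apply[OF V(1) s] by (rule D_half_parity[OF V(1) ker_sfuns[OF V(1) s]])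
    have "ker_act_parity z V s \<in> sect ker_sheaf V"
      unfolding ker_act_parity_apply[OF V(1) s] by (rule D_half_ker[OF V(1) parity_ker[OF V(1) s]])
    from ker_act_parity_apply[OF V(1) this]
    have "ker_act_parity y V (ker_act_parity z V s) = D_half siegel y V (parity_fun (- parity_fun (D_half siegel z V s)))"
      unfolding z by simp
    also have "\<dots> = D_half siegel y V (fscl (-1) (D_half siegel z V s))"
      by (simp add: parity_fun_linear(3)) (rule arg_cong[where f = "D_half siegel y V"], simp add: fscl_def fun_eq_iff)
    also have "\<dots> = fscl (-1) (D_half siegel y V (D_half siegel z V s))"
      by (rule oper_lin(3)[OF D_half_carrier[OF siegel_open_siegel] V ker_sfuns[OF V(1) D]])
    finally show ?thesis by (simp add: fscl_def fun_eq_iff)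
  qed
  moreover have m: "- x + fscl (-1) (- w) = w - x" for x w :: "'a sfun" by (simp add: fscl_def fun_eq_iff)
  ultimately show "(ker_act_parity y \<otimes>\<^bsub>End_Ker\<^esub> ker_act_parity z \<ominus>\<^bsub>End_Ker\<^esub> ker_act_parity z \<otimes>\<^bsub>End_Ker\<^esub> ker_act_parity y) V s
      = ((symp y z / 2) \<odot>\<^bsub>End_Ker\<^esub> \<one>\<^bsub>End_Ker\<^esub>) V s"
    unfolding KA.minus_eq_smult[OF KA.m_closed[OF ker_act_parity_carrier ker_act_parity_carrier]
        KA.m_closed[OF ker_act_parity_carrier ker_act_parity_carrier]]
      K.sheaf_End_apply[OF V s] ker_sheaf_ops
    by (simp only: m D_half_comm_ker[OF V(1) s])
qed (simp_all add: ker_act_parity_carrier)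

section \<open>The D-module\<close>

text \<open>Equality of classes in the quotient over N. Both operators are required to be
  differential operators so that congruences survive restriction and products without side
  conditions.\<close>

definition icong :: "'n::{finite,linorder} cmat set \<Rightarrow> 'n oper \<Rightarrow> 'n oper \<Rightarrow> bool" where
  "icong N P Q \<longleftrightarrow> P \<in> diff_ops N \<and> Q \<in> diff_ops N \<and> P \<ominus>\<^bsub>oper_alg N\<^esub> Q \<in> lap_ideal N"

context
  fixes N :: "'n::{finite,linorder} cmat set"
  assumes N: "siegel_open N"
begin

lemma icong_refl: "P \<in> diff_ops N \<Longrightarrow> icong N P P"
  by (simp add: icong_def OA.minus_eq_zero_iff[THEN iffD2] diff_ops_carrier[OF N] lap_ideal_zero[OF N])

lemma icong_sym: assumes "icong N P Q" shows "icong N Q P"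
proof -
  have c: "P \<in> carrier (oper_alg N)" "Q \<in> carrier (oper_alg N)" using assms diff_ops_carrier[OF N] by (auto simp: icong_def)
  have "Q \<ominus>\<^bsub>oper_alg N\<^esub> P = (-1) \<odot>\<^bsub>oper_alg N\<^esub> (P \<ominus>\<^bsub>oper_alg N\<^esub> Q)"
    using c by (simp add: OA.minus_eq_smult OA.smult_add_right OA.smult_smult OA.a_comm)
  then show ?thesis using assms lap_ideal_smult[OF N] by (simp add: icong_def)
qed

lemma icong_trans: assumes "icong N P Q" "icong N Q R" shows "icong N P R"
proof -
  have c: "P \<in> carrier (oper_alg N)" "Q \<in> carrier (oper_alg N)" "R \<in> carrier (oper_alg N)"
    using assms diff_ops_carrier[OF N] by (auto simp: icong_def)
  have "(P \<ominus>\<^bsub>oper_alg N\<^esub> Q) \<oplus>\<^bsub>oper_alg N\<^esub> (Q \<ominus>\<^bsub>oper_alg N\<^esub> R) = P \<oplus>\<^bsub>oper_alg N\<^esub> ((\<ominus>\<^bsub>oper_alg N\<^esub> Q \<oplus>\<^bsub>oper_alg N\<^esub> Q) \<oplus>\<^bsub>oper_alg N\<^esub> \<ominus>\<^bsub>oper_alg N\<^esub> R)"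
    using c by (simp add: a_minus_def OA.a_assoc)
  also have "\<dots> = P \<ominus>\<^bsub>oper_alg N\<^esub> R" using c by (simp add: OA.l_neg a_minus_def)
  finally show ?thesis using assms lap_ideal_add[OF N, of "P \<ominus>\<^bsub>oper_alg N\<^esub> Q" "Q \<ominus>\<^bsub>oper_alg N\<^esub> R"] by (simp add: icong_def)
qed

lemma icong_add: assumes "icong N P Q" "icong N P' Q'" shows "icong N (P \<oplus>\<^bsub>oper_alg N\<^esub> P') (Q \<oplus>\<^bsub>oper_alg N\<^esub> Q')"
proof -
  have c: "P \<in> carrier (oper_alg N)" "Q \<in> carrier (oper_alg N)" "P' \<in> carrier (oper_alg N)" "Q' \<in> carrier (oper_alg N)"
    using assms diff_ops_carrier[OF N] by (auto simp: icong_def)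
  have "(P \<oplus>\<^bsub>oper_alg N\<^esub> P') \<ominus>\<^bsub>oper_alg N\<^esub> (Q \<oplus>\<^bsub>oper_alg N\<^esub> Q') = (P \<ominus>\<^bsub>oper_alg N\<^esub> Q) \<oplus>\<^bsub>oper_alg N\<^esub> (P' \<ominus>\<^bsub>oper_alg N\<^esub> Q')"
    using c by (simp add: OA.minus_eq_smult OA.smult_add_right OA.a_ac)
  then show ?thesis using assms by (simp add: icong_def diff_ops_add[OF N] lap_ideal_add[OF N])
qed

lemma icong_smult: assumes "icong N P Q" shows "icong N (c \<odot>\<^bsub>oper_alg N\<^esub> P) (c \<odot>\<^bsub>oper_alg N\<^esub> Q)"
proof -
  have car: "P \<in> carrier (oper_alg N)" "Q \<in> carrier (oper_alg N)" using assms diff_ops_carrier[OF N] by (auto simp: icong_def)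
  have "c \<odot>\<^bsub>oper_alg N\<^esub> P \<ominus>\<^bsub>oper_alg N\<^esub> c \<odot>\<^bsub>oper_alg N\<^esub> Q = c \<odot>\<^bsub>oper_alg N\<^esub> (P \<ominus>\<^bsub>oper_alg N\<^esub> Q)"
    using car by (simp add: OA.minus_eq_smult OA.smult_add_right OA.smult_smult)
  then show ?thesis using assms by (simp add: icong_def diff_ops_smult[OF N] lap_ideal_smult[OF N])
qed

lemma icong_lmult: assumes "icong N P Q" "R \<in> diff_ops N" shows "icong N (R \<otimes>\<^bsub>oper_alg N\<^esub> P) (R \<otimes>\<^bsub>oper_alg N\<^esub> Q)"
proof -
  have c: "P \<in> carrier (oper_alg N)" "Q \<in> carrier (oper_alg N)" "R \<in> carrier (oper_alg N)"
    using assms diff_ops_carrier[OF N] by (auto simp: icong_def)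
  have "R \<otimes>\<^bsub>oper_alg N\<^esub> P \<ominus>\<^bsub>oper_alg N\<^esub> R \<otimes>\<^bsub>oper_alg N\<^esub> Q = R \<otimes>\<^bsub>oper_alg N\<^esub> (P \<ominus>\<^bsub>oper_alg N\<^esub> Q)"
    using c by (simp add: OA.minus_eq_smult OA.r_distr OA.smult_mult_right)
  then show ?thesis using assms by (simp add: icong_def diff_ops_mult[OF N] lap_ideal_lmult[OF N])
qed

text \<open>For general right factors there is no such rule, the ideal being a left one; for the
  operators of E it is \<open>lap_ideal_D_half\<close>.\<close>

lemma icong_D_half: assumes "icong N P Q" shows "icong N (P \<otimes>\<^bsub>oper_alg N\<^esub> D_half N y) (Q \<otimes>\<^bsub>oper_alg N\<^esub> D_half N y)"
proof -
  have c: "P \<in> carrier (oper_alg N)" "Q \<in> carrier (oper_alg N)" "D_half N y \<in> carrier (oper_alg N)"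
    using assms diff_ops_carrier[OF N] D_half_carrier[OF N] by (auto simp: icong_def)
  have "P \<otimes>\<^bsub>oper_alg N\<^esub> D_half N y \<ominus>\<^bsub>oper_alg N\<^esub> Q \<otimes>\<^bsub>oper_alg N\<^esub> D_half N y = (P \<ominus>\<^bsub>oper_alg N\<^esub> Q) \<otimes>\<^bsub>oper_alg N\<^esub> D_half N y"
    using c by (simp add: OA.minus_eq_smult OA.l_distr OA.smult_mult_left)
  then show ?thesis using assms
    by (simp add: icong_def diff_ops_mult[OF N] diff_ops_D_half[OF N] lap_ideal_D_half[OF N])
qed

lemma icong_restrict: assumes "icong N P Q" "siegel_open W" "W \<subseteq> N" shows "icong W (oper_on W P) (oper_on W Q)"
proof -
  have c: "P \<in> carrier (oper_alg N)" "Q \<in> carrier (oper_alg N)" using assms diff_ops_carrier[OF N] by (auto simp: icong_def)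
  have "oper_on W (P \<ominus>\<^bsub>oper_alg N\<^esub> Q) = oper_on W P \<ominus>\<^bsub>oper_alg W\<^esub> oper_on W Q"
    using c O.sheaf_End_restrict(1)[OF assms(3)]
    by (simp add: OA.minus_eq_smult O.sheaf_End_restrict(2,4)[OF assms(3)])
  moreover have "oper_on W (P \<ominus>\<^bsub>oper_alg N\<^esub> Q) \<in> lap_ideal W"
    using assms(1) unfolding icong_def by (intro lap_ideal_restrict[OF N assms(2,3)]) blast
  ultimately show ?thesis
    using assms(1) diff_ops_restrict[OF N assms(2,3)] by (simp add: icong_def)
qed

end

section \<open>Germs of the quotient, and operations on them through representatives\<close>

definition rep :: "'n::{finite,linorder} cmat \<Rightarrow> 'n cmat set \<Rightarrow> 'n oper \<Rightarrow> bool" where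
  "rep x W P \<longleftrightarrow> siegel_open W \<and> x \<in> W \<and> P \<in> diff_ops W"

definition germ_eq :: "'n::{finite,linorder} cmat \<Rightarrow> 'n cmat set \<Rightarrow> 'n oper \<Rightarrow> 'n cmat set \<Rightarrow> 'n oper \<Rightarrow> bool" where
  "germ_eq x W P W' Q \<longleftrightarrow> (\<exists>N. siegel_open N \<and> x \<in> N \<and> N \<subseteq> W \<inter> W' \<and> icong N (oper_on N P) (oper_on N Q))"

lemma rep_restrict: "rep x W P \<Longrightarrow> siegel_open N \<Longrightarrow> x \<in> N \<Longrightarrow> N \<subseteq> W \<Longrightarrow> rep x N (oper_on N P)"
  using diff_ops_restrict[of W N P] by (auto simp: rep_def)

lemma germ_class_iff:
  assumes "rep x W P"
  shows "(W', Q) \<in> germ_class x W P \<longleftrightarrow> rep x W' Q \<and> germ_eq x W P W' Q"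
proof -
  have "icong N (oper_on N P) (oper_on N Q) \<longleftrightarrow> oper_on N P \<ominus>\<^bsub>oper_alg N\<^esub> oper_on N Q \<in> lap_ideal N"
    if "siegel_open N" "x \<in> N" "N \<subseteq> W \<inter> W'" "rep x W' Q" for N
    using that assms diff_ops_restrict[of W N P] diff_ops_restrict[of W' N Q] by (auto simp: icong_def rep_def)
  then show ?thesis by (auto simp: germ_class_def germ_eq_def rep_def)
qed

lemma germ_eq_refl: "rep x W P \<Longrightarrow> germ_eq x W P W P"
  unfolding germ_eq_def rep_def
  by (intro exI[of _ W]) (auto intro!: icong_refl simp: O.sheaf_End_normal diff_ops_carrier)

lemma germ_eq_sym: "germ_eq x W P W' Q \<Longrightarrow> germ_eq x W' Q W P"
  unfolding germ_eq_def using icong_sym by blast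

lemma germ_eq_trans:
  assumes "germ_eq x W P W' Q" "germ_eq x W' Q W'' R" shows "germ_eq x W P W'' R"
proof -
  obtain N where N: "siegel_open N" "x \<in> N" "N \<subseteq> W \<inter> W'" "icong N (oper_on N P) (oper_on N Q)"
    using assms(1) unfolding germ_eq_def by blast
  obtain N' where N': "siegel_open N'" "x \<in> N'" "N' \<subseteq> W' \<inter> W''" "icong N' (oper_on N' Q) (oper_on N' R)"
    using assms(2) unfolding germ_eq_def by blast
  have K: "siegel_open (N \<inter> N')" using N N' siegel_open_Int by blast
  have "icong (N \<inter> N') (oper_on (N \<inter> N') P) (oper_on (N \<inter> N') Q)"
    using icong_restrict[OF N(1,4) K] by (simp add: on_sect_on_sect)
  moreover have "icong (N \<inter> N') (oper_on (N \<inter> N') Q) (oper_on (N \<inter> N') R)"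
    using icong_restrict[OF N'(1,4) K] by (simp add: on_sect_on_sect)
  ultimately have "icong (N \<inter> N') (oper_on (N \<inter> N') P) (oper_on (N \<inter> N') R)" by (rule icong_trans[OF K])
  then show ?thesis unfolding germ_eq_def using K N(2,3) N'(2,3) by (intro exI[of _ "N \<inter> N'"]) auto
qed

lemma germ_class_eqI:
  assumes "rep x W P" "rep x W' Q" "germ_eq x W P W' Q" shows "germ_class x W P = germ_class x W' Q"
proof (rule subset_antisym; rule subsetI; clarify)
  fix K R
  show "(K, R) \<in> germ_class x W' Q" if "(K, R) \<in> germ_class x W P"
    using that germ_eq_trans[OF germ_eq_sym[OF assms(3)], of K R] by (simp add: germ_class_iff assms)
  show "(K, R) \<in> germ_class x W P" if "(K, R) \<in> germ_class x W' Q"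
    using that germ_eq_trans[OF assms(3), of K R] by (simp add: germ_class_iff assms)
qed

lemma germ_class_self: "rep x W P \<Longrightarrow> (W, P) \<in> germ_class x W P"
  by (simp add: germ_class_iff germ_eq_refl)

lemma germ_eq_restrict: "rep x W P \<Longrightarrow> siegel_open N \<Longrightarrow> x \<in> N \<Longrightarrow> N \<subseteq> W \<Longrightarrow> germ_eq x W P N (oper_on N P)"
  unfolding germ_eq_def using icong_refl[of N "oper_on N P"] rep_restrict[of x W P N]
  by (intro exI[of _ N]) (auto simp: rep_def)

lemma germ_class_restrict:
  "rep x W P \<Longrightarrow> siegel_open N \<Longrightarrow> x \<in> N \<Longrightarrow> N \<subseteq> W \<Longrightarrow> germ_class x W P = germ_class x N (oper_on N P)"
  by (intro germ_class_eqI rep_restrict germ_eq_restrict)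

lemma germ_eqI:
  assumes "siegel_open N" "x \<in> N" "N \<subseteq> W \<inter> W'" "icong N (oper_on N P) (oper_on N Q)" shows "germ_eq x W P W' Q"
  using assms unfolding germ_eq_def by blast

lemma germ_eqE:
  assumes "germ_eq x W P W' Q"
  obtains N where "siegel_open N" "x \<in> N" "N \<subseteq> W" "N \<subseteq> W'" "icong N (oper_on N P) (oper_on N Q)"
  using assms unfolding germ_eq_def by blast

text \<open>The operations on stalks are unions over all representatives. If the result does not
  depend on the representative, the union is that result, since every class contains at least its
  defining pair.\<close>

lemma UN_germ_class:
  assumes P: "rep x W P"
    and G: "\<And>W' Q. rep x W' Q \<Longrightarrow> germ_eq x W P W' Q \<Longrightarrow> G W' Q = C"
  shows "(\<Union>(W', Q)\<in>germ_class x W P. G W' Q) = C"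
proof -
  have "(\<Union>(W', Q)\<in>germ_class x W P. G W' Q) = (\<Union>p\<in>germ_class x W P. C)"
    using G by (intro SUP_cong refl) (auto simp: germ_class_iff[OF P])
  then show ?thesis using germ_class_self[OF P] by auto
qed

abbreviation M_add :: "'n::{finite,linorder} msect \<Rightarrow> 'n msect \<Rightarrow> 'n msect" where "M_add \<equiv> vadd M_sheaf"
abbreviation M_scl :: "complex \<Rightarrow> 'n::{finite,linorder} msect \<Rightarrow> 'n msect" where "M_scl \<equiv> vscl M_sheaf"

text \<open>The operation inside \<open>M_act\<close>. It does not mention the open set of the
  section: each representative is multiplied by the operator of y over its own domain.\<close>

definition M_rmult :: "'n::{finite,linorder} evec \<Rightarrow> 'n msect \<Rightarrow> 'n msect" where
  "M_rmult y s = (\<lambda>x. \<Union>(W, Q)\<in>s x. germ_class x W (Q \<otimes>\<^bsub>oper_alg W\<^esub> D_half W y))"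

lemma rep_ops:
  assumes "rep x N P" "rep x N Q"
  shows "rep x N (P \<oplus>\<^bsub>oper_alg N\<^esub> Q)" "rep x N (P \<otimes>\<^bsub>oper_alg N\<^esub> Q)" "rep x N (c \<odot>\<^bsub>oper_alg N\<^esub> P)"
    "rep x N (P \<otimes>\<^bsub>oper_alg N\<^esub> D_half N y)"
  using assms by (auto simp: rep_def diff_ops_add diff_ops_mult diff_ops_smult diff_ops_D_half)

lemma rep_carrier: "rep x N P \<Longrightarrow> P \<in> carrier (oper_alg N)"
  by (simp add: rep_def diff_ops_carrier)

lemma oper_on_id: "rep x N P \<Longrightarrow> oper_on N P = P"
  using rep_carrier O.sheaf_End_normal by blast

lemma M_add_germ:
  assumes s: "s x = germ_class x N P" and t: "t x = germ_class x N Q" and P: "rep x N P" and Q: "rep x N Q"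
  shows "M_add s t x = germ_class x N (P \<oplus>\<^bsub>oper_alg N\<^esub> Q)"
proof -
  have "M_add s t x = (\<Union>(W, P')\<in>germ_class x N P. \<Union>(W', Q')\<in>germ_class x N Q. germ_class x (W \<inter> W')
        (oper_on (W \<inter> W') P' \<oplus>\<^bsub>oper_alg (W \<inter> W')\<^esub> oper_on (W \<inter> W') Q'))"
    by (simp add: M_sheaf_def s t)
  also have "\<dots> = germ_class x N (P \<oplus>\<^bsub>oper_alg N\<^esub> Q)"
  proof (rule UN_germ_class[OF P], rule UN_germ_class[OF Q])
    fix W P' W' Q'
    assume P': "rep x W P'" and eP: "germ_eq x N P W P'" and Q': "rep x W' Q'" and eQ: "germ_eq x N Q W' Q'"
    let ?W = "W \<inter> W'"
    have W: "siegel_open ?W" "x \<in> ?W" using P' Q' siegel_open_Int by (auto simp: rep_def)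
    have r: "rep x ?W (oper_on ?W P')" "rep x ?W (oper_on ?W Q')"
      using rep_restrict[OF P' W] rep_restrict[OF Q' W] by auto
    from eP obtain K where K: "siegel_open K" "x \<in> K" "K \<subseteq> N" "K \<subseteq> W" "icong K (oper_on K P) (oper_on K P')" by (rule germ_eqE)
    from eQ obtain L where L: "siegel_open L" "x \<in> L" "L \<subseteq> N" "L \<subseteq> W'" "icong L (oper_on L Q) (oper_on L Q')" by (rule germ_eqE)
    \<comment> \<open>Both congruences restrict to this intersection, which lies in N and in the
      domain of the sum of the other representatives.\<close>
    let ?K = "K \<inter> L"
    have KL: "siegel_open ?K" "x \<in> ?K" "?K \<subseteq> N" "?K \<subseteq> ?W" using K L siegel_open_Int by auto
    have KWN: "?K \<subseteq> ?W \<inter> N" using KL(3,4) by blast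
    have e1: "oper_on ?K (oper_on ?W P' \<oplus>\<^bsub>oper_alg ?W\<^esub> oper_on ?W Q') = oper_on ?K P' \<oplus>\<^bsub>oper_alg ?K\<^esub> oper_on ?K Q'"
      by (simp only: O.sheaf_End_restrict(2)[OF KL(4)] on_sect_on_sect[OF KL(4)])
    have e2: "oper_on ?K (P \<oplus>\<^bsub>oper_alg N\<^esub> Q) = oper_on ?K P \<oplus>\<^bsub>oper_alg ?K\<^esub> oper_on ?K Q"
      by (rule O.sheaf_End_restrict(2)[OF KL(3)])
    have iP: "icong ?K (oper_on ?K P) (oper_on ?K P')"
      using icong_restrict[OF K(1,5) KL(1)] by (simp only: on_sect_on_sect Int_lower1)
    have iQ: "icong ?K (oper_on ?K Q) (oper_on ?K Q')"
      using icong_restrict[OF L(1,5) KL(1)] by (simp only: on_sect_on_sect Int_lower2)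
    have "icong ?K (oper_on ?K P' \<oplus>\<^bsub>oper_alg ?K\<^esub> oper_on ?K Q') (oper_on ?K P \<oplus>\<^bsub>oper_alg ?K\<^esub> oper_on ?K Q)"
      by (rule icong_sym[OF KL(1) icong_add[OF KL(1) iP iQ]])
    then have "germ_eq x ?W (oper_on ?W P' \<oplus>\<^bsub>oper_alg ?W\<^esub> oper_on ?W Q') N (P \<oplus>\<^bsub>oper_alg N\<^esub> Q)"
      unfolding e1[symmetric] e2[symmetric] by (rule germ_eqI[OF KL(1,2) KWN])
    then show "germ_class x ?W (oper_on ?W P' \<oplus>\<^bsub>oper_alg ?W\<^esub> oper_on ?W Q') = germ_class x N (P \<oplus>\<^bsub>oper_alg N\<^esub> Q)"
      by (rule germ_class_eqI[OF rep_ops(1)[OF r] rep_ops(1)[OF P Q]])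
  qed
  finally show ?thesis .
qed

lemma M_scl_germ:
  assumes s: "s x = germ_class x N P" and P: "rep x N P"
  shows "M_scl c s x = germ_class x N (c \<odot>\<^bsub>oper_alg N\<^esub> P)"
proof -
  have "M_scl c s x = (\<Union>(W, P')\<in>germ_class x N P. germ_class x W (c \<odot>\<^bsub>oper_alg W\<^esub> P'))"
    by (simp add: M_sheaf_def s)
  also have "\<dots> = germ_class x N (c \<odot>\<^bsub>oper_alg N\<^esub> P)"
  proof (rule UN_germ_class[OF P])
    fix W P' assume P': "rep x W P'" and eP: "germ_eq x N P W P'"
    from eP obtain K where K: "siegel_open K" "x \<in> K" "K \<subseteq> N" "K \<subseteq> W" "icong K (oper_on K P) (oper_on K P')" by (rule germ_eqE)
    have "germ_eq x N (c \<odot>\<^bsub>oper_alg N\<^esub> P) W (c \<odot>\<^bsub>oper_alg W\<^esub> P')"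
      using K icong_smult[OF K(1,5), of c] by (intro germ_eqI[of K]) (simp_all add: O.sheaf_End_restrict(4))
    then show "germ_class x W (c \<odot>\<^bsub>oper_alg W\<^esub> P') = germ_class x N (c \<odot>\<^bsub>oper_alg N\<^esub> P)"
      by (rule germ_class_eqI[OF rep_ops(3)[OF P' P'] rep_ops(3)[OF P P] germ_eq_sym])
  qed
  finally show ?thesis .
qed

lemma M_rmult_germ:
  assumes s: "s x = germ_class x N P" and P: "rep x N P"
  shows "M_rmult y s x = germ_class x N (P \<otimes>\<^bsub>oper_alg N\<^esub> D_half N y)"
proof -
  have "M_rmult y s x = (\<Union>(W, P')\<in>germ_class x N P. germ_class x W (P' \<otimes>\<^bsub>oper_alg W\<^esub> D_half W y))"
    by (simp add: M_rmult_def s)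
  also have "\<dots> = germ_class x N (P \<otimes>\<^bsub>oper_alg N\<^esub> D_half N y)"
  proof (rule UN_germ_class[OF P])
    fix W P' assume P': "rep x W P'" and eP: "germ_eq x N P W P'"
    from eP obtain K where K: "siegel_open K" "x \<in> K" "K \<subseteq> N" "K \<subseteq> W" "icong K (oper_on K P) (oper_on K P')" by (rule germ_eqE)
    have "germ_eq x N (P \<otimes>\<^bsub>oper_alg N\<^esub> D_half N y) W (P' \<otimes>\<^bsub>oper_alg W\<^esub> D_half W y)"
      using K icong_D_half[OF K(1,5), of y] P P'
      by (intro germ_eqI[of K])
        (simp_all add: O.sheaf_End_restrict(3) D_half_carrier oper_on_D_half rep_def)
    then show "germ_class x W (P' \<otimes>\<^bsub>oper_alg W\<^esub> D_half W y) = germ_class x N (P \<otimes>\<^bsub>oper_alg N\<^esub> D_half N y)"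
      by (rule germ_class_eqI[OF rep_ops(4)[OF P' P'] rep_ops(4)[OF P P] germ_eq_sym])
  qed
  finally show ?thesis .
qed

text \<open>The definition multiplies over the intersection of U with the domain of the
  representative; for N inside U this is N itself.\<close>

lemma M_lmult_germ:
  assumes s: "s x = germ_class x N P" and P: "rep x N P" and U: "siegel_open U" and R: "R \<in> diff_ops U" and NU: "N \<subseteq> U"
  shows "M_lmult U R s x = germ_class x N (oper_on N R \<otimes>\<^bsub>oper_alg N\<^esub> P)"
proof -
  have RU: "rep x U R" using P R U NU by (auto simp: rep_def)
  have RN: "rep x N (oper_on N R)" using P NU by (intro rep_restrict[OF RU]) (auto simp: rep_def)
  have "M_lmult U R s x = (\<Union>(W, P')\<in>germ_class x N P. germ_class x (U \<inter> W) (oper_on (U \<inter> W) R \<otimes>\<^bsub>oper_alg (U \<inter> W)\<^esub> oper_on (U \<inter> W) P'))"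
    by (simp add: M_lmult_def s)
  also have "\<dots> = germ_class x N (oper_on N R \<otimes>\<^bsub>oper_alg N\<^esub> P)"
  proof (rule UN_germ_class[OF P])
    fix W P' assume P': "rep x W P'" and eP: "germ_eq x N P W P'"
    let ?W = "U \<inter> W"
    have W: "siegel_open ?W" "x \<in> ?W" using RU P' siegel_open_Int by (auto simp: rep_def)
    have r: "rep x ?W (oper_on ?W R)" "rep x ?W (oper_on ?W P')"
      using rep_restrict[OF RU W] rep_restrict[OF P' W] by auto
    from eP obtain K where K: "siegel_open K" "x \<in> K" "K \<subseteq> N" "K \<subseteq> W" "icong K (oper_on K P) (oper_on K P')" by (rule germ_eqE)
    have KW: "K \<subseteq> ?W" and KU: "K \<subseteq> U" using K NU by auto
    have RK: "oper_on K R \<in> diff_ops K" by (rule diff_ops_restrict[OF U K(1) KU R])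
    have e1: "oper_on K (oper_on N R \<otimes>\<^bsub>oper_alg N\<^esub> P) = oper_on K R \<otimes>\<^bsub>oper_alg K\<^esub> oper_on K P"
      by (simp add: O.sheaf_End_restrict(3)[OF K(3) rep_carrier[OF P]] on_sect_on_sect[OF K(3)])
    have e2: "oper_on K (oper_on ?W R \<otimes>\<^bsub>oper_alg ?W\<^esub> oper_on ?W P') = oper_on K R \<otimes>\<^bsub>oper_alg K\<^esub> oper_on K P'"
      by (simp add: O.sheaf_End_restrict(3)[OF KW rep_carrier[OF r(2)]] on_sect_on_sect[OF KW])
    have KNW: "K \<subseteq> N \<inter> ?W" using K(3) KW by blast
    have "germ_eq x N (oper_on N R \<otimes>\<^bsub>oper_alg N\<^esub> P) ?W (oper_on ?W R \<otimes>\<^bsub>oper_alg ?W\<^esub> oper_on ?W P')"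
      using icong_lmult[OF K(1,5) RK] unfolding e1[symmetric] e2[symmetric] by (rule germ_eqI[OF K(1,2) KNW])
    then show "germ_class x ?W (oper_on ?W R \<otimes>\<^bsub>oper_alg ?W\<^esub> oper_on ?W P') = germ_class x N (oper_on N R \<otimes>\<^bsub>oper_alg N\<^esub> P)"
      by (rule germ_class_eqI[OF rep_ops(2)[OF r] rep_ops(2)[OF RN P] germ_eq_sym])
  qed
  finally show ?thesis .
qed

section \<open>Sections of the quotient sheaf through their local representatives\<close>

abbreviation M_sect :: "'n::{finite,linorder} cmat set \<Rightarrow> 'n msect set" where "M_sect \<equiv> sect M_sheaf"

text \<open>One operator represents s at every point of W, so identities of operators over W
  transfer to all the germs at once.\<close>

definition local_rep :: "'n::{finite,linorder} msect \<Rightarrow> 'n cmat set \<Rightarrow> 'n oper \<Rightarrow> bool" where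
  "local_rep s W P \<longleftrightarrow> siegel_open W \<and> P \<in> diff_ops W \<and> (\<forall>y\<in>W. s y = germ_class y W P)"

lemma local_rep_rep: "local_rep s W P \<Longrightarrow> x \<in> W \<Longrightarrow> rep x W P"
  and local_rep_germ: "local_rep s W P \<Longrightarrow> x \<in> W \<Longrightarrow> s x = germ_class x W P"
  by (auto simp: local_rep_def rep_def)

lemma local_rep_restrict:
  assumes "local_rep s W P" "siegel_open N" "N \<subseteq> W" shows "local_rep s N (oper_on N P)"
  unfolding local_rep_def
proof (intro conjI ballI)
  show "siegel_open N" "oper_on N P \<in> diff_ops N"
    using assms diff_ops_restrict by (auto simp: local_rep_def)
  fix y assume y: "y \<in> N"
  then have yW: "y \<in> W" using assms(3) by blast
  show "s y = germ_class y N (oper_on N P)"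
    unfolding local_rep_germ[OF assms(1) yW] by (rule germ_class_restrict[OF local_rep_rep[OF assms(1) yW] assms(2) y assms(3)])
qed

lemma M_sect_iff:
  "s \<in> M_sect U \<longleftrightarrow> (\<forall>x. x \<notin> U \<longrightarrow> s x = {}) \<and> (\<forall>x\<in>U. \<exists>W P. x \<in> W \<and> W \<subseteq> U \<and> local_rep s W P)"
proof -
  have "(siegel_open W \<and> x \<in> W \<and> W \<subseteq> U \<and> P \<in> diff_ops W \<and> (\<forall>y\<in>W. s y = germ_class y W P)) \<longleftrightarrow>
      (x \<in> W \<and> W \<subseteq> U \<and> local_rep s W P)" for x W P
    unfolding local_rep_def by blast
  then show ?thesis by (simp only: M_sheaf_def vsheaf.simps mem_Collect_eq)
qed

lemma M_sect_outside: "s \<in> M_sect U \<Longrightarrow> x \<notin> U \<Longrightarrow> s x = {}"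
  by (simp add: M_sect_iff)

lemma M_sect_local:
  assumes "s \<in> M_sect U" "x \<in> U"
  obtains W P where "x \<in> W" "W \<subseteq> U" "siegel_open W" "local_rep s W P"
  using assms unfolding M_sect_iff local_rep_def by blast

lemma M_sect_local2:
  assumes "s \<in> M_sect U" "t \<in> M_sect U" "x \<in> U"
  obtains W P Q where "x \<in> W" "W \<subseteq> U" "siegel_open W" "local_rep s W P" "local_rep t W Q"
proof -
  obtain W P where W: "x \<in> W" "W \<subseteq> U" "siegel_open W" "local_rep s W P" using M_sect_local[OF assms(1,3)] by blast
  obtain W' Q where W': "x \<in> W'" "W' \<subseteq> U" "siegel_open W'" "local_rep t W' Q" using M_sect_local[OF assms(2,3)] by blast
  have o: "siegel_open (W \<inter> W')" by (rule siegel_open_Int[OF W(3) W'(3)])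
  show thesis
    by (rule that[OF _ _ o local_rep_restrict[OF W(4) o Int_lower1] local_rep_restrict[OF W'(4) o Int_lower2]])
      (use W W' in auto)
qed

lemma M_sect_local3:
  assumes "s \<in> M_sect U" "t \<in> M_sect U" "u \<in> M_sect U" "x \<in> U"
  obtains W P Q R where "x \<in> W" "W \<subseteq> U" "siegel_open W" "local_rep s W P" "local_rep t W Q" "local_rep u W R"
proof -
  obtain W P Q where W: "x \<in> W" "W \<subseteq> U" "siegel_open W" "local_rep s W P" "local_rep t W Q"
    using M_sect_local2[OF assms(1,2,4)] by blast
  obtain W' R where W': "x \<in> W'" "W' \<subseteq> U" "siegel_open W'" "local_rep u W' R" using M_sect_local[OF assms(3,4)] by blast
  have o: "siegel_open (W \<inter> W')" by (rule siegel_open_Int[OF W(3) W'(3)])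
  show thesis
    by (rule that[OF _ _ o local_rep_restrict[OF W(4) o Int_lower1] local_rep_restrict[OF W(5) o Int_lower1] local_rep_restrict[OF W'(4) o Int_lower2]])
      (use W W' in auto)
qed

lemma M_sectI:
  assumes "\<And>x. x \<notin> U \<Longrightarrow> s x = {}" "\<And>x. x \<in> U \<Longrightarrow> \<exists>W P. x \<in> W \<and> W \<subseteq> U \<and> local_rep s W P"
  shows "s \<in> M_sect U"
  using assms by (simp add: M_sect_iff)

lemma local_rep_add:
  assumes "local_rep s W P" "local_rep t W Q" shows "local_rep (M_add s t) W (P \<oplus>\<^bsub>oper_alg W\<^esub> Q)"
proof -
  have "M_add s t y = germ_class y W (P \<oplus>\<^bsub>oper_alg W\<^esub> Q)" if "y \<in> W" for y
    by (rule M_add_germ[where s = s and t = t and x = y, OF local_rep_germ[OF assms(1) that] local_rep_germ[OF assms(2) that]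
          local_rep_rep[OF assms(1) that] local_rep_rep[OF assms(2) that]])
  then show ?thesis using assms by (simp add: local_rep_def diff_ops_add)
qed

lemma local_rep_scl:
  assumes "local_rep s W P" shows "local_rep (M_scl c s) W (c \<odot>\<^bsub>oper_alg W\<^esub> P)"
proof -
  have "M_scl c s y = germ_class y W (c \<odot>\<^bsub>oper_alg W\<^esub> P)" if "y \<in> W" for y
    by (rule M_scl_germ[where s = s and x = y, OF local_rep_germ[OF assms that] local_rep_rep[OF assms that]])
  then show ?thesis using assms by (simp add: local_rep_def diff_ops_smult)
qed

lemma local_rep_rmult:
  assumes "local_rep s W P" shows "local_rep (M_rmult z s) W (P \<otimes>\<^bsub>oper_alg W\<^esub> D_half W z)"
proof -
  have "M_rmult z s y = germ_class y W (P \<otimes>\<^bsub>oper_alg W\<^esub> D_half W z)" if "y \<in> W" for y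
    by (rule M_rmult_germ[where s = s and x = y, OF local_rep_germ[OF assms that] local_rep_rep[OF assms that]])
  then show ?thesis using assms by (simp add: local_rep_def diff_ops_mult diff_ops_D_half)
qed

lemma local_rep_lmult:
  assumes "local_rep s W P" "siegel_open U" "W \<subseteq> U" "R \<in> diff_ops U"
  shows "local_rep (M_lmult U R s) W (oper_on W R \<otimes>\<^bsub>oper_alg W\<^esub> P)"
proof -
  have "M_lmult U R s y = germ_class y W (oper_on W R \<otimes>\<^bsub>oper_alg W\<^esub> P)" if "y \<in> W" for y
    using M_lmult_germ[where s = s and x = y, OF local_rep_germ[OF assms(1) that] local_rep_rep[OF assms(1) that] assms(2,4,3)] .
  then show ?thesis using assms by (simp add: local_rep_def diff_ops_mult diff_ops_restrict)
qed

lemma M_rest: "rest M_sheaf W s = (\<lambda>x. if x \<in> W then s x else {})"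
  by (simp add: M_sheaf_def)

lemma M_ops_empty:
  "s x = {} \<Longrightarrow> M_add s t x = {}" "s x = {} \<Longrightarrow> M_scl c s x = {}" "s x = {} \<Longrightarrow> M_rmult y s x = {}"
  "s x = {} \<Longrightarrow> M_lmult U R s x = {}"
  unfolding M_sheaf_def M_rmult_def M_lmult_def by simp_all

lemma M_closed:
  assumes U: "siegel_open U" and s: "s \<in> M_sect U"
  shows M_scl_closed: "M_scl c s \<in> M_sect U"
    and M_rmult_closed: "M_rmult y s \<in> M_sect U"
    and M_lmult_closed: "R \<in> diff_ops U \<Longrightarrow> M_lmult U R s \<in> M_sect U"
    and M_add_closed: "t \<in> M_sect U \<Longrightarrow> M_add s t \<in> M_sect U"
proof -
  show "M_scl c s \<in> M_sect U"
  proof (rule M_sectI)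
    fix x assume "x \<in> U"
    then obtain W P where W: "x \<in> W" "W \<subseteq> U" "local_rep s W P" by (rule M_sect_local[OF s])
    show "\<exists>W P. x \<in> W \<and> W \<subseteq> U \<and> local_rep (M_scl c s) W P" using W(1,2) local_rep_scl[OF W(3)] by blast
  qed (simp add: M_ops_empty M_sect_outside[OF s])
  show "M_rmult y s \<in> M_sect U"
  proof (rule M_sectI)
    fix x assume "x \<in> U"
    then obtain W P where W: "x \<in> W" "W \<subseteq> U" "local_rep s W P" by (rule M_sect_local[OF s])
    show "\<exists>W P. x \<in> W \<and> W \<subseteq> U \<and> local_rep (M_rmult y s) W P" using W(1,2) local_rep_rmult[OF W(3)] by blast
  qed (simp add: M_ops_empty M_sect_outside[OF s])
  show "M_lmult U R s \<in> M_sect U" if R: "R \<in> diff_ops U"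
  proof (rule M_sectI)
    fix x assume "x \<in> U"
    then obtain W P where W: "x \<in> W" "W \<subseteq> U" "local_rep s W P" by (rule M_sect_local[OF s])
    show "\<exists>W P. x \<in> W \<and> W \<subseteq> U \<and> local_rep (M_lmult U R s) W P" using W(1,2) local_rep_lmult[OF W(3) U W(2) R] by blast
  qed (simp add: M_ops_empty M_sect_outside[OF s])
  show "M_add s t \<in> M_sect U" if t: "t \<in> M_sect U"
  proof (rule M_sectI)
    fix x assume "x \<in> U"
    then obtain W P Q where W: "x \<in> W" "W \<subseteq> U" "local_rep s W P" "local_rep t W Q" by (rule M_sect_local2[OF s t])
    show "\<exists>W P. x \<in> W \<and> W \<subseteq> U \<and> local_rep (M_add s t) W P" using W(1,2) local_rep_add[OF W(3,4)] by blast
  qed (simp add: M_ops_empty M_sect_outside[OF s])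
qed

text \<open>Near each point the sections s, t and u are given by operators on a common open set, and
  both sides only have to be given there by the same operator. Laws of the presheaf thereby become
  laws of the operator algebra. Laws with fewer variables repeat an argument.\<close>

lemma M_eqI:
  assumes s: "s \<in> M_sect U" and t: "t \<in> M_sect U" and u: "u \<in> M_sect U"
    and out: "\<And>x. x \<notin> U \<Longrightarrow> l x = r x"
    and eq: "\<And>W P Q R. siegel_open W \<Longrightarrow> W \<subseteq> U \<Longrightarrow> local_rep s W P \<Longrightarrow> local_rep t W Q \<Longrightarrow> local_rep u W R \<Longrightarrow>
      P \<in> carrier (oper_alg W) \<Longrightarrow> Q \<in> carrier (oper_alg W) \<Longrightarrow> R \<in> carrier (oper_alg W) \<Longrightarrow>
      \<exists>A. local_rep l W A \<and> local_rep r W A"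
  shows "l = (r :: 'n::{finite,linorder} msect)"
proof
  fix x
  show "l x = r x"
  proof (cases "x \<in> U")
    case True
    obtain W P Q R where W: "x \<in> W" "W \<subseteq> U" "siegel_open W" "local_rep s W P" "local_rep t W Q" "local_rep u W R"
      using M_sect_local3[OF s t u True] by blast
    then have c: "P \<in> carrier (oper_alg W)" "Q \<in> carrier (oper_alg W)" "R \<in> carrier (oper_alg W)"
      using diff_ops_carrier by (auto simp: local_rep_def)
    from eq[OF W(3,2,4,5,6) c] obtain A where A: "local_rep l W A" "local_rep r W A" by blast
    show ?thesis unfolding local_rep_germ[OF A(1) W(1)] local_rep_germ[OF A(2) W(1)] ..
  qed (rule out)
qed

lemma vpresheaf_M: "vpresheaf (M_sheaf :: ('n::{finite,linorder} cmat, 'n msect) vsheaf)"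
proof
  fix V :: "'n cmat set" and s :: "'n msect" and c :: complex
  assume V: "siegel_open V" and s: "s \<in> M_sect V"
  note out = M_ops_empty M_sect_outside[OF s]
  show "M_scl c s \<in> M_sect V" by (rule M_scl_closed[OF V s])
  show "M_scl (c + d) s = M_add (M_scl c s) (M_scl d s)" for d
  proof (rule M_eqI[OF s s s])
    fix W P assume P: "local_rep s W P" "P \<in> carrier (oper_alg W)"
    show "\<exists>A. local_rep (M_scl (c + d) s) W A \<and> local_rep (M_add (M_scl c s) (M_scl d s)) W A"
      using local_rep_scl[OF P(1), of "c + d"] local_rep_add[OF local_rep_scl[OF P(1)] local_rep_scl[OF P(1)], of c d]
      by (auto simp: OA.smult_add_left[OF P(2)])
  qed (simp add: out)
  show "M_scl c (M_scl d s) = M_scl (c * d) s" for d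
  proof (rule M_eqI[OF s s s])
    fix W P assume P: "local_rep s W P" "P \<in> carrier (oper_alg W)"
    show "\<exists>A. local_rep (M_scl c (M_scl d s)) W A \<and> local_rep (M_scl (c * d) s) W A"
      using local_rep_scl[OF P(1), of "c * d"] local_rep_scl[OF local_rep_scl[OF P(1)], of c d]
      by (auto simp: OA.smult_smult[OF P(2)])
  qed (simp add: out)
  show "M_scl 1 s = s"
  proof (rule M_eqI[OF s s s])
    fix W P assume P: "local_rep s W P" "P \<in> carrier (oper_alg W)"
    show "\<exists>A. local_rep (M_scl 1 s) W A \<and> local_rep s W A"
      using local_rep_scl[OF P(1), of 1] P by auto
  qed (simp add: out)
  {
    fix W :: "'n cmat set" assume W: "siegel_open W" "W \<subseteq> V"
    show "rest M_sheaf W s \<in> M_sect W"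
    proof (rule M_sectI)
      fix x assume x: "x \<in> W"
      then have "x \<in> V" using W(2) by blast
      then obtain N P where N: "x \<in> N" "siegel_open N" "local_rep s N P" by (rule M_sect_local[OF s])
      have o: "siegel_open (N \<inter> W)" by (rule siegel_open_Int[OF N(2) W(1)])
      have "local_rep (rest M_sheaf W s) (N \<inter> W) (oper_on (N \<inter> W) P)"
        using local_rep_restrict[OF N(3) o Int_lower1] by (auto simp: local_rep_def M_rest)
      then show "\<exists>N P. x \<in> N \<and> N \<subseteq> W \<and> local_rep (rest M_sheaf W s) N P"
        using x N(1) by (intro exI[of _ "N \<inter> W"] exI[of _ "oper_on (N \<inter> W) P"]) simp
    qed (simp add: M_rest)
    show "rest M_sheaf W (M_scl c s) = M_scl c (rest M_sheaf W s)"
      unfolding M_rest by (rule ext) (simp add: M_sheaf_def)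
    show "rest M_sheaf W (M_add s t) = M_add (rest M_sheaf W s) (rest M_sheaf W t)" for t
      unfolding M_rest by (rule ext) (simp add: M_sheaf_def)
  }
  fix t :: "'n msect" assume t: "t \<in> M_sect V"
  note out = out M_sect_outside[OF t]
  show "M_add s t \<in> M_sect V" by (rule M_add_closed[OF V s t])
  show "M_add s t = M_add t s"
  proof (rule M_eqI[OF s t t])
    fix W P Q assume P: "local_rep s W P" "P \<in> carrier (oper_alg W)" and Q: "local_rep t W Q" "Q \<in> carrier (oper_alg W)"
    show "\<exists>A. local_rep (M_add s t) W A \<and> local_rep (M_add t s) W A"
      using local_rep_add[OF P(1) Q(1)] local_rep_add[OF Q(1) P(1)] by (auto simp: OA.a_comm[OF P(2) Q(2)])
  qed (simp add: out)
  show "M_add s (M_scl 0 t) = s"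
  proof (rule M_eqI[OF s t t])
    fix W P Q assume P: "local_rep s W P" "P \<in> carrier (oper_alg W)" and Q: "local_rep t W Q" "Q \<in> carrier (oper_alg W)"
    show "\<exists>A. local_rep (M_add s (M_scl 0 t)) W A \<and> local_rep s W A"
      using local_rep_add[OF P(1) local_rep_scl[OF Q(1)], of 0] P Q(2) by auto
  qed (simp add: out)
  show "M_scl c (M_add s t) = M_add (M_scl c s) (M_scl c t)"
  proof (rule M_eqI[OF s t t])
    fix W P Q assume P: "local_rep s W P" "P \<in> carrier (oper_alg W)" and Q: "local_rep t W Q" "Q \<in> carrier (oper_alg W)"
    show "\<exists>A. local_rep (M_scl c (M_add s t)) W A \<and> local_rep (M_add (M_scl c s) (M_scl c t)) W A"
      using local_rep_scl[OF local_rep_add[OF P(1) Q(1)], of c] local_rep_add[OF local_rep_scl[OF P(1)] local_rep_scl[OF Q(1)], of c c]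
      by (auto simp: OA.smult_add_right[OF P(2) Q(2)])
  qed (simp add: out)
  fix u :: "'n msect" assume u: "u \<in> M_sect V"
  show "M_add (M_add s t) u = M_add s (M_add t u)"
  proof (rule M_eqI[OF s t u])
    fix W P Q R assume P: "local_rep s W P" "P \<in> carrier (oper_alg W)" and Q: "local_rep t W Q" "Q \<in> carrier (oper_alg W)"
      and R: "local_rep u W R" "R \<in> carrier (oper_alg W)"
    show "\<exists>A. local_rep (M_add (M_add s t) u) W A \<and> local_rep (M_add s (M_add t u)) W A"
      using local_rep_add[OF local_rep_add[OF P(1) Q(1)] R(1)] local_rep_add[OF P(1) local_rep_add[OF Q(1) R(1)]]
      by (auto simp: OA.a_assoc[OF P(2) Q(2) R(2)])
  qed (simp add: out)
qed

interpretation MS: vpresheaf M_sheaf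
  by (rule vpresheaf_M)

interpretation MA: calgebra "sheaf_End M_sheaf U" for U :: "'n::{finite,linorder} cmat set"
  by (rule MS.calgebra_sheaf_End)

lemma M_lmult_add:
  assumes U: "siegel_open U" and s: "s \<in> M_sect U" and t: "t \<in> M_sect U" and R: "R \<in> diff_ops U"
  shows "M_lmult U R (M_add s t) = M_add (M_lmult U R s) (M_lmult U R t)"
proof (rule M_eqI[OF s t t])
  fix W P Q assume W: "siegel_open W" "W \<subseteq> U" and P: "local_rep s W P" "P \<in> carrier (oper_alg W)" and Q: "local_rep t W Q" "Q \<in> carrier (oper_alg W)"
  have R': "oper_on W R \<in> carrier (oper_alg W)" using diff_ops_restrict[OF U W R] diff_ops_carrier[OF W(1)] by blast
  show "\<exists>A. local_rep (M_lmult U R (M_add s t)) W A \<and> local_rep (M_add (M_lmult U R s) (M_lmult U R t)) W A"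
    using local_rep_lmult[OF local_rep_add[OF P(1) Q(1)] U W(2) R] local_rep_add[OF local_rep_lmult[OF P(1) U W(2) R] local_rep_lmult[OF Q(1) U W(2) R]]
    by (auto simp: OA.r_distr[OF P(2) Q(2) R'])
qed (simp add: M_ops_empty M_sect_outside[OF s])

lemma M_lmult_scl:
  assumes U: "siegel_open U" and s: "s \<in> M_sect U" and R: "R \<in> diff_ops U"
  shows "M_lmult U R (M_scl c s) = M_scl c (M_lmult U R s)"
proof (rule M_eqI[OF s s s])
  fix W P assume W: "siegel_open W" "W \<subseteq> U" and P: "local_rep s W P" "P \<in> carrier (oper_alg W)"
  have R': "oper_on W R \<in> carrier (oper_alg W)" using diff_ops_restrict[OF U W R] diff_ops_carrier[OF W(1)] by blast
  show "\<exists>A. local_rep (M_lmult U R (M_scl c s)) W A \<and> local_rep (M_scl c (M_lmult U R s)) W A"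
    using local_rep_lmult[OF local_rep_scl[OF P(1)] U W(2) R, of c] local_rep_scl[OF local_rep_lmult[OF P(1) U W(2) R], of c]
    by (auto simp: OA.smult_mult_right[OF R' P(2)])
qed (simp add: M_ops_empty M_sect_outside[OF s])

text \<open>Associativity of the operator algebra: left and right multiplication commute.\<close>

lemma M_lmult_rmult:
  assumes U: "siegel_open U" and s: "s \<in> M_sect U" and R: "R \<in> diff_ops U"
  shows "M_rmult y (M_lmult U R s) = M_lmult U R (M_rmult y s)"
proof (rule M_eqI[OF s s s])
  fix W P assume W: "siegel_open W" "W \<subseteq> U" and P: "local_rep s W P" "P \<in> carrier (oper_alg W)"
  have R': "oper_on W R \<in> carrier (oper_alg W)" using diff_ops_restrict[OF U W R] diff_ops_carrier[OF W(1)] by blast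
  show "\<exists>A. local_rep (M_rmult y (M_lmult U R s)) W A \<and> local_rep (M_lmult U R (M_rmult y s)) W A"
    using local_rep_lmult[OF local_rep_rmult[OF P(1)] U W(2) R, of y] local_rep_rmult[OF local_rep_lmult[OF P(1) U W(2) R], of y]
    by (auto simp: OA.m_assoc[OF R' P(2) D_half_carrier[OF W(1)]])
qed (simp add: M_ops_empty M_sect_outside[OF s])

section \<open>Endomorphisms of the D-module and the action of E by right multiplication\<close>

text \<open>The module endomorphisms form a subalgebra of the sheaf endomorphisms; for sums and
  scalar multiples this uses that left multiplication by an operator is linear on sections.\<close>

lemma calgebra_End_M: "calgebra (End_M :: ('n::{finite,linorder} cmat set \<Rightarrow> 'n msect \<Rightarrow> 'n msect) calg)"
proof -
  let ?E = "sheaf_End M_sheaf (siegel :: 'n cmat set)"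
  let ?S = "{\<phi> \<in> carrier ?E. \<forall>U. siegel_open U \<longrightarrow> (\<forall>P\<in>diff_ops U. \<forall>s\<in>M_sect U.
        \<phi> U (M_lmult U P s) = M_lmult U P (\<phi> U s))}"
  have S: "\<phi> \<in> carrier ?E" and com: "siegel_open U \<Longrightarrow> P \<in> diff_ops U \<Longrightarrow> s \<in> M_sect U \<Longrightarrow> \<phi> U (M_lmult U P s) = M_lmult U P (\<phi> U s)"
    if "\<phi> \<in> ?S" for \<phi> U P s using that by blast+
  have SI: "\<phi> \<in> ?S" if "\<phi> \<in> carrier ?E" "\<And>U P s. siegel_open U \<Longrightarrow> P \<in> diff_ops U \<Longrightarrow> s \<in> M_sect U \<Longrightarrow> \<phi> U (M_lmult U P s) = M_lmult U P (\<phi> U s)" for \<phi>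
    using that by blast
  have cl: "\<phi> U s \<in> M_sect U" if "\<phi> \<in> ?S" "siegel_open U" "s \<in> M_sect U" for \<phi> U s
    using MS.sheaf_EndD(1)[OF S[OF that(1)] that(2) siegel_openD[OF that(2)] that(3)] .
  have "calgebra (?E\<lparr>carrier := ?S\<rparr>)"
  proof (rule MA.calgebra_subalgebra)
    show "?S \<subseteq> carrier ?E" by blast
    show "\<one>\<^bsub>?E\<^esub> \<in> ?S"
    proof (rule SI)
      fix U P and s :: "'n msect" assume *: "siegel_open U" "P \<in> diff_ops U" "s \<in> M_sect U"
      note app = MS.sheaf_End_apply[OF *(1) siegel_openD[OF *(1)]]
      show "\<one>\<^bsub>?E\<^esub> U (M_lmult U P s) = M_lmult U P (\<one>\<^bsub>?E\<^esub> U s)"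
        unfolding app(4)[OF *(3)] app(4)[OF M_lmult_closed[OF *(1,3,2)]] ..
    qed (rule MA.one_closed)
    show "a \<oplus>\<^bsub>?E\<^esub> b \<in> ?S" if ab: "a \<in> ?S" "b \<in> ?S" for a b
    proof (rule SI)
      show "a \<oplus>\<^bsub>?E\<^esub> b \<in> carrier ?E" by (rule MA.add.m_closed[OF S[OF ab(1)] S[OF ab(2)]])
      fix U P and s :: "'n msect" assume *: "siegel_open U" "P \<in> diff_ops U" "s \<in> M_sect U"
      note app = MS.sheaf_End_apply[OF *(1) siegel_openD[OF *(1)]]
      show "(a \<oplus>\<^bsub>?E\<^esub> b) U (M_lmult U P s) = M_lmult U P ((a \<oplus>\<^bsub>?E\<^esub> b) U s)"
        unfolding app(1)[OF *(3)] app(1)[OF M_lmult_closed[OF *(1,3,2)]] com[OF ab(1) *] com[OF ab(2) *]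
        by (rule M_lmult_add[OF *(1) cl[OF ab(1) *(1,3)] cl[OF ab(2) *(1,3)] *(2), symmetric])
    qed
    show "a \<otimes>\<^bsub>?E\<^esub> b \<in> ?S" if ab: "a \<in> ?S" "b \<in> ?S" for a b
    proof (rule SI)
      show "a \<otimes>\<^bsub>?E\<^esub> b \<in> carrier ?E" by (rule MA.m_closed[OF S[OF ab(1)] S[OF ab(2)]])
      fix U P and s :: "'n msect" assume *: "siegel_open U" "P \<in> diff_ops U" "s \<in> M_sect U"
      note app = MS.sheaf_End_apply[OF *(1) siegel_openD[OF *(1)]]
      show "(a \<otimes>\<^bsub>?E\<^esub> b) U (M_lmult U P s) = M_lmult U P ((a \<otimes>\<^bsub>?E\<^esub> b) U s)"
        unfolding app(2)[OF *(3)] app(2)[OF M_lmult_closed[OF *(1,3,2)]] com[OF ab(2) *]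
        by (rule com[OF ab(1) *(1,2) cl[OF ab(2) *(1,3)]])
    qed
    show "c \<odot>\<^bsub>?E\<^esub> a \<in> ?S" if a: "a \<in> ?S" for c a
    proof (rule SI)
      show "c \<odot>\<^bsub>?E\<^esub> a \<in> carrier ?E" by (rule MA.smult_closed[OF S[OF a]])
      fix U P and s :: "'n msect" assume *: "siegel_open U" "P \<in> diff_ops U" "s \<in> M_sect U"
      note app = MS.sheaf_End_apply[OF *(1) siegel_openD[OF *(1)]]
      show "(c \<odot>\<^bsub>?E\<^esub> a) U (M_lmult U P s) = M_lmult U P ((c \<odot>\<^bsub>?E\<^esub> a) U s)"
        unfolding app(3)[OF *(3)] app(3)[OF M_lmult_closed[OF *(1,3,2)]] com[OF a *]
        by (rule M_lmult_scl[OF *(1) cl[OF a *(1,3)] *(2), symmetric])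
    qed
  qed
  then show ?thesis unfolding End_M_def .
qed

interpretation EM: calgebra "End_M :: ('n::{finite,linorder} cmat set \<Rightarrow> 'n msect \<Rightarrow> 'n msect) calg"
  by (rule calgebra_End_M)

lemma M_act_eq: "M_act y = on_sect M_sheaf siegel (\<lambda>U. M_rmult y)"
  by (simp add: M_act_def M_rmult_def[abs_def])

lemma M_act_apply: "siegel_open V \<Longrightarrow> s \<in> M_sect V \<Longrightarrow> M_act y V s = M_rmult y s"
  by (simp add: M_act_eq on_sect_apply siegel_openD)

lemma M_act_sheaf_End: "M_act y \<in> carrier (sheaf_End M_sheaf siegel)"
  unfolding M_act_eq
proof (rule MS.sheaf_EndI)
  fix V :: "'a cmat set" and s assume V: "siegel_open V" and s: "s \<in> M_sect V"
  show "M_rmult y s \<in> M_sect V" by (rule M_rmult_closed[OF V s])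
  show "M_rmult y (M_scl c s) = M_scl c (M_rmult y s)" for c
  proof (rule M_eqI[OF s s s])
    fix W P assume W: "siegel_open W" and P: "local_rep s W P" "P \<in> carrier (oper_alg W)"
    show "\<exists>A. local_rep (M_rmult y (M_scl c s)) W A \<and> local_rep (M_scl c (M_rmult y s)) W A"
      using local_rep_rmult[OF local_rep_scl[OF P(1)], of y c] local_rep_scl[OF local_rep_rmult[OF P(1)], of c y]
      by (auto simp: OA.smult_mult_left[OF P(2) D_half_carrier[OF W]])
  qed (simp add: M_ops_empty M_sect_outside[OF s])
  show "rest M_sheaf W (M_rmult y s) = M_rmult y (rest M_sheaf W s)" for W
    unfolding M_rest by (rule ext) (simp add: M_rmult_def)
  fix t assume t: "t \<in> M_sect V"
  show "M_rmult y (M_add s t) = M_add (M_rmult y s) (M_rmult y t)"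
  proof (rule M_eqI[OF s t t])
    fix W P Q assume W: "siegel_open W" and P: "local_rep s W P" "P \<in> carrier (oper_alg W)" and Q: "local_rep t W Q" "Q \<in> carrier (oper_alg W)"
    show "\<exists>A. local_rep (M_rmult y (M_add s t)) W A \<and> local_rep (M_add (M_rmult y s) (M_rmult y t)) W A"
      using local_rep_rmult[OF local_rep_add[OF P(1) Q(1)], of y] local_rep_add[OF local_rep_rmult[OF P(1)] local_rep_rmult[OF Q(1)], of y y]
      by (auto simp: OA.l_distr[OF P(2) Q(2) D_half_carrier[OF W]])
  qed (simp add: M_ops_empty M_sect_outside[OF s])
qed

lemma M_act_carrier: "M_act y \<in> carrier End_M"
  by (simp add: End_M_def M_act_sheaf_End M_act_apply M_lmult_closed M_lmult_rmult)

lemma End_M_eqI: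
  assumes "\<phi> \<in> carrier End_M" "\<psi> \<in> carrier End_M" "\<And>V s. siegel_open V \<Longrightarrow> s \<in> M_sect V \<Longrightarrow> \<phi> V s = \<psi> V s"
  shows "\<phi> = \<psi>"
  by (rule MS.sheaf_End_eqI[where U = siegel]) (use assms in \<open>auto simp: End_M_def\<close>)

lemma End_M_apply:
  assumes "siegel_open V" "s \<in> M_sect V"
  shows "(\<phi> \<oplus>\<^bsub>End_M\<^esub> \<psi>) V s = M_add (\<phi> V s) (\<psi> V s)" "(\<phi> \<otimes>\<^bsub>End_M\<^esub> \<psi>) V s = \<phi> V (\<psi> V s)"
    "(c \<odot>\<^bsub>End_M\<^esub> \<phi>) V s = M_scl c (\<phi> V s)" "\<one>\<^bsub>End_M\<^esub> V s = s"
  using MS.sheaf_End_apply[OF assms(1) siegel_openD[OF assms(1)] assms(2)] by (simp_all add: End_M_def)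

lemma M_act_linear:
  "M_act (evec_scale a y + evec_scale b z) = a \<odot>\<^bsub>End_M\<^esub> M_act y \<oplus>\<^bsub>End_M\<^esub> b \<odot>\<^bsub>End_M\<^esub> M_act (z :: 'n::{finite,linorder} evec)"
proof (rule End_M_eqI)
  fix V :: "'n cmat set" and s assume V: "siegel_open V" and s: "s \<in> M_sect V"
  have "M_rmult (evec_scale a y + evec_scale b z) s = M_add (M_scl a (M_rmult y s)) (M_scl b (M_rmult z s))"
  proof (rule M_eqI[OF s s s])
    fix W P assume W: "siegel_open W" and P: "local_rep s W P" "P \<in> carrier (oper_alg W)"
    have "P \<otimes>\<^bsub>oper_alg W\<^esub> D_half W (evec_scale a y + evec_scale b z) =
        a \<odot>\<^bsub>oper_alg W\<^esub> (P \<otimes>\<^bsub>oper_alg W\<^esub> D_half W y) \<oplus>\<^bsub>oper_alg W\<^esub> b \<odot>\<^bsub>oper_alg W\<^esub> (P \<otimes>\<^bsub>oper_alg W\<^esub> D_half W z)"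
      using P(2) D_half_carrier[OF W] by (simp add: D_half_linear[OF W] OA.r_distr OA.smult_mult_right)
    then show "\<exists>A. local_rep (M_rmult (evec_scale a y + evec_scale b z) s) W A \<and> local_rep (M_add (M_scl a (M_rmult y s)) (M_scl b (M_rmult z s))) W A"
      using local_rep_rmult[OF P(1), of "evec_scale a y + evec_scale b z"]
        local_rep_add[OF local_rep_scl[OF local_rep_rmult[OF P(1)]] local_rep_scl[OF local_rep_rmult[OF P(1)]], of a y b z] by auto
  qed (simp add: M_ops_empty M_sect_outside[OF s])
  then show "M_act (evec_scale a y + evec_scale b z) V s = (a \<odot>\<^bsub>End_M\<^esub> M_act y \<oplus>\<^bsub>End_M\<^esub> b \<odot>\<^bsub>End_M\<^esub> M_act z) V s"
    by (simp only: End_M_apply[OF V s] M_act_apply[OF V s])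
qed (simp_all add: M_act_carrier)

lemma symp_skew: "symp z y = - symp y z"
  unfolding symp_def sum_negf[symmetric] by (intro sum.cong) auto

text \<open>The two sides are represented by operators that are congruent modulo the ideal but in
  general different, so the germs are compared directly rather than through
  \<open>M_eqI\<close>.\<close>

lemma M_act_comm:
  "M_act y \<otimes>\<^bsub>End_M\<^esub> M_act z \<ominus>\<^bsub>End_M\<^esub> M_act z \<otimes>\<^bsub>End_M\<^esub> M_act (y :: 'n::{finite,linorder} evec) = (symp y z / 2) \<odot>\<^bsub>End_M\<^esub> \<one>\<^bsub>End_M\<^esub>"
proof (rule End_M_eqI)
  fix V :: "'n cmat set" and s assume V: "siegel_open V" and s: "s \<in> M_sect V"
  let ?l = "M_add (M_rmult y (M_rmult z s)) (M_scl (-1) (M_rmult z (M_rmult y s)))" and ?r = "M_scl (symp y z / 2) s"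
  have "?l x = ?r x" for x
  proof (cases "x \<in> V")
    case True
    obtain W P where W: "x \<in> W" "W \<subseteq> V" "siegel_open W" and P: "local_rep s W P" using M_sect_local[OF s True] by blast
    let ?A = "oper_alg W" and ?D = "D_half W"
    have Pd: "P \<in> diff_ops W" using P by (simp add: local_rep_def)
    note c = diff_ops_carrier[OF W(3) Pd] D_half_carrier[OF W(3)]
    let ?L = "P \<otimes>\<^bsub>?A\<^esub> ?D z \<otimes>\<^bsub>?A\<^esub> ?D y \<oplus>\<^bsub>?A\<^esub> (-1) \<odot>\<^bsub>?A\<^esub> (P \<otimes>\<^bsub>?A\<^esub> ?D y \<otimes>\<^bsub>?A\<^esub> ?D z)"
    let ?R = "(symp y z / 2) \<odot>\<^bsub>?A\<^esub> P"
    have L: "local_rep ?l W ?L"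
      by (intro local_rep_add local_rep_scl local_rep_rmult P)
    have R: "local_rep ?r W ?R" by (rule local_rep_scl[OF P])
    \<comment> \<open>Composing the actions of z and then y multiplies P on the right by D_z D_y. So
      \<open>comm_D_half_ideal\<close> enters with z and y exchanged, and the skew-symmetry of
      \<open>symp\<close> produces the plus sign.\<close>
    have "?L \<ominus>\<^bsub>?A\<^esub> ?R = P \<otimes>\<^bsub>?A\<^esub> ((?D z \<otimes>\<^bsub>?A\<^esub> ?D y \<ominus>\<^bsub>?A\<^esub> ?D y \<otimes>\<^bsub>?A\<^esub> ?D z) \<oplus>\<^bsub>?A\<^esub> (symp z y / 2) \<odot>\<^bsub>?A\<^esub> \<one>\<^bsub>?A\<^esub>)"
      using c by (simp add: OA.minus_eq_smult OA.r_distr OA.smult_mult_right OA.m_assoc OA.smult_smult symp_skew[of y z])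
    also have "\<dots> \<in> lap_ideal W"
      by (rule lap_ideal_lmult[OF W(3) Pd comm_D_half_ideal[OF W(3)]])
    finally have "icong W ?L ?R" using L R by (simp add: icong_def local_rep_def)
    then have "icong W (oper_on W ?L) (oper_on W ?R)"
      using oper_on_id[OF local_rep_rep[OF L W(1)]] oper_on_id[OF local_rep_rep[OF R W(1)]] by simp
    then have "germ_eq x W ?L W ?R" by (intro germ_eqI[OF W(3,1)]) simp_all
    then have "germ_class x W ?L = germ_class x W ?R"
      by (rule germ_class_eqI[OF local_rep_rep[OF L W(1)] local_rep_rep[OF R W(1)]])
    then show ?thesis unfolding local_rep_germ[OF L W(1)] local_rep_germ[OF R W(1)] .
  qed (simp add: M_ops_empty M_sect_outside[OF s])
  then have "?l = ?r" by (rule ext)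
  then show "(M_act y \<otimes>\<^bsub>End_M\<^esub> M_act z \<ominus>\<^bsub>End_M\<^esub> M_act z \<otimes>\<^bsub>End_M\<^esub> M_act y) V s = ((symp y z / 2) \<odot>\<^bsub>End_M\<^esub> \<one>\<^bsub>End_M\<^esub>) V s"
    unfolding EM.minus_eq_smult[OF EM.m_closed[OF M_act_carrier M_act_carrier] EM.m_closed[OF M_act_carrier M_act_carrier]]
      End_M_apply[OF V s] M_act_apply[OF V s] M_act_apply[OF V M_rmult_closed[OF V s]] .
qed (simp_all add: M_act_carrier)

theorem proposition4p3p16:
  shows
   "(\<forall>y::'n::{finite,linorder} evec. M_act y \<in> carrier End_M) \<and>
    (\<forall>y z::'n evec.
       M_act y \<otimes>\<^bsub>End_M\<^esub> M_act z \<ominus>\<^bsub>End_M\<^esub> M_act z \<otimes>\<^bsub>End_M\<^esub> M_act y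
         = (symp y z / 2) \<odot>\<^bsub>End_M\<^esub> \<one>\<^bsub>End_M\<^esub>) \<and>
    osp_actions End_M (M_act :: 'n evec \<Rightarrow> _) \<noteq> {} \<and>
    (\<forall>\<rho>\<in>osp_actions End_M (M_act :: 'n evec \<Rightarrow> _). descends End_M \<rho>) \<and>

    (\<forall>y::'n evec. ker_act y \<in> carrier (opposite_alg End_Ker)) \<and>
    (\<forall>y z::'n evec.
       ker_act y \<otimes>\<^bsub>opposite_alg End_Ker\<^esub> ker_act z \<ominus>\<^bsub>opposite_alg End_Ker\<^esub> ker_act z \<otimes>\<^bsub>opposite_alg End_Ker\<^esub> ker_act y
         = (symp y z / 2) \<odot>\<^bsub>opposite_alg End_Ker\<^esub> \<one>\<^bsub>opposite_alg End_Ker\<^esub>) \<and>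
    osp_actions (opposite_alg End_Ker) (ker_act :: 'n evec \<Rightarrow> _) \<noteq> {} \<and>
    (\<forall>\<rho>\<in>osp_actions (opposite_alg End_Ker) (ker_act :: 'n evec \<Rightarrow> _). descends (opposite_alg End_Ker) \<rho>) \<and>

    (\<forall>y::'n evec. ker_act_parity y \<in> carrier End_Ker) \<and>
    (\<forall>y z::'n evec.
       ker_act_parity y \<otimes>\<^bsub>End_Ker\<^esub> ker_act_parity z \<ominus>\<^bsub>End_Ker\<^esub> ker_act_parity z \<otimes>\<^bsub>End_Ker\<^esub> ker_act_parity y
         = (symp y z / 2) \<odot>\<^bsub>End_Ker\<^esub> \<one>\<^bsub>End_Ker\<^esub>) \<and>
    osp_actions End_Ker (ker_act_parity :: 'n evec \<Rightarrow> _) \<noteq> {} \<and>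
    (\<forall>\<rho>\<in>osp_actions End_Ker (ker_act_parity :: 'n evec \<Rightarrow> _). descends End_Ker \<rho>)"
proof -
  interpret OK: calgebra "opposite_alg (End_Ker :: 'n oper calg)" by (rule KA.calgebra_opposite)
  have op: "carrier (opposite_alg A) = carrier A" "x \<otimes>\<^bsub>opposite_alg A\<^esub> y = y \<otimes>\<^bsub>A\<^esub> x" "x \<oplus>\<^bsub>opposite_alg A\<^esub> y = x \<oplus>\<^bsub>A\<^esub> y"
    "c \<odot>\<^bsub>opposite_alg A\<^esub> x = c \<odot>\<^bsub>A\<^esub> x" "\<one>\<^bsub>opposite_alg A\<^esub> = \<one>\<^bsub>A\<^esub>" for A :: "'b calg" and x y c
    by (simp_all add: opposite_alg_def)
  have k_carrier: "ker_act y \<in> carrier (opposite_alg End_Ker)" for y :: "'n evec"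
    unfolding op by (rule ker_act_carrier)
  have k_linear: "ker_act (evec_scale a y + evec_scale b z) =
      a \<odot>\<^bsub>opposite_alg End_Ker\<^esub> ker_act y \<oplus>\<^bsub>opposite_alg End_Ker\<^esub> b \<odot>\<^bsub>opposite_alg End_Ker\<^esub> ker_act z" for a b and y z :: "'n evec"
    unfolding op by (rule ker_act_linear)
  have k_comm: "ker_act y \<otimes>\<^bsub>opposite_alg End_Ker\<^esub> ker_act z \<ominus>\<^bsub>opposite_alg End_Ker\<^esub> ker_act z \<otimes>\<^bsub>opposite_alg End_Ker\<^esub> ker_act y
         = (symp y z / 2) \<odot>\<^bsub>opposite_alg End_Ker\<^esub> \<one>\<^bsub>opposite_alg End_Ker\<^esub>" for y z :: "'n evec"
    using ker_act_comm[of z y]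
    \<comment> \<open>Both differences are written with the scalar -1, whose action the algebra and
      its opposite share; unfolding the opposite product then identifies the two statements.\<close>
    unfolding OK.minus_eq_smult[OF OK.m_closed[OF k_carrier k_carrier] OK.m_closed[OF k_carrier k_carrier]]
      KA.minus_eq_smult[OF KA.m_closed[OF ker_act_carrier ker_act_carrier] KA.m_closed[OF ker_act_carrier ker_act_carrier]]
    unfolding op .
  note M = osp_actions_descend[OF EM.calgebra_axioms M_act_carrier M_act_linear M_act_comm]
    and K = osp_actions_descend[OF OK.calgebra_axioms k_carrier k_linear k_comm]
    and P = osp_actions_descend[OF KA.calgebra_axioms ker_act_parity_carrier ker_act_parity_linear ker_act_parity_comm]
  show ?thesis
    by (intro conjI allI M_act_carrier M_act_comm k_carrier k_comm ker_act_parity_carrier ker_act_parity_comm M K P)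
qed

end
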